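(* Let $\phi$ be a finite Blaschke product, let $\mathcal A_\phi=\{M_\phi\}'\cap\{M_\phi^*\}'$, and let $q$ be the number of connected components of the Riemann surface $S_\phi$ of $\phi^{-1}\circ\phi$ over $\mathbb D$. Let $\mathcal E_1,\dots,\mathcal E_q$ be the bounded operators on $L^2_a$ determined by $$(\mathcal E_k f)(z)=\sum_{\rho\in G_{i_k}}\rho'(z)\,f(\rho(z)),\qquad z\in E,\ f\in L^2_a .$$ Then the von Neumann algebra $\mathcal A_\phi$ is generated by the linearly independent operators $\mathcal E_1,\dots,\mathcal E_q$, and hence has dimension $q$.
   Context: $\mathbb D$ is the open unit disk, $dA$ is normalized area measure on $\mathbb D$, and $L^2_a$ is the Bergman space of analytic functions in $L^2(\mathbb D,dA)$. A (finite) Blaschke product of order $n$ is $\phi(z)=\prod_{j=1}^n\frac{z-a_j}{1-\overline{a}_jz}$ with $a_j\in\mathbb D$. $M_\phi h=\phi h$ on $L^2_a$. For a bounded operator $T$, $\{T\}'$ is its commutant, i.e. the set of bounded operators on $L^2_a$ commuting with $T$. Let $\mathcal C$ be the set of critical points of $\phi$ in $\mathbb D$ (a finite set), $\mathcal F=\mathbb D\cap\phi^{-1}(\phi(\mathcal C))$ (a finite set) and $E=\mathbb D\setminus\mathcal F$. A local inverse of $\phi$ on an open set $V\subset\mathbb D$ is an analytic $\rho:V\to\mathbb D$ with $\phi\circ\rho=\phi$ on $V$. Near every point $z_0\in E$ there are exactly $n$ distinct local inverses $\rho_1,\dots,\rho_n$, with $\rho_1(z)=z$; their values are pairwise distinct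 at each point, and each can be analytically continued along every curve in $E$. Write $\rho\sim\hat\rho$ if $\hat\rho$ is obtained from $\rho$ by analytic continuation along some loop in $E$ based at $z_0$; this is an equivalence relation on $\{\rho_1,\dots,\rho_n\}$, whose classes are denoted $G_{i_1},\dots,G_{i_q}$. The set of germs $G_{i_k}$ can be continued to every point of $E$, and the resulting set does not depend on the path, so the sum defining $\mathcal E_kf$ is a well-defined single-valued function on $E$; it is analytic and extends to a function in $L^2_a$. The Riemann surface $S_\phi$ of $\phi^{-1}\circ\phi$ over $\mathbb D$ is the $n$-sheeted branched cover of $\mathbb D$ obtained by completing, over the points of $\mathcal F$, the $n$-sheeted unbranched cover $\{(w,z): z\in E,\ w\in\mathbb D,\ \phi(w)=\phi(z)\}\to E$, $(w,z)\mapsto z$. Its number of connected components is the number of connected components of this unbranched cover, which equals the number $q$ of classes $G_{i_k}$. *)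

theory Defs
  imports "HOL-Complex_Analysis.Complex_Analysis" "HOL-Library.Function_Algebras"
begin

section \<open>The Bergman space\<close>

definition disk_area :: "complex measure" where
  "disk_area = uniform_measure lborel (ball 0 1)"

text \<open>Elements are total functions; the value \<open>0\<close> outside the disk makes the
  representation unique, so that equality in the type is equality on the disk.\<close>

definition bergman_set :: "(complex \<Rightarrow> complex) set" where
  "bergman_set = {f. f holomorphic_on ball 0 1 \<and> integrable disk_area (\<lambda>z. (cmod (f z))\<^sup>2) \<and>
     (\<forall>z. z \<notin> ball 0 1 \<longrightarrow> f z = 0)}"

lemma bergman_set_measurable:
  assumes "f \<in> bergman_set" shows "f \<in> borel_measurable borel"
proof -
  have "(\<lambda>z. if z \<in> ball 0 1 then f z else 0) \<in> borel_measurable borel"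
    using assms
    by (intro borel_measurable_continuous_on_if)
       (auto simp: bergman_set_def holomorphic_on_imp_continuous_on)
  moreover have "(\<lambda>z. if z \<in> ball 0 1 then f z else 0) = f"
    using assms by (auto simp: bergman_set_def)
  ultimately show ?thesis by simp
qed

lemma measurable_disk_area [simp]: "f \<in> borel_measurable disk_area \<longleftrightarrow> f \<in> borel_measurable borel"
  by (simp add: disk_area_def measurable_def)

lemma zero_in_bergman_set: "(\<lambda>_. 0) \<in> bergman_set"
  by (simp add: bergman_set_def)

lemma cmult_in_bergman_set:
  assumes "f \<in> bergman_set" shows "(\<lambda>z. c * f z) \<in> bergman_set"
  using assms by (auto simp: bergman_set_def norm_mult power_mult_distrib intro!: holomorphic_intros)

lemma add_in_bergman_set:
  assumes f: "f \<in> bergman_set" and g: "g \<in> bergman_set"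
  shows "(\<lambda>z. f z + g z) \<in> bergman_set"
proof -
  note [measurable] = bergman_set_measurable[OF f] bergman_set_measurable[OF g]
  have "integrable disk_area (\<lambda>z. (cmod (f z + g z))\<^sup>2)"
  proof (rule Bochner_Integration.integrable_bound)
    show "integrable disk_area (\<lambda>z. 2 * (cmod (f z))\<^sup>2 + 2 * (cmod (g z))\<^sup>2)"
      using f g by (auto simp: bergman_set_def)
    show "(\<lambda>z. (cmod (f z + g z))\<^sup>2) \<in> borel_measurable disk_area"
      by (simp only: measurable_disk_area) measurable
    show "AE z in disk_area. norm ((cmod (f z + g z))\<^sup>2)
            \<le> norm (2 * (cmod (f z))\<^sup>2 + 2 * (cmod (g z))\<^sup>2)"
    proof (rule AE_I2)
      fix z
      have "(cmod (f z + g z))\<^sup>2 \<le> (cmod (f z) + cmod (g z))\<^sup>2"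
        by (intro power_mono norm_triangle_ineq) auto
      also have "\<dots> \<le> 2 * (cmod (f z))\<^sup>2 + 2 * (cmod (g z))\<^sup>2"
        using zero_le_power2[of "cmod (f z) - cmod (g z)"]
        by (simp add: power2_eq_square algebra_simps)
      finally show "norm ((cmod (f z + g z))\<^sup>2)
            \<le> norm (2 * (cmod (f z))\<^sup>2 + 2 * (cmod (g z))\<^sup>2)" by simp
    qed
  qed
  then show ?thesis using f g by (auto simp: bergman_set_def intro!: holomorphic_intros)
qed

lemma integrable_bergman_product:
  assumes f: "f \<in> bergman_set" and g: "g \<in> bergman_set"
  shows "integrable disk_area (\<lambda>z. f z * cnj (g z))"
proof (rule Bochner_Integration.integrable_bound)
  note [measurable] = bergman_set_measurable[OF f] bergman_set_measurable[OF g]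
  show "integrable disk_area (\<lambda>z. (cmod (f z))\<^sup>2 + (cmod (g z))\<^sup>2)"
    using f g by (auto simp: bergman_set_def)
  have [measurable]: "cnj \<in> borel_measurable borel"
    by (intro borel_measurable_continuous_onI continuous_intros)
  show "(\<lambda>z. f z * cnj (g z)) \<in> borel_measurable disk_area"
    by (simp only: measurable_disk_area) measurable
  show "AE z in disk_area. norm (f z * cnj (g z)) \<le> norm ((cmod (f z))\<^sup>2 + (cmod (g z))\<^sup>2)"
  proof (rule AE_I2)
    fix z
    have "2 * (cmod (f z) * cmod (g z)) \<le> (cmod (f z))\<^sup>2 + (cmod (g z))\<^sup>2"
      using zero_le_power2[of "cmod (f z) - cmod (g z)"]
      by (simp add: power2_eq_square algebra_simps)
    moreover have "0 \<le> cmod (f z) * cmod (g z)" by simp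
    ultimately have "cmod (f z) * cmod (g z) \<le> (cmod (f z))\<^sup>2 + (cmod (g z))\<^sup>2" by linarith
    then show "norm (f z * cnj (g z)) \<le> norm ((cmod (f z))\<^sup>2 + (cmod (g z))\<^sup>2)"
      by (simp add: norm_mult)
  qed
qed

lemma bergman_set_eq_zero:
  assumes f: "f \<in> bergman_set" and 0: "(LINT z|disk_area. (cmod (f z))\<^sup>2) = 0"
  shows "f z = 0"
proof (rule ccontr)
  assume nz: "f z \<noteq> 0"
  let ?U = "{w \<in> ball 0 1. f w \<noteq> 0}"
  have cont: "continuous_on (ball 0 1) f"
    using f by (auto simp: bergman_set_def holomorphic_on_imp_continuous_on)
  have opn: "open ?U"
  proof -
    have "open (ball 0 1 \<inter> f -` (- {0}))"
      by (rule continuous_open_preimage[OF cont open_ball]) (simp add: open_Compl)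
    also have "ball 0 1 \<inter> f -` (- {0}) = ?U" by auto
    finally show ?thesis .
  qed
  have z: "z \<in> ?U" using nz f by (auto simp: bergman_set_def)
  have "AE w in disk_area. (cmod (f w))\<^sup>2 = 0"
    using f 0 integral_nonneg_eq_0_iff_AE[of disk_area "\<lambda>z. (cmod (f z))\<^sup>2"]
    by (simp add: bergman_set_def)
  then have "AE w in disk_area. w \<notin> ?U" by (auto elim!: eventually_mono)
  moreover have "?U \<in> sets disk_area" using opn by (simp add: disk_area_def)
  ultimately have "emeasure disk_area ?U = 0"
    by (simp add: AE_iff_null_sets null_setsD1)
  then have "emeasure lborel (ball 0 1 \<inter> ?U) / emeasure lborel (ball (0::complex) 1) = 0"
    unfolding disk_area_def using opn by (subst (asm) emeasure_uniform_measure) auto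
  moreover have "emeasure lborel (ball (0::complex) 1) \<noteq> \<infinity>"
    using emeasure_lborel_ball_finite[of "0::complex" 1] by simp
  moreover have "ball 0 1 \<inter> ?U = ?U" by blast
  ultimately have null: "emeasure lborel ?U = 0"
    using ennreal_divide_eq_0_iff by auto
  obtain r where r: "r > 0" "ball z r \<subseteq> ?U" using opn z openE by blast
  have "emeasure lborel (ball z r) \<le> emeasure lborel ?U"
    using r opn by (intro emeasure_mono) auto
  then have "measure lborel (ball z r) = 0" using null by (simp add: measure_def)
  then show False using content_ball_pos[OF r(1), of z] by simp
qed

typedef bergman = bergman_set
  morphisms bergman_fun Bergman
  using zero_in_bergman_set by blast

setup_lifting type_definition_bergman

instantiation bergman :: real_inner
begin

lift_definition zero_bergman :: bergman is "\<lambda>_. 0" by (rule zero_in_bergman_set)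
lift_definition plus_bergman :: "bergman \<Rightarrow> bergman \<Rightarrow> bergman" is "\<lambda>f g z. f z + g z"
  by (rule add_in_bergman_set)
lift_definition uminus_bergman :: "bergman \<Rightarrow> bergman" is "\<lambda>f z. - f z"
  using cmult_in_bergman_set[of _ "-1"] by simp
lift_definition minus_bergman :: "bergman \<Rightarrow> bergman \<Rightarrow> bergman" is "\<lambda>f g z. f z - g z"
  using add_in_bergman_set[OF _ cmult_in_bergman_set[of _ "-1"]] by simp
lift_definition scaleR_bergman :: "real \<Rightarrow> bergman \<Rightarrow> bergman" is "\<lambda>r f z. of_real r * f z"
  by (rule cmult_in_bergman_set)

definition inner_bergman :: "bergman \<Rightarrow> bergman \<Rightarrow> real" where
  "inner_bergman f g = Re (LINT z|disk_area. bergman_fun f z * cnj (bergman_fun g z))"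
definition norm_bergman :: "bergman \<Rightarrow> real" where
  "norm_bergman f = sqrt (inner f f)"
definition dist_bergman :: "bergman \<Rightarrow> bergman \<Rightarrow> real" where
  "dist_bergman f g = norm (f - g)"
definition sgn_bergman :: "bergman \<Rightarrow> bergman" where
  "sgn_bergman f = inverse (norm f) *\<^sub>R f"
definition uniformity_bergman :: "(bergman \<times> bergman) filter" where
  "uniformity_bergman = (INF e\<in>{0 <..}. principal {(x, y). dist x y < e})"
definition open_bergman :: "bergman set \<Rightarrow> bool" where
  "open_bergman U = (\<forall>x\<in>U. \<forall>\<^sub>F (x', y) in uniformity. x' = x \<longrightarrow> y \<in> U)"

instance
proof
  fix f g h :: bergman and r s :: real and U :: "bergman set"
  show "f + g + h = f + (g + h)" "f + g = g + f" "0 + f = f" "- f + f = 0" "f - g = f + - g"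
    "r *\<^sub>R (f + g) = r *\<^sub>R f + r *\<^sub>R g" "(r + s) *\<^sub>R f = r *\<^sub>R f + s *\<^sub>R f"
    "r *\<^sub>R s *\<^sub>R f = (r * s) *\<^sub>R f" "1 *\<^sub>R f = f"
    by (transfer; simp add: fun_eq_iff algebra_simps)+
  show "dist f g = norm (f - g)" by (rule dist_bergman_def)
  show "sgn f = inverse (norm f) *\<^sub>R f" by (rule sgn_bergman_def)
  show "uniformity = (INF e\<in>{0 <..}. principal {(x, y :: bergman). dist x y < e})"
    by (rule uniformity_bergman_def)
  show "open U \<longleftrightarrow> (\<forall>x\<in>U. \<forall>\<^sub>F (x', y) in uniformity. x' = x \<longrightarrow> y \<in> U)"
    by (rule open_bergman_def)
  show "norm f = sqrt (inner f f)" by (rule norm_bergman_def)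
  note int = integrable_bergman_product[OF bergman_fun bergman_fun]
  show "inner f g = inner g f"
  proof -
    have "(LINT z|disk_area. bergman_fun g z * cnj (bergman_fun f z))
        = (LINT z|disk_area. cnj (bergman_fun f z * cnj (bergman_fun g z)))"
      by (simp add: mult.commute)
    also have "\<dots> = cnj (LINT z|disk_area. bergman_fun f z * cnj (bergman_fun g z))"
      by (rule Bochner_Integration.integral_cnj)
    finally show ?thesis by (simp add: inner_bergman_def)
  qed
  show "inner (f + g) h = inner f h + inner g h"
    using int[of f h] int[of g h]
    by (simp add: inner_bergman_def plus_bergman.rep_eq distrib_right)
  show "inner (r *\<^sub>R f) g = r * inner f g"
    by (simp add: inner_bergman_def scaleR_bergman.rep_eq mult.assoc)
  have sq: "inner f f = (LINT z|disk_area. (cmod (bergman_fun f z))\<^sup>2)"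
  proof -
    have "(LINT z|disk_area. bergman_fun f z * cnj (bergman_fun f z))
        = (LINT z|disk_area. complex_of_real ((cmod (bergman_fun f z))\<^sup>2))"
      by (simp only: complex_norm_square)
    also have "\<dots> = complex_of_real (LINT z|disk_area. (cmod (bergman_fun f z))\<^sup>2)"
      by (rule integral_complex_of_real)
    finally show ?thesis by (simp add: inner_bergman_def)
  qed
  show "0 \<le> inner f f" unfolding sq by simp
  show "inner f f = 0 \<longleftrightarrow> f = 0"
  proof
    assume "inner f f = 0"
    then have "bergman_fun f z = 0" for z
      using bergman_set_eq_zero[OF bergman_fun] unfolding sq by blast
    then show "f = 0" by (simp add: bergman_fun_inject[symmetric] zero_bergman.rep_eq fun_eq_iff)
  next
    assume "f = 0"
    then show "inner f f = 0" unfolding sq by (simp add: zero_bergman.rep_eq)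
  qed
qed

end

lift_definition cscale :: "complex \<Rightarrow> bergman \<Rightarrow> bergman" is "\<lambda>c f z. c * f z"
  by (rule cmult_in_bergman_set)

definition cinner :: "bergman \<Rightarrow> bergman \<Rightarrow> complex" where
  "cinner f g = (LINT z|disk_area. bergman_fun f z * cnj (bergman_fun g z))"


section \<open>Operators and von Neumann algebras\<close>

definition bounded_ops :: "(bergman \<Rightarrow> bergman) set" where
  "bounded_ops = {T. bounded_linear T \<and> (\<forall>c f. T (cscale c f) = cscale c (T f))}"

definition op_scale :: "complex \<Rightarrow> (bergman \<Rightarrow> bergman) \<Rightarrow> bergman \<Rightarrow> bergman" where
  "op_scale c T = (\<lambda>f. cscale c (T f))"

interpretation ops: vector_space op_scale
proof
  fix c d :: complex and S T :: "bergman \<Rightarrow> bergman"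
  show "op_scale c (S + T) = op_scale c S + op_scale c T"
    "op_scale (c + d) T = op_scale c T + op_scale d T"
    "op_scale c (op_scale d T) = op_scale (c * d) T" "op_scale 1 T = T"
    unfolding op_scale_def plus_fun_def fun_eq_iff
    by (transfer; simp add: fun_eq_iff algebra_simps)+
qed

text \<open>The Hilbert space adjoint, with respect to the complex inner product.\<close>

definition adj :: "(bergman \<Rightarrow> bergman) \<Rightarrow> bergman \<Rightarrow> bergman" where
  "adj T = (THE S. \<forall>f g. cinner (T f) g = cinner f (S g))"

definition commutant :: "(bergman \<Rightarrow> bergman) set \<Rightarrow> (bergman \<Rightarrow> bergman) set" where
  "commutant X = {T \<in> bounded_ops. \<forall>S\<in>X. T \<circ> S = S \<circ> T}"

text \<open>The weak operator topology: the coarsest topology on the bounded operators for which all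
  maps \<open>T \<mapsto> \<langle>T f, g\<rangle>\<close> are continuous.  The topology \<open>euclidean\<close> on the
  function type is the product topology.\<close>

definition weak_operator_topology :: "(bergman \<Rightarrow> bergman) topology" where
  "weak_operator_topology = pullback_topology bounded_ops
     (\<lambda>T. \<lambda>(f, g). cinner (T f) g) (euclidean :: (bergman \<times> bergman \<Rightarrow> complex) topology)"

definition von_neumann_algebra :: "(bergman \<Rightarrow> bergman) set \<Rightarrow> bool" where
  "von_neumann_algebra M \<longleftrightarrow>
     ops.subspace M \<and> id \<in> M \<and> (\<forall>S\<in>M. \<forall>T\<in>M. S \<circ> T \<in> M) \<and> (\<forall>T\<in>M. adj T \<in> M) \<and>
     closedin weak_operator_topology M"

definition von_neumann_generated :: "(bergman \<Rightarrow> bergman) set \<Rightarrow> (bergman \<Rightarrow> bergman) set" where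
  "von_neumann_generated X = \<Inter> {M. von_neumann_algebra M \<and> X \<subseteq> M}"

text \<open>For a bounded analytic symbol the product lies in \<^const>\<open>bergman_set\<close>, so the
  abstraction function is applied within its domain; otherwise the value is unspecified.\<close>

definition mult_op :: "(complex \<Rightarrow> complex) \<Rightarrow> bergman \<Rightarrow> bergman" where
  "mult_op \<phi> h = Bergman (\<lambda>z. \<phi> z * bergman_fun h z)"

definition blaschke_algebra :: "(complex \<Rightarrow> complex) \<Rightarrow> (bergman \<Rightarrow> bergman) set" where
  "blaschke_algebra \<phi> = commutant {mult_op \<phi>} \<inter> commutant {adj (mult_op \<phi>)}"


section \<open>Blaschke products and their local inverses\<close>

definition blaschke :: "nat \<Rightarrow> (nat \<Rightarrow> complex) \<Rightarrow> complex \<Rightarrow> complex" where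
  "blaschke n a = (\<lambda>z. \<Prod>j=1..n. (z - a j) / (1 - cnj (a j) * z))"

definition critical_points :: "(complex \<Rightarrow> complex) \<Rightarrow> complex set" where
  "critical_points \<phi> = {z \<in> ball 0 1. deriv \<phi> z = 0}"

definition singular_set :: "(complex \<Rightarrow> complex) \<Rightarrow> complex set" where
  "singular_set \<phi> = ball 0 1 \<inter> \<phi> -` (\<phi> ` critical_points \<phi>)"

definition regular_set :: "(complex \<Rightarrow> complex) \<Rightarrow> complex set" where
  "regular_set \<phi> = ball 0 1 - singular_set \<phi>"

definition local_inverse :: "(complex \<Rightarrow> complex) \<Rightarrow> complex set \<Rightarrow> (complex \<Rightarrow> complex) \<Rightarrow> bool" where
  "local_inverse \<phi> V \<rho> \<longleftrightarrow> open V \<and> V \<subseteq> ball 0 1 \<and>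
     \<rho> holomorphic_on V \<and> \<rho> ` V \<subseteq> ball 0 1 \<and> (\<forall>z\<in>V. \<phi> (\<rho> z) = \<phi> z)"

text \<open>A germ at \<open>z\<close> is a class of functions agreeing near \<open>z\<close>.\<close>

type_synonym cgerm = "(complex \<Rightarrow> complex) set"

definition germ :: "complex \<Rightarrow> (complex \<Rightarrow> complex) \<Rightarrow> cgerm" where
  "germ z \<rho> = {g. \<forall>\<^sub>F w in nhds z. g w = \<rho> w}"

definition local_inverse_germs :: "(complex \<Rightarrow> complex) \<Rightarrow> complex \<Rightarrow> cgerm set" where
  "local_inverse_germs \<phi> z = {germ z \<rho> | \<rho> V. z \<in> V \<and> local_inverse \<phi> V \<rho>}"

text \<open>Analytic continuation along \<open>\<gamma>\<close>, as a family \<open>G t\<close> of analytic germs at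
  \<open>\<gamma> t\<close> that is locally induced by a single analytic function.\<close>

definition analytic_continuation :: "(real \<Rightarrow> complex) \<Rightarrow> (real \<Rightarrow> cgerm) \<Rightarrow> bool" where
  "analytic_continuation \<gamma> G \<longleftrightarrow> path \<gamma> \<and>
     (\<forall>t\<in>{0..1}. \<exists>V \<rho> e. open V \<and> \<rho> holomorphic_on V \<and> e > 0 \<and>
        (\<forall>s\<in>{0..1}. dist s t < e \<longrightarrow> \<gamma> s \<in> V \<and> G s = germ (\<gamma> s) \<rho>))"

definition continues_to :: "complex set \<Rightarrow> complex \<Rightarrow> complex \<Rightarrow> cgerm \<Rightarrow> cgerm \<Rightarrow> bool" where
  "continues_to E z w g h \<longleftrightarrow> (\<exists>\<gamma> G. analytic_continuation \<gamma> G \<and> path_image \<gamma> \<subseteq> E \<and>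
     pathstart \<gamma> = z \<and> pathfinish \<gamma> = w \<and> G 0 = g \<and> G 1 = h)"

definition inverse_classes :: "(complex \<Rightarrow> complex) \<Rightarrow> complex \<Rightarrow> cgerm set set" where
  "inverse_classes \<phi> z0 = local_inverse_germs \<phi> z0 //
     {(g, h). g \<in> local_inverse_germs \<phi> z0 \<and> h \<in> local_inverse_germs \<phi> z0 \<and>
              continues_to (regular_set \<phi>) z0 z0 g h}"

text \<open>The continuation to \<open>z\<close> of a class \<open>K\<close> of germs at \<open>z0\<close>.  Taking all paths
  from \<open>z0\<close> to \<open>z\<close> is harmless, since the resulting set does not depend on the path.\<close>

definition continued_class ::
    "(complex \<Rightarrow> complex) \<Rightarrow> complex \<Rightarrow> cgerm set \<Rightarrow> complex \<Rightarrow> cgerm set" where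
  "continued_class \<phi> z0 K z = {h. \<exists>g\<in>K. continues_to (regular_set \<phi>) z0 z g h}"

definition germ_rep :: "cgerm \<Rightarrow> complex \<Rightarrow> complex" where
  "germ_rep g = (SOME \<rho>. \<rho> \<in> g)"

definition class_sum ::
    "(complex \<Rightarrow> complex) \<Rightarrow> complex \<Rightarrow> cgerm set \<Rightarrow> bergman \<Rightarrow> complex \<Rightarrow> complex" where
  "class_sum \<phi> z0 K f z =
     (\<Sum>g\<in>continued_class \<phi> z0 K z. deriv (germ_rep g) z * bergman_fun f (germ_rep g z))"

definition class_op :: "(complex \<Rightarrow> complex) \<Rightarrow> complex \<Rightarrow> cgerm set \<Rightarrow> bergman \<Rightarrow> bergman" where
  "class_op \<phi> z0 K f = (THE h. \<forall>z\<in>regular_set \<phi>. bergman_fun h z = class_sum \<phi> z0 K f z)"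


section \<open>The Riemann surface of the inverse composed with the function\<close>

definition unbranched_cover :: "(complex \<Rightarrow> complex) \<Rightarrow> (complex \<times> complex) set" where
  "unbranched_cover \<phi> = {(w, z). z \<in> regular_set \<phi> \<and> w \<in> ball 0 1 \<and> \<phi> w = \<phi> z}"

definition punctured_cover ::
    "(complex \<Rightarrow> complex) \<Rightarrow> complex \<Rightarrow> real \<Rightarrow> (complex \<times> complex) set" where
  "punctured_cover \<phi> b r = {(w, z) \<in> unbranched_cover \<phi>. z \<in> ball b r - {b}}"

text \<open>The points added over \<open>b\<close> are the ends of the cover over \<open>b\<close>: consistent choices of a
  component of the cover over every punctured neighbourhood of \<open>b\<close>.  For small \<open>r\<close> such a
  component is a finite cover of a punctured disk, to which one point is added.
  The normalization for \<open>r \<le> 0\<close> makes an end a unique function.\<close>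

definition cover_ends ::
    "(complex \<Rightarrow> complex) \<Rightarrow> complex \<Rightarrow> (real \<Rightarrow> (complex \<times> complex) set) set" where
  "cover_ends \<phi> b = {U. (\<forall>r>0. U r \<in> components (punctured_cover \<phi> b r)) \<and>
     (\<forall>r s. 0 < r \<and> r \<le> s \<longrightarrow> U r \<subseteq> U s) \<and> (\<forall>r\<le>0. U r = {})}"

datatype surface_point =
    Sheet "complex \<times> complex"
  | Branch complex "real \<Rightarrow> (complex \<times> complex) set"

definition surface_points :: "(complex \<Rightarrow> complex) \<Rightarrow> surface_point set" where
  "surface_points \<phi> = Sheet ` unbranched_cover \<phi> \<union>
     {Branch b U | b U. b \<in> singular_set \<phi> \<and> U \<in> cover_ends \<phi> b}"

text \<open>The cover is an open subspace, and the sets \<open>{Branch b U} \<union> Sheet ` U r\<close> with \<open>r\<close> small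
  and positive form a neighbourhood base at an added point.\<close>

definition riemann_surface :: "(complex \<Rightarrow> complex) \<Rightarrow> surface_point topology" where
  "riemann_surface \<phi> = topology (\<lambda>W. W \<subseteq> surface_points \<phi> \<and>
     openin (top_of_set (unbranched_cover \<phi>)) (Sheet -` W) \<and>
     (\<forall>b U. Branch b U \<in> W \<longrightarrow> (\<exists>r>0. Sheet ` U r \<subseteq> W)))"

lemma openin_riemann_surface:
  "openin (riemann_surface \<phi>) W \<longleftrightarrow> W \<subseteq> surface_points \<phi> \<and>
     openin (top_of_set (unbranched_cover \<phi>)) (Sheet -` W) \<and>
     (\<forall>b U. Branch b U \<in> W \<longrightarrow> (\<exists>r>0. Sheet ` U r \<subseteq> W))"
proof -
  let ?P = "\<lambda>W. W \<subseteq> surface_points \<phi> \<and>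
     openin (top_of_set (unbranched_cover \<phi>)) (Sheet -` W) \<and>
     (\<forall>b U. Branch b U \<in> W \<longrightarrow> (\<exists>r>0. Sheet ` U r \<subseteq> W))"
  have "istopology ?P"
    unfolding istopology_def
  proof (intro conjI allI impI)
    fix S T assume S: "?P S" and T: "?P T"
    show "S \<inter> T \<subseteq> surface_points \<phi>" using S by blast
    show "openin (top_of_set (unbranched_cover \<phi>)) (Sheet -` (S \<inter> T))"
      using S T by (simp add: vimage_Int openin_Int)
    fix b U assume "Branch b U \<in> S \<inter> T"
    then have bS: "Branch b U \<in> S" and bT: "Branch b U \<in> T" and "Branch b U \<in> surface_points \<phi>"
      using S by auto
    then have U: "U \<in> cover_ends \<phi> b" by (auto simp: surface_points_def)
    obtain r s where r: "r > 0" "Sheet ` U r \<subseteq> S" and s: "s > 0" "Sheet ` U s \<subseteq> T"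
      using S T bS bT by meson
    have "U (min r s) \<subseteq> U r" "U (min r s) \<subseteq> U s"
      using U r(1) s(1) unfolding cover_ends_def by auto
    then show "\<exists>r>0. Sheet ` U r \<subseteq> S \<inter> T"
      using r s by (intro exI[of _ "min r s"]) (simp, blast)
  next
    fix \<K> assume K: "\<forall>W\<in>\<K>. ?P W"
    show "\<Union>\<K> \<subseteq> surface_points \<phi>" using K by blast
    show "openin (top_of_set (unbranched_cover \<phi>)) (Sheet -` \<Union>\<K>)"
      unfolding vimage_Union using K by (intro openin_Union) auto
    fix b U assume "Branch b U \<in> \<Union>\<K>"
    then obtain W where W: "W \<in> \<K>" "Branch b U \<in> W" by blast
    then obtain r where "r > 0" "Sheet ` U r \<subseteq> W" using K by meson
    then show "\<exists>r>0. Sheet ` U r \<subseteq> \<Union>\<K>" using W by (intro exI[of _ r]) auto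
  qed
  then show ?thesis unfolding riemann_surface_def by (simp add: topology_inverse')
qed

lemma topspace_riemann_surface: "topspace (riemann_surface \<phi>) = surface_points \<phi>"
proof
  show "topspace (riemann_surface \<phi>) \<subseteq> surface_points \<phi>"
    using openin_topspace openin_riemann_surface by blast
  have "Sheet -` surface_points \<phi> = unbranched_cover \<phi>"
    by (auto simp: surface_points_def)
  moreover have "\<exists>r>0. Sheet ` U r \<subseteq> surface_points \<phi>" if "Branch b U \<in> surface_points \<phi>" for b U
  proof -
    have "U 1 \<in> components (punctured_cover \<phi> b 1)"
      using that by (auto simp: surface_points_def cover_ends_def)
    then have "U 1 \<subseteq> unbranched_cover \<phi>"
      using in_components_subset by (fastforce simp: punctured_cover_def)
    then show ?thesis by (intro exI[of _ 1]) (auto simp: surface_points_def)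
  qed
  ultimately have "openin (riemann_surface \<phi>) (surface_points \<phi>)"
    unfolding openin_riemann_surface by auto
  then show "surface_points \<phi> \<subseteq> topspace (riemann_surface \<phi>)"
    by (rule openin_subset)
qed

end

theory Submission
  imports Defs
begin

text \<open>Over the regular set the fibres of \<open>\<phi>\<close> form a finite cover \<open>X\<close> of points \<open>(w, z)\<close> with
  \<open>\<phi>(w) = \<phi>(z)\<close>.  A germ of a local inverse at \<open>z\<close> is determined by its value \<open>w\<close>, continuation of
  germs is a path in \<open>X\<close>, and so the classes of germs, the components of \<open>X\<close> and the components of
  the completed surface correspond to each other.  Push-forward along \<open>\<phi>\<close> compares integrals over
  the disk fibre by fibre; this bounds the operator of a component and identifies its adjoint with
  the operator of the transposed component.

  Conversely, if \<open>T\<close> commutes with \<open>M\<^sub>\<phi>\<close> and its adjoint, then \<open>\<integral> u(\<phi>) (T f \<cdot> cnj g - f \<cdot> cnj (T\<^sup>* g)) = 0\<close>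
  for every continuous \<open>u\<close> by the Stone-Weierstrass theorem, and so the integrand has vanishing
  fibre sums.  Testing these with \<open>f\<close> and \<open>g\<close> that interpolate on a fibre gives
  \<open>T f(z) = \<Sum> c(w, z) \<phi>'(z)/\<phi>'(w) f(w)\<close>, where \<open>c\<close> is both holomorphic and, by the adjoint relation,
  antiholomorphic along local sections.  Hence \<open>c\<close> is constant on each component of \<open>X\<close>.\<close>


section \<open>Change of variables for holomorphic maps\<close>

text \<open>The cover is parametrised by the base value \<open>v\<close>, not by \<open>z\<close>:
  over a small disk of regular values the fibre splits into sections \<open>\<sigma> w\<close>, a
  piece of the cover is the set of pairs \<open>(\<sigma> w v, \<sigma> z v)\<close>, and a local
  inverse of \<open>\<phi>\<close> is \<open>\<sigma> w\<close> after \<open>\<phi>\<close>. This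
  form is symmetric in the two entries, which suits transposition, adjoints and the comparison of c
  with its conjugate. Substitution along a section produces its Jacobian; this is the origin of the
  weight \<open>1 / (cmod (deriv \<phi> z))\<^sup>2\<close> in all fibre sums. Two obstacles shape
  the proof. The factor \<phi>'(z)/\<phi>'(w) is unbounded near critical fibres, so the holomorphic
  extension and the norm bound of a component operator are obtained separately. And T is an abstract
  operator, so c can be seen to be holomorphic along sections only if the interpolating functions
  move holomorphically; they are therefore polynomials whose roots run along the sections. Adjoints
  come from Riesz representation; hence the completeness of the space, resting on point evaluation
  bounds and area mean values.\<close>

definition vec2 :: "complex \<Rightarrow> real^2" where "vec2 z = (\<chi> i. if i = 1 then Re z else Im z)"
definition unvec2 :: "real^2 \<Rightarrow> complex" where "unvec2 x = Complex (x $ 1) (x $ 2)"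

lemma vec2_nth [simp]: "vec2 z $ 1 = Re z" "vec2 z $ 2 = Im z"
  by (auto simp: vec2_def)

lemma unvec2_vec2 [simp]: "unvec2 (vec2 z) = z"
  by (auto simp: unvec2_def complex_eq_iff)

lemma vec2_unvec2 [simp]: "vec2 (unvec2 x) = x"
  by (auto simp: vec_eq_iff forall_2 unvec2_def)

lemma linear_vec2: "linear vec2"
  by (rule linearI) (auto simp: vec_eq_iff forall_2)

lemma linear_unvec2: "linear unvec2"
  by (rule linearI) (auto simp: unvec2_def complex_eq_iff)

lemma vec2_borel [measurable]: "vec2 \<in> borel_measurable borel"
  using linear_vec2
  by (intro borel_measurable_continuous_onI linear_continuous_on) (simp add: linear_linear)

lemma unvec2_borel [measurable]: "unvec2 \<in> borel_measurable borel"
  using linear_unvec2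
  by (intro borel_measurable_continuous_onI linear_continuous_on) (simp add: linear_linear)

text \<open>The Jacobian formula used below speaks of \<open>real^2\<close> and matrices;
  identifying \<open>lborel\<close> on both sides transports it to \<open>complex\<close>. Both
  measures give a box the product of its side lengths, and boxes determine them.\<close>

lemma distr_unvec2: "distr lborel borel unvec2 = lborel"
proof (rule lborel_eqI[symmetric])
  fix l u :: complex
  assume le: "\<And>b. b \<in> Basis \<Longrightarrow> l \<bullet> b \<le> u \<bullet> b"
  have le': "Re l \<le> Re u" "Im l \<le> Im u"
    using le[of 1] le[of \<i>] by (auto simp: Basis_complex_def)
  have "unvec2 -` box l u = box (vec2 l) (vec2 u)"
    by (auto simp: set_eq_iff mem_box_cart forall_2) (auto simp: box_def Basis_complex_def unvec2_def)
  then have "emeasure (distr lborel borel unvec2) (box l u) = emeasure lborel (box (vec2 l) (vec2 u))"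
    by (simp add: emeasure_distr)
  also have "\<dots> = (\<Prod>b\<in>Basis. (vec2 u - vec2 l) \<bullet> b)"
    by (rule emeasure_lborel_box)
       (auto simp: Basis_vec_def inner_axis forall_2 le' vec2_def)
  also have "(\<Prod>b\<in>Basis. (vec2 u - vec2 l) \<bullet> b) = (Re u - Re l) * (Im u - Im l)"
  proof -
    have "(Basis :: (real^2) set) = {axis 1 1, axis 2 1}"
      by (auto simp: Basis_vec_def) (metis exhaust_2)+
    moreover have "axis 1 1 \<noteq> (axis 2 1 :: real^2)"
      by (auto simp: axis_eq_axis)
    ultimately have "prod F Basis = F (axis 1 1) * F (axis 2 1)" for F :: "real^2 \<Rightarrow> real"
      by (metis (no_types, lifting) empty_iff finite.intros insert_iff mult.right_neutral prod.empty prod.insert)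
    then show ?thesis by (simp add: inner_axis)
  qed
  also have "\<dots> = (\<Prod>b\<in>Basis. (u - l) \<bullet> b)"
    by (simp add: Basis_complex_def)
  finally show "emeasure (distr lborel borel unvec2) (box l u) = (\<Prod>b\<in>Basis. (u - l) \<bullet> b)" .
qed simp

lemma nn_integral_unvec2:
  assumes [measurable]: "f \<in> borel_measurable borel"
  shows "(\<integral>\<^sup>+x. f (unvec2 x) \<partial>lborel) = (\<integral>\<^sup>+z. f z \<partial>lborel)"
  by (subst distr_unvec2[symmetric], subst nn_integral_distr) auto

lemma vec2_image: "vec2 ` A = unvec2 -` A"
  by (auto simp: image_iff) (metis vec2_unvec2)

lemma emeasure_vec2_image:
  assumes "A \<in> sets borel"
  shows "emeasure lborel (vec2 ` A) = emeasure lborel A"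
  using assms by (subst distr_unvec2[symmetric], subst emeasure_distr) (auto simp: vec2_image)

text \<open>The derivative of a holomorphic map is multiplication by a complex number, whose real
  determinant is its squared modulus. The real theorem treats finite measure; the infinite case is
  recovered from its being an equivalence.\<close>

lemma emeasure_holomorphic_image:
  assumes S: "S \<in> sets borel" and gS: "g ` S \<in> sets borel"
    and g: "\<And>z. z \<in> S \<Longrightarrow> (g has_field_derivative g' z) (at z)"
    and inj: "inj_on g S"
    and g': "(\<lambda>z. indicator S z * (cmod (g' z))\<^sup>2) \<in> borel_measurable borel"
  shows "emeasure lborel (g ` S) = (\<integral>\<^sup>+z. ennreal (indicator S z * (cmod (g' z))\<^sup>2) \<partial>lborel)"
proof -
  define f where "f = vec2 \<circ> g \<circ> unvec2"
  define f' where "f' = (\<lambda>x. vec2 \<circ> (\<lambda>h. g' (unvec2 x) * h) \<circ> unvec2)"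
  define J where "J = (\<lambda>x. indicator S (unvec2 x) * (cmod (g' (unvec2 x)))\<^sup>2)"
  have bl: "bounded_linear vec2" "bounded_linear unvec2"
    using linear_vec2 linear_unvec2 linear_linear by blast+
  have der: "(f has_derivative f' x) (at x within vec2 ` S)" if "x \<in> vec2 ` S" for x
  proof -
    have "unvec2 x \<in> S" using that by (auto simp: vec2_image)
    then have "(g has_derivative (\<lambda>h. g' (unvec2 x) * h)) (at (unvec2 x))"
      using g by (simp add: has_field_derivative_def)
    then have "(g \<circ> unvec2 has_derivative (\<lambda>h. g' (unvec2 x) * h) \<circ> unvec2) (at x)"
      using diff_chain_at[OF bounded_linear_imp_has_derivative[OF bl(2)]] by blast
    then have "(vec2 \<circ> (g \<circ> unvec2) has_derivative vec2 \<circ> ((\<lambda>h. g' (unvec2 x) * h) \<circ> unvec2)) (at x)"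
      using diff_chain_at[OF _ bounded_linear_imp_has_derivative[OF bl(1)]] by blast
    then show ?thesis
      unfolding f_def f'_def by (simp add: comp_assoc has_derivative_at_withinI)
  qed
  have det: "\<bar>det (matrix (f' x))\<bar> = (cmod (g' (unvec2 x)))\<^sup>2" for x
    unfolding cmod_power2 by (simp add: det_2 matrix_def f'_def unvec2_def axis_def power2_eq_square)
  have injf: "inj_on f (vec2 ` S)"
    using inj unfolding inj_on_def f_def by (auto) (metis unvec2_vec2)+
  have S2: "vec2 ` S \<in> sets borel"
    using measurable_sets[OF unvec2_borel S] by (simp add: vec2_image)
  have fim: "f ` (vec2 ` S) = vec2 ` (g ` S)" by (force simp: f_def)
  have fim2: "f ` (vec2 ` S) \<in> sets borel"
    using measurable_sets[OF unvec2_borel gS] unfolding fim by (simp add: vec2_image)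
  have Jm[measurable]: "J \<in> borel_measurable borel"
    using measurable_compose[OF unvec2_borel g'] by (simp add: J_def)
  have J0: "0 \<le> J x" for x by (simp add: J_def)
  have I: "(\<integral>\<^sup>+z. ennreal (indicator S z * (cmod (g' z))\<^sup>2) \<partial>lborel) = (\<integral>\<^sup>+x. ennreal (J x) \<partial>lborel)"
    unfolding J_def using nn_integral_unvec2[of "\<lambda>z. ennreal (indicator S z * (cmod (g' z))\<^sup>2)"] g'
    by simp
  have key: "(f ` (vec2 ` S) \<in> lmeasurable \<and> measure lebesgue (f ` (vec2 ` S)) = m) \<longleftrightarrow> (J has_integral m) UNIV" for m
  proof -
    have "(f ` (vec2 ` S) \<in> lmeasurable \<and> measure lebesgue (f ` (vec2 ` S)) = m) \<longleftrightarrow>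
          ((\<lambda>x. \<bar>det (matrix (f' x))\<bar>) has_integral m) (vec2 ` S)"
      using der injf S2 by (intro has_measure_differentiable_image) auto
    also have "\<dots> \<longleftrightarrow> ((\<lambda>x. if x \<in> vec2 ` S then \<bar>det (matrix (f' x))\<bar> else 0) has_integral m) UNIV"
      by (rule has_integral_restrict_UNIV[symmetric])
    also have "(\<lambda>x. if x \<in> vec2 ` S then \<bar>det (matrix (f' x))\<bar> else 0) = J"
      unfolding det by (auto simp: J_def vec2_image indicator_def)
    finally show ?thesis .
  qed
  have eqm: "emeasure lebesgue (f ` (vec2 ` S)) = emeasure lborel (g ` S)"
    using fim2 gS fim by (simp add: emeasure_vec2_image)
  have nnJ: "(J has_integral m) UNIV \<longleftrightarrow> 0 \<le> m \<and> (\<integral>\<^sup>+x. ennreal (J x) \<partial>lborel) = ennreal m" for m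
  proof
    assume h: "(J has_integral m) UNIV"
    then have "0 \<le> m" using J0 by (rule has_integral_nonneg)
    moreover have "integral\<^sup>N lborel J = ennreal m"
      using nn_integral_has_integral_lborel[OF _ J0 h] by simp
    ultimately show "0 \<le> m \<and> (\<integral>\<^sup>+x. ennreal (J x) \<partial>lborel) = ennreal m" by simp
  next
    assume "0 \<le> m \<and> (\<integral>\<^sup>+x. ennreal (J x) \<partial>lborel) = ennreal m"
    then show "(J has_integral m) UNIV" using J0 by (intro nn_integral_has_integral) auto
  qed
  show ?thesis
  proof (cases "(\<integral>\<^sup>+x. ennreal (J x) \<partial>lborel) = \<infinity>")
    case True
    \<comment> \<open>A finite image measure would make \<open>J\<close> integrable by
      \<open>key\<close>, against the infinite integral.\<close>
    have "emeasure lborel (g ` S) = \<infinity>"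
    proof (rule ccontr)
      assume "\<not> ?thesis"
      then have "f ` (vec2 ` S) \<in> lmeasurable"
        using eqm fim2 by (intro fmeasurableI) (auto simp: top.not_eq_extremum)
      then show False using key[of "measure lebesgue (f ` (vec2 ` S))"] nnJ True by auto
    qed
    then show ?thesis using True I by simp
  next
    case False
    then obtain m where m: "0 \<le> m" "(\<integral>\<^sup>+x. ennreal (J x) \<partial>lborel) = ennreal m"
      by (cases "\<integral>\<^sup>+x. ennreal (J x) \<partial>lborel" rule: ennreal_cases) auto
    then have "f ` (vec2 ` S) \<in> lmeasurable \<and> measure lebesgue (f ` (vec2 ` S)) = m"
      using nnJ key by blast
    then have "emeasure lebesgue (f ` (vec2 ` S)) = ennreal m"
      by (metis emeasure_eq_measure2 fmeasurableD2 emeasure_eq_ennreal_measure)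
    then show ?thesis using eqm I m by simp
  qed
qed

text \<open>It suffices to compare two measures: the push-forward of the density
  \<open>(cmod (deriv g x))\<^sup>2\<close> on \<open>S\<close>, and area restricted to the image.
  On a Borel set \<open>A\<close> this is the area formula for the part of \<open>S\<close> mapped
  into \<open>A\<close>.\<close>

theorem nn_integral_holomorphic_substitution:
  assumes S: "open S" and hol: "g holomorphic_on S" and inj: "inj_on g S"
    and h[measurable]: "h \<in> borel_measurable borel"
  shows "(\<integral>\<^sup>+y\<in>g ` S. h y \<partial>lborel) = (\<integral>\<^sup>+x\<in>S. ennreal ((cmod (deriv g x))\<^sup>2) * h (g x) \<partial>lborel)"
proof -
  have gS: "open (g ` S)" using open_mapping_thm3[OF hol S inj] .
  \<comment> \<open>A total measurable substitute for \<open>g\<close>, which is unconstrained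
    outside \<open>S\<close>.\<close>
  define g0 where "g0 = (\<lambda>x. if x \<in> S then g x else 0)"
  define d where "d = (\<lambda>x. indicator S x * (cmod (deriv g x))\<^sup>2)"
  have g0[measurable]: "g0 \<in> borel_measurable borel"
    unfolding g0_def using S hol
    by (intro borel_measurable_continuous_on_if) (auto simp: holomorphic_on_imp_continuous_on)
  have d[measurable]: "d \<in> borel_measurable borel"
  proof -
    have "(\<lambda>x. if x \<in> S then (cmod (deriv g x))\<^sup>2 else 0) \<in> borel_measurable borel"
      using S hol by (intro borel_measurable_continuous_on_if continuous_intros)
        (auto intro!: holomorphic_on_imp_continuous_on holomorphic_deriv)
    also have "(\<lambda>x. if x \<in> S then (cmod (deriv g x))\<^sup>2 else 0) = d" by (auto simp: d_def)
    finally show ?thesis .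
  qed
  have eq: "distr (density lborel (\<lambda>x. ennreal (d x))) borel g0 = density lborel (indicator (g ` S))"
  proof (rule measure_eqI)
    fix A assume "A \<in> sets (distr (density lborel (\<lambda>x. ennreal (d x))) borel g0)"
    then have A[measurable]: "A \<in> sets borel" by simp
    define T where "T = S \<inter> g0 -` A"
    have T[measurable]: "T \<in> sets borel"
      using measurable_sets[OF g0 A] S by (auto simp: T_def)
    have gT: "g ` T = g ` S \<inter> A" by (auto simp: T_def g0_def)
    have "emeasure (distr (density lborel (\<lambda>x. ennreal (d x))) borel g0) A
        = (\<integral>\<^sup>+x. ennreal (d x) * indicator (g0 -` A) x \<partial>lborel)"
      by (subst emeasure_distr) (auto simp: emeasure_density measurable_sets[OF g0 A, simplified])
    also have "\<dots> = (\<integral>\<^sup>+x. ennreal (indicator T x * (cmod (deriv g x))\<^sup>2) \<partial>lborel)"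
      by (intro nn_integral_cong) (auto simp: d_def T_def indicator_def)
    also have "\<dots> = emeasure lborel (g ` T)"
    proof (rule emeasure_holomorphic_image[symmetric])
      show "g ` T \<in> sets borel" unfolding gT using gS by auto
      show "inj_on g T" using inj by (rule inj_on_subset) (auto simp: T_def)
      show "(g has_field_derivative deriv g z) (at z)" if "z \<in> T" for z
        using that hol S by (auto simp: T_def intro: holomorphic_derivI)
      have "(\<lambda>z. indicator T z * d z) \<in> borel_measurable borel" by measurable
      also have "(\<lambda>z. indicator T z * d z) = (\<lambda>z. indicator T z * (cmod (deriv g z))\<^sup>2)"
        by (auto simp: d_def T_def indicator_def)
      finally show "(\<lambda>z. indicator T z * (cmod (deriv g z))\<^sup>2) \<in> borel_measurable borel" .
    qed fact
    also have "\<dots> = emeasure (density lborel (indicator (g ` S))) A"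
      unfolding gT using gS by (subst emeasure_density) (auto simp: indicator_inter_arith[symmetric])
    finally show "emeasure (distr (density lborel (\<lambda>x. ennreal (d x))) borel g0) A
      = emeasure (density lborel (indicator (g ` S))) A" .
  qed simp
  have "(\<integral>\<^sup>+y\<in>g ` S. h y \<partial>lborel) = (\<integral>\<^sup>+y. h y \<partial>density lborel (indicator (g ` S)))"
    using gS by (subst nn_integral_density) (auto simp: mult.commute)
  also have "\<dots> = (\<integral>\<^sup>+x. ennreal (d x) * h (g0 x) \<partial>lborel)"
    unfolding eq[symmetric] by (subst nn_integral_distr) (auto simp: nn_integral_density)
  also have "\<dots> = (\<integral>\<^sup>+x\<in>S. ennreal ((cmod (deriv g x))\<^sup>2) * h (g x) \<partial>lborel)"
    by (intro nn_integral_cong) (auto simp: d_def g0_def indicator_def)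
  finally show ?thesis .
qed

section \<open>The Bergman space is complete\<close>

lemma integral_lborel_rotation:
  fixes f :: "complex \<Rightarrow> complex"
  assumes c: "cmod c = 1" and f: "f \<in> borel_measurable borel"
  shows "(LINT z|lborel. f (z0 + c * (z - z0))) = (LINT z|lborel. f z)"
proof -
  define s where "s = (\<lambda>z. z0 + c * (z - z0))"
  have c0: "c \<noteq> 0" using c by auto
  have s[measurable]: "s \<in> borel_measurable borel"
    unfolding s_def by (intro borel_measurable_continuous_onI continuous_intros)
  have der: "deriv s z = c" for z
    unfolding s_def by (rule DERIV_imp_deriv) (auto intro!: derivative_eq_intros)
  have surj: "range s = UNIV"
  proof (rule surjI)
    show "s (z0 + (z - z0) / c) = z" for z using c0 by (simp add: s_def)
  qed
  have "distr lborel borel s = lborel"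
  proof (rule measure_eqI)
    fix A assume "A \<in> sets (distr lborel borel s)"
    then have A[measurable]: "A \<in> sets borel" by simp
    have "emeasure lborel A = (\<integral>\<^sup>+y\<in>s ` UNIV. indicator A y \<partial>lborel)" by (simp add: surj)
    also have "\<dots> = (\<integral>\<^sup>+x\<in>UNIV. ennreal ((cmod (deriv s x))\<^sup>2) * indicator A (s x) \<partial>lborel)"
    proof (rule nn_integral_holomorphic_substitution)
      show "s holomorphic_on UNIV" unfolding s_def by (intro holomorphic_intros)
      show "inj s" using c0 by (auto simp: inj_def s_def)
    qed auto
    also have "\<dots> = (\<integral>\<^sup>+x. indicator A (s x) \<partial>lborel)" by (simp add: der c)
    also have "\<dots> = (\<integral>\<^sup>+y. indicator A y \<partial>distr lborel borel s)"
      by (subst nn_integral_distr) auto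
    also have "\<dots> = emeasure (distr lborel borel s) A" by (subst nn_integral_indicator) auto
    finally show "emeasure (distr lborel borel s) A = emeasure lborel A" by simp
  qed simp
  then have "(LINT z|lborel. f z) = (LINT z|distr lborel borel s. f z)" by simp
  also have "\<dots> = (LINT z|lborel. f (s z))" using f by (intro integral_distr) auto
  finally show ?thesis by (simp add: s_def)
qed

lemma integral_ball_power:
  fixes z0 :: complex
  assumes "m > 0"
  shows "(LINT z|lborel. indicator (ball z0 r) z * (z - z0) ^ m) = 0"
proof -
  let ?f = "\<lambda>z. indicator (ball z0 r) z * (z - z0) ^ m"
  \<comment> \<open>An m-th root of -1: rotation by it preserves the disk but flips the sign of the
    integrand, so the integral equals its own negative.\<close>
  define c where "c = cis (pi / m)"
  have "c ^ m = cis (real m * (pi / real m))" unfolding c_def by (rule Complex.DeMoivre)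
  then have c: "cmod c = 1" "c ^ m = - 1" using assms by (auto simp: c_def)
  have f: "?f \<in> borel_measurable borel"
    by (intro borel_measurable_times borel_measurable_indicator)
       (auto intro!: borel_measurable_continuous_onI continuous_intros)
  have "(LINT z|lborel. ?f z) = (LINT z|lborel. ?f (z0 + c * (z - z0)))"
    by (rule integral_lborel_rotation[OF c(1) f, symmetric])
  also have "\<dots> = (LINT z|lborel. - ?f z)"
  proof (rule Bochner_Integration.integral_cong)
    fix z
    have "indicator (ball z0 r) (z0 + c * (z - z0)) = (indicator (ball z0 r) z :: complex)"
      using c(1) by (simp add: indicator_def dist_norm norm_mult norm_minus_commute)
    then show "?f (z0 + c * (z - z0)) = - ?f z" using c(2) by (simp add: power_mult_distrib)
  qed simp
  finally show ?thesis by simp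
qed

lemma integrable_ball_bounded:
  fixes f :: "complex \<Rightarrow> complex"
  assumes "f \<in> borel_measurable borel" "\<And>z. z \<in> ball z0 r \<Longrightarrow> cmod (f z) \<le> B"
  shows "integrable lborel (\<lambda>z. indicator (ball z0 r) z * f z)"
proof (rule Bochner_Integration.integrable_bound)
  show "integrable lborel (\<lambda>z. indicator (ball z0 r) z * B)"
    using emeasure_lborel_ball_finite[of z0 r] by (intro integrable_mult_left) auto
  show "(\<lambda>z. indicator (ball z0 r) z * f z) \<in> borel_measurable lborel"
    using assms(1) by (intro borel_measurable_times borel_measurable_indicator) auto
  show "AE z in lborel. norm (indicator (ball z0 r) z * f z) \<le> norm (indicator (ball z0 r) z * B)"
    using assms(2) by (intro AE_I2) (fastforce simp: indicator_def)
qed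

text \<open>The power series about the centre may be integrated term by term, and by
  \<open>integral_ball_power\<close> only the constant term survives.\<close>

lemma area_mean_value:
  fixes f :: "complex \<Rightarrow> complex"
  assumes hol: "f holomorphic_on ball z0 R" and r: "0 < r" "r < R"
  shows "(LINT z|lborel. indicator (ball z0 r) z * f z) = measure lborel (ball z0 r) * f z0"
proof -
  define a where "a = (\<lambda>n. (deriv ^^ n) f z0 / fact n)"
  let ?g = "\<lambda>n z. indicator (ball z0 r) z * (a n * (z - z0) ^ n)"
  have sums: "(\<lambda>n. a n * (w - z0) ^ n) sums f w" if "w \<in> ball z0 R" for w
    unfolding a_def by (rule holomorphic_power_series[OF hol that])
  \<comment> \<open>A radius strictly between \<open>r\<close> and \<open>R\<close>: convergence
    there gives absolute convergence at distance \<open>r\<close>, which dominates the series on the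
    whole disk.\<close>
  define s where "s = (r + R) / 2"
  have s: "r < s" "s < R" "0 < s" using r by (auto simp: s_def)
  have "summable (\<lambda>n. a n * complex_of_real s ^ n)"
    using sums[of "z0 + s"] s r by (auto simp: dist_norm sums_iff)
  then have summ: "summable (\<lambda>n. norm (a n * complex_of_real r ^ n))"
    by (rule powser_insidea) (use s r in auto)
  have int: "integrable lborel (?g n)" for n
  proof (rule integrable_ball_bounded)
    show "(\<lambda>z. a n * (z - z0) ^ n) \<in> borel_measurable borel"
      by (intro borel_measurable_continuous_onI continuous_intros)
    show "cmod (a n * (z - z0) ^ n) \<le> cmod (a n) * r ^ n" if "z \<in> ball z0 r" for z
      using that by (auto simp: norm_mult norm_power dist_norm norm_minus_commute intro!: mult_left_mono power_mono)
  qed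
  have le: "norm (?g n z) \<le> norm (a n * complex_of_real r ^ n) * indicator (ball z0 r) z" for n z
    using r by (auto simp: indicator_def norm_mult norm_power dist_norm norm_minus_commute intro!: mult_left_mono power_mono)
  have "(LINT z|lborel. indicator (ball z0 r) z * f z) = (LINT z|lborel. (\<Sum>n. ?g n z))"
  proof (rule Bochner_Integration.integral_cong)
    fix z show "indicator (ball z0 r) z * f z = (\<Sum>n. ?g n z)"
    proof (cases "z \<in> ball z0 r")
      case True
      then show ?thesis using sums[of z] r by (simp add: sums_iff)
    next
      case False then show ?thesis by simp
    qed
  qed simp
  also have "\<dots> = (\<Sum>n. LINT z|lborel. ?g n z)"
  proof (rule integral_suminf[OF int])
    show "AE z in lborel. summable (\<lambda>n. norm (?g n z))"
    proof (rule AE_I2)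
      fix z
      have "summable (\<lambda>n. norm (a n * complex_of_real r ^ n) * indicator (ball z0 r) z)"
        by (intro summable_mult2 summ)
      then show "summable (\<lambda>n. norm (?g n z))"
        by (rule summable_comparison_test'[where N = 0]) (use le in simp)
    qed
    show "summable (\<lambda>n. LINT z|lborel. norm (?g n z))"
    proof (rule summable_comparison_test'[where N = 0])
      show "summable (\<lambda>n. norm (a n * complex_of_real r ^ n) * measure lborel (ball z0 r))"
        by (intro summable_mult2 summ)
      fix n
      have "(LINT z|lborel. norm (?g n z)) \<le> (LINT z|lborel. norm (a n * complex_of_real r ^ n) * indicator (ball z0 r) z)"
        using int[of n] le emeasure_lborel_ball_finite[of z0 r]
        by (intro integral_mono) (auto simp: less_top)
      then show "norm (LINT z|lborel. norm (?g n z)) \<le> norm (a n * complex_of_real r ^ n) * measure lborel (ball z0 r)"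
        by simp
    qed
  qed
  also have "\<dots> = (\<Sum>n. if n = 0 then measure lborel (ball z0 r) * f z0 else 0)"
  proof (rule suminf_cong)
    fix n
    have "(LINT z|lborel. ?g n z) = a n * (LINT z|lborel. indicator (ball z0 r) z * (z - z0) ^ n)"
      by (subst integral_mult_right_zero[symmetric]) (simp add: algebra_simps)
    moreover have "(LINT z|lborel. indicator (ball z0 r) z :: complex) = measure lborel (ball z0 r)"
    proof -
      have "(LINT z|lborel. indicator (ball z0 r) z :: complex) = (LINT z|lborel. complex_of_real (indicator (ball z0 r) z))"
        by (intro Bochner_Integration.integral_cong) (auto simp: indicator_def)
      also have "\<dots> = complex_of_real (LINT z|lborel. indicator (ball z0 r) z)"
        by (rule integral_complex_of_real)
      finally show ?thesis by simp
    qed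
    ultimately show "(LINT z|lborel. ?g n z) = (if n = 0 then measure lborel (ball z0 r) * f z0 else 0)"
      using integral_ball_power[of n z0 r] by (auto simp: a_def)
  qed
  also have "\<dots> = measure lborel (ball z0 r) * f z0"
    by (subst suminf_finite[of "{0}"]) auto
  finally show ?thesis .
qed

section \<open>Bounded point evaluations and completeness\<close>

lemma measure_unit_ball_pos: "measure lborel (ball (0::complex) 1) > 0"
  using content_ball_pos[of 1 "0::complex"] by simp

lemma nn_integral_disk_area:
  assumes [measurable]: "f \<in> borel_measurable borel"
  shows "(\<integral>\<^sup>+z. f z \<partial>disk_area) = (\<integral>\<^sup>+z\<in>ball 0 1. f z \<partial>lborel) / ennreal (measure lborel (ball (0::complex) 1))"
proof -
  have "emeasure lborel (ball (0::complex) 1) = ennreal (measure lborel (ball (0::complex) 1))"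
    using emeasure_lborel_ball_finite[of "0::complex" 1] by (simp add: emeasure_eq_ennreal_measure less_top)
  then show ?thesis
    unfolding disk_area_def by (subst nn_integral_uniform_measure) auto
qed

lemma bergman_fun_measurable [measurable]: "bergman_fun f \<in> borel_measurable borel"
  by (rule bergman_set_measurable[OF bergman_fun])

lemma integral_cmod2_eq_inner:
  "(LINT z|disk_area. (cmod (bergman_fun f z))\<^sup>2) = inner f f"
proof -
  have "(LINT z|disk_area. bergman_fun f z * cnj (bergman_fun f z))
      = (LINT z|disk_area. complex_of_real ((cmod (bergman_fun f z))\<^sup>2))"
    by (simp only: complex_norm_square)
  also have "\<dots> = complex_of_real (LINT z|disk_area. (cmod (bergman_fun f z))\<^sup>2)"
    by (rule integral_complex_of_real)
  finally show ?thesis by (simp add: inner_bergman_def)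
qed

lemma integrable_bergman_cmod2: "integrable disk_area (\<lambda>z. (cmod (bergman_fun f z))\<^sup>2)"
  using bergman_fun[of f] by (simp add: bergman_set_def)

lemma bergman_norm_nn_integral:
  "(\<integral>\<^sup>+z. ennreal ((cmod (bergman_fun f z))\<^sup>2) \<partial>disk_area) = ennreal ((norm f)\<^sup>2)"
  unfolding power2_norm_eq_inner[of f] integral_cmod2_eq_inner[symmetric]
  by (rule nn_integral_eq_integral[OF integrable_bergman_cmod2]) auto

lemma bergman_fun_holomorphic: "bergman_fun f holomorphic_on ball 0 1"
  using bergman_fun[of f] by (simp add: bergman_set_def)

lemma bergman_fun_outside: "z \<notin> ball 0 1 \<Longrightarrow> bergman_fun f z = 0"
  using bergman_fun[of f] unfolding bergman_set_def by blast

text \<open>Mean value property of the square of the function: the area of the small disk times the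
  squared modulus at \<open>z0\<close> is at most the integral of the squared modulus over the unit
  disk. The factor \<open>r\<close> is the square root of the ratio of the two areas.\<close>

lemma bergman_point_bound:
  assumes r: "0 < r" and sub: "cball z0 r \<subseteq> ball 0 1"
  shows "r * cmod (bergman_fun f z0) \<le> norm f"
proof -
  let ?F = "bergman_fun f" and ?V = "measure lborel (ball (0::complex) 1)"
  \<comment> \<open>\<open>area_mean_value\<close> wants holomorphy on a strictly larger concentric
    disk. The point of the closed disk farthest from the origin lies in the unit disk, so
    \<open>cmod z0 + r < 1\<close>.\<close>
  obtain R where R: "r < R" "ball z0 R \<subseteq> ball 0 1"
  proof -
    have "cmod z0 + r < 1"
    proof -
      define u where "u = (if z0 = 0 then 1 else z0 / cmod z0)"
      have u: "cmod u = 1" "z0 = cmod z0 * u" by (auto simp: u_def norm_divide)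
      have "z0 + r * u \<in> cball z0 r" using r u by (simp add: dist_norm norm_mult)
      then have "cmod (z0 + r * u) < 1" using sub by auto
      also have "z0 + r * u = (cmod z0 + r) * u" by (subst u(2)) (simp add: algebra_simps)
      finally show ?thesis using r u by (simp add: norm_mult flip: of_real_add)
    qed
    then show ?thesis
    proof (intro that[of "1 - cmod z0"] subsetI)
      fix t assume "t \<in> ball z0 (1 - cmod z0)"
      then show "t \<in> ball 0 1" using norm_triangle_sub[of t z0] by (simp add: dist_norm norm_minus_commute)
    qed auto
  qed
  have hol: "(\<lambda>z. (?F z)\<^sup>2) holomorphic_on ball z0 R"
    using holomorphic_on_subset[OF bergman_fun_holomorphic R(2)] by (intro holomorphic_intros)
  have sub': "ball z0 r \<subseteq> ball 0 1" using sub ball_subset_cball by blast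
  have "ennreal ((r * cmod (?F z0))\<^sup>2) * ennreal ?V = ennreal (measure lborel (ball z0 r) * (cmod (?F z0))\<^sup>2)"
    using content_ball_conv_unit_ball[of r z0] r by (simp add: power_mult_distrib ennreal_mult[symmetric] mult_ac)
  also have "measure lborel (ball z0 r) * (cmod (?F z0))\<^sup>2 = cmod (LINT z|lborel. indicator (ball z0 r) z * (?F z)\<^sup>2)"
    by (subst area_mean_value[OF hol r R(1)]) (simp add: norm_mult norm_power)
  also have "ennreal \<dots> \<le> (\<integral>\<^sup>+z. ennreal (norm (indicator (ball z0 r) z * (?F z)\<^sup>2)) \<partial>lborel)"
  proof (cases "integrable lborel (\<lambda>z. indicator (ball z0 r) z * (?F z)\<^sup>2)")
    case True
    then show ?thesis by (rule integral_norm_bound_ennreal)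
  next
    case False
    then show ?thesis by (simp add: not_integrable_integral_eq)
  qed
  also have "\<dots> \<le> (\<integral>\<^sup>+z\<in>ball 0 1. ennreal ((cmod (?F z))\<^sup>2) \<partial>lborel)"
    using sub' by (intro nn_integral_mono) (auto simp: indicator_def norm_mult norm_power)
  also have "\<dots> = ennreal ((norm f)\<^sup>2) * ennreal ?V"
    unfolding bergman_norm_nn_integral[symmetric] using measure_unit_ball_pos
    by (subst nn_integral_disk_area) (auto simp: ennreal_divide_times ennreal_mult_divide_eq)
  finally have "(r * cmod (?F z0))\<^sup>2 * ?V \<le> (norm f)\<^sup>2 * ?V"
    by (simp add: ennreal_mult[symmetric])
  then have "(r * cmod (?F z0))\<^sup>2 \<le> (norm f)\<^sup>2"
    using measure_unit_ball_pos by (simp add: mult_le_cancel_right)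
  then show ?thesis by (rule power2_le_imp_le) simp
qed

lemma cball_subset_unit_ball:
  assumes "cmod z \<le> R" "R < 1"
  shows "cball z ((1 - R) / 2) \<subseteq> ball 0 1"
proof
  fix w assume "w \<in> cball z ((1 - R) / 2)"
  then have "cmod (w - z) \<le> (1 - R) / 2" by (simp add: dist_norm norm_minus_commute)
  then show "w \<in> ball 0 1" using assms norm_triangle_sub[of w z] by simp
qed

lemma bergman_fun_diff: "bergman_fun (f - g) z = bergman_fun f z - bergman_fun g z"
  by (simp add: minus_bergman.rep_eq)

lemma bergman_fun_add: "bergman_fun (f + g) z = bergman_fun f z + bergman_fun g z"
  by (simp add: plus_bergman.rep_eq)

lemma bergman_fun_zero [simp]: "bergman_fun 0 z = 0"
  by (simp add: zero_bergman.rep_eq)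

lemma bergman_fun_cscale [simp]: "bergman_fun (cscale c f) z = c * bergman_fun f z"
  by (simp add: cscale.rep_eq)

lemma bergman_eqI: "(\<And>z. z \<in> ball 0 1 \<Longrightarrow> bergman_fun f z = bergman_fun g z) \<Longrightarrow> f = g"
  by (rule bergman_fun_inject[THEN iffD1]) (metis bergman_fun_outside ext)

text \<open>Bounded point evaluations make a Cauchy sequence converge uniformly on each smaller
  closed disk, so the pointwise limit is holomorphic; Fatou's lemma then upgrades pointwise
  convergence to convergence in norm.\<close>

instance bergman :: complete_space
proof
  fix X :: "nat \<Rightarrow> bergman" assume C: "Cauchy X"
  let ?f = "\<lambda>n. bergman_fun (X n)"
  define g where "g = (\<lambda>z. lim (\<lambda>n. ?f n z))"
  have ul: "uniform_limit (cball 0 R) ?f g sequentially" if R: "R < 1" for R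
  proof -
    have "uniformly_Cauchy_on (cball 0 R) ?f"
    proof (rule uniformly_Cauchy_onI)
      fix e :: real assume e: "e > 0"
      then have "e * ((1 - R) / 2) > 0" using R by simp
      then obtain M where M: "\<And>m n. m \<ge> M \<Longrightarrow> n \<ge> M \<Longrightarrow> dist (X m) (X n) < e * ((1 - R) / 2)"
        using C unfolding Cauchy_def by meson
      show "\<exists>M. \<forall>x\<in>cball 0 R. \<forall>m\<ge>M. \<forall>n\<ge>M. dist (?f m x) (?f n x) < e"
      proof (intro exI[of _ M] ballI allI impI)
        fix x :: complex and m n assume x: "x \<in> cball 0 R" and mn: "m \<ge> M" "n \<ge> M"
        have "(1 - R) / 2 * cmod (bergman_fun (X m - X n) x) \<le> norm (X m - X n)"
          using x R by (intro bergman_point_bound cball_subset_unit_ball) auto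
        also have "\<dots> < e * ((1 - R) / 2)" using M[OF mn] by (simp add: dist_norm)
        finally show "dist (?f m x) (?f n x) < e"
          using R by (simp add: bergman_fun_diff dist_norm mult.commute)
      qed
    qed
    then show ?thesis
      unfolding g_def using Cauchy_uniformly_convergent uniformly_convergent_uniform_limit_iff by blast
  qed
  have lim: "(\<lambda>n. ?f n z) \<longlonglongrightarrow> g z" for z
  proof (cases "z \<in> ball 0 1")
    case True
    then show ?thesis using tendsto_uniform_limitI[OF ul[of "cmod z"], of z] by simp
  next
    case False
    then show ?thesis by (simp add: g_def bergman_fun_outside)
  qed
  have hol: "g holomorphic_on ball 0 1"
  proof (rule holomorphic_uniform_sequence[of _ ?f])
    fix z :: complex assume z: "z \<in> ball 0 1"
    define R where "R = (1 + cmod z) / 2"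
    have R: "R < 1" using z by (simp add: R_def)
    have "cball z ((1 - cmod z) / 2) \<subseteq> cball 0 R"
    proof
      fix w assume "w \<in> cball z ((1 - cmod z) / 2)"
      then have "cmod (w - z) \<le> (1 - cmod z) / 2" by (simp add: dist_norm norm_minus_commute)
      then show "w \<in> cball 0 R" using norm_triangle_sub[of w z] by (simp add: R_def field_simps)
    qed
    moreover have "cball 0 R \<subseteq> ball 0 1" using R by auto
    ultimately show "\<exists>d>0. cball z d \<subseteq> ball 0 1 \<and> uniform_limit (cball z d) ?f g sequentially"
      using z uniform_limit_on_subset[OF ul[OF R]]
      by (intro exI[of _ "(1 - cmod z) / 2"]) auto
  qed (auto intro: bergman_fun_holomorphic)
  have g0: "g z = 0" if "z \<notin> ball 0 1" for z
    using that by (simp add: g_def bergman_fun_outside)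
  have gm[measurable]: "g \<in> borel_measurable borel"
    by (rule borel_measurable_LIMSEQ_metric[of ?f]) (use lim in auto)
  \<comment> \<open>Used twice: with \<open>e = 1\<close> to see that the limit differs from one
    \<open>X M\<close> by a square integrable function, then with small \<open>e\<close> for the
    convergence itself.\<close>
  have fatou: "(\<integral>\<^sup>+z. ennreal ((cmod (g z - ?f k z))\<^sup>2) \<partial>disk_area) \<le> ennreal (e\<^sup>2)"
    if e: "e > 0" and k: "\<And>m. m \<ge> M \<Longrightarrow> dist (X m) (X k) < e" for e k M
  proof -
    have "(\<integral>\<^sup>+z. ennreal ((cmod (g z - ?f k z))\<^sup>2) \<partial>disk_area)
        = (\<integral>\<^sup>+z. liminf (\<lambda>m. ennreal ((cmod (?f m z - ?f k z))\<^sup>2)) \<partial>disk_area)"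
    proof (rule nn_integral_cong)
      fix z
      have "(\<lambda>m. ennreal ((cmod (?f m z - ?f k z))\<^sup>2)) \<longlonglongrightarrow> ennreal ((cmod (g z - ?f k z))\<^sup>2)"
        by (intro tendsto_ennrealI tendsto_intros lim)
      then show "ennreal ((cmod (g z - ?f k z))\<^sup>2) = liminf (\<lambda>m. ennreal ((cmod (?f m z - ?f k z))\<^sup>2))"
        using lim_imp_Liminf by (metis trivial_limit_sequentially)
    qed
    also have "\<dots> \<le> liminf (\<lambda>m. \<integral>\<^sup>+z. ennreal ((cmod (?f m z - ?f k z))\<^sup>2) \<partial>disk_area)"
      by (rule nn_integral_liminf) (simp only: measurable_disk_area, measurable)
    also have "\<dots> = liminf (\<lambda>m. ennreal ((norm (X m - X k))\<^sup>2))"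
      by (simp add: bergman_norm_nn_integral[symmetric] bergman_fun_diff)
    also have "\<dots> \<le> liminf (\<lambda>m::nat. ennreal (e\<^sup>2))"
    proof (rule Liminf_mono)
      show "\<forall>\<^sub>F m in sequentially. ennreal ((norm (X m - X k))\<^sup>2) \<le> ennreal (e\<^sup>2)"
        unfolding eventually_sequentially using k[THEN less_imp_le]
        by (intro exI[of _ M] allI impI ennreal_leI power_mono) (auto simp: dist_norm)
    qed
    also have "\<dots> = ennreal (e\<^sup>2)" by (simp add: Liminf_const)
    finally show ?thesis .
  qed
  obtain M where M: "\<And>m. m \<ge> M \<Longrightarrow> dist (X m) (X M) < 1"
    using C unfolding Cauchy_def by (metis less_numeral_extra(1) order_refl)
  have diffset: "(\<lambda>z. g z - ?f M z) \<in> bergman_set"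
    unfolding bergman_set_def
  proof (safe)
    show "(\<lambda>z. g z - ?f M z) holomorphic_on ball 0 1"
      by (intro holomorphic_intros hol bergman_fun_holomorphic)
    show "integrable disk_area (\<lambda>z. (cmod (g z - ?f M z))\<^sup>2)"
    proof (rule integrableI_nonneg)
      show "(\<lambda>z. (cmod (g z - ?f M z))\<^sup>2) \<in> borel_measurable disk_area"
        by (simp only: measurable_disk_area) measurable
      show "(\<integral>\<^sup>+z. ennreal ((cmod (g z - ?f M z))\<^sup>2) \<partial>disk_area) < \<infinity>"
        using fatou[OF _ M, of M] by (simp add: le_less_trans)
    qed simp
    show "g z - ?f M z = 0" if "z \<notin> ball 0 1" for z using that by (simp add: g0 bergman_fun_outside)
  qed
  have "g \<in> bergman_set" using add_in_bergman_set[OF diffset bergman_fun[of "X M"]] by simp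
  define L where "L = Bergman g"
  have L: "bergman_fun L = g" using \<open>g \<in> bergman_set\<close> by (simp add: L_def Bergman_inverse)
  have "X \<longlonglongrightarrow> L"
  proof (rule metric_LIMSEQ_I)
    fix e :: real assume e: "e > 0"
    then obtain N where N: "\<And>m n. m \<ge> N \<Longrightarrow> n \<ge> N \<Longrightarrow> dist (X m) (X n) < e / 2"
      using C unfolding Cauchy_def by (meson half_gt_zero)
    show "\<exists>N. \<forall>n\<ge>N. dist (X n) L < e"
    proof (intro exI[of _ N] allI impI)
      fix n assume n: "n \<ge> N"
      have "ennreal ((norm (L - X n))\<^sup>2) \<le> ennreal ((e / 2)\<^sup>2)"
        unfolding bergman_norm_nn_integral[symmetric] bergman_fun_diff L
        by (rule fatou[of _ N]) (use e N n in auto)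
      then have "norm (L - X n) \<le> e / 2" using e by (simp add: abs_le_square_iff[symmetric])
      then show "dist (X n) L < e" using e by (simp add: dist_norm norm_minus_commute)
    qed
  qed
  then show "convergent X" by (rule convergentI)
qed

section \<open>Adjoints and commutants\<close>

text \<open>Direct method: half the squared norm minus \<open>L\<close> has a minimiser, because the
  parallelogram law makes minimising sequences Cauchy; the vanishing of the first variation there is
  the claim.\<close>

lemma riesz_representation:
  fixes L :: "'a :: {real_inner, complete_space} \<Rightarrow> real"
  assumes "bounded_linear L"
  shows "\<exists>x. \<forall>y. L y = inner x y"
proof -
  interpret L: bounded_linear L by fact
  define J where "J = (\<lambda>x. (norm x)\<^sup>2 / 2 - L x)"
  obtain K where K: "\<And>x. norm (L x) \<le> norm x * K" using L.bounded by blast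
  have lower: "- K\<^sup>2 / 2 \<le> J x" for x
  proof -
    have "0 \<le> (norm x - K)\<^sup>2" by simp
    moreover have "L x \<le> norm x * K" using K[of x] by simp
    ultimately show ?thesis by (simp add: J_def power2_eq_square algebra_simps)
  qed
  define j where "j = (INF x. J x)"
  have bdd: "bdd_below (range J)" using lower by (intro bdd_belowI) auto
  have j: "j \<le> J x" for x unfolding j_def by (rule cINF_lower[OF bdd]) simp
  have "\<exists>x. J x < j + 1 / real (Suc k)" for k
    using cINF_less_iff[OF _ bdd, of "j + 1 / real (Suc k)"] by (auto simp: j_def)
  then obtain X where X: "\<And>k. J (X k) < j + 1 / real (Suc k)" by metis
  have par: "(norm (x - y))\<^sup>2 / 4 = J x + J y - 2 * J ((x + y) /\<^sub>R 2)" for x y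
  proof -
    have "(norm ((x + y) /\<^sub>R 2))\<^sup>2 = (norm (x + y))\<^sup>2 / 4" by (simp add: power2_eq_square)
    then show ?thesis
      by (simp add: J_def L.add L.scale power2_norm_eq_inner inner_simps inner_commute field_simps)
  qed
  \<comment> \<open>By \<open>par\<close> a quarter of the left side is
    \<open>J (X k) + J (X l)\<close> minus twice \<open>J\<close> at the midpoint, hence below
    \<open>2 * (1 / real (Suc m))\<close>; this is the origin of the 8.\<close>
  have close: "(norm (X k - X l))\<^sup>2 < 8 * (1 / real (Suc m))" if "k \<ge> m" "l \<ge> m" for k l m
  proof -
    have "1 / real (Suc k) \<le> 1 / real (Suc m)" "1 / real (Suc l) \<le> 1 / real (Suc m)"
      using that by (auto simp: field_simps)
    then show ?thesis
      using par[of "X k" "X l"] X[of k] X[of l] j[of "(X k + X l) /\<^sub>R 2"] by linarith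
  qed
  have "Cauchy X"
  proof (rule metric_CauchyI)
    fix e :: real assume e: "e > 0"
    obtain m where m: "8 / e\<^sup>2 < real (Suc m)" using reals_Archimedean2 less_trans
      by (metis lessI of_nat_less_iff)
    then have "8 * (1 / real (Suc m)) < e\<^sup>2" using e by (simp add: field_simps)
    then have "norm (X k - X l) < e" if "k \<ge> m" "l \<ge> m" for k l
      using close[OF that] e by (intro power2_less_imp_less[of _ e]) auto
    then show "\<exists>M. \<forall>m\<ge>M. \<forall>n\<ge>M. dist (X m) (X n) < e" by (auto simp: dist_norm)
  qed
  then obtain x where x: "X \<longlonglongrightarrow> x" using Cauchy_convergent convergentD by blast
  have "(\<lambda>k. J (X k)) \<longlonglongrightarrow> J x"
    unfolding J_def by (intro tendsto_intros L.tendsto x) auto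
  moreover have "(\<lambda>k. j + 1 / real (Suc k)) \<longlonglongrightarrow> j + 0"
    using LIMSEQ_inverse_real_of_nat by (intro tendsto_intros) (simp add: inverse_eq_divide)
  ultimately have "J x \<le> j + 0"
    by (rule LIMSEQ_le) (use X less_imp_le in blast)
  then have Jx: "J x \<le> J y" for y using j[of y] by simp
  have "L y = inner x y" for y
  proof (rule ccontr)
    assume ne: "L y \<noteq> inner x y"
    define d where "d = L y - inner x y"
    have "y \<noteq> 0" using ne by (auto simp: L.zero)
    \<comment> \<open>The minimiser of the quadratic polynomial \<open>J (x + t *\<^sub>R y)\<close>
      in \<open>t\<close>; it lowers \<open>J\<close> by
      \<open>d\<^sup>2 / (norm y)\<^sup>2 / 2\<close>, which contradicts minimality.\<close>
    define t where "t = d / (norm y)\<^sup>2"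
    have "(norm (x + t *\<^sub>R y))\<^sup>2 = (norm x)\<^sup>2 + 2 * t * inner x y + t\<^sup>2 * (norm y)\<^sup>2"
      unfolding power2_norm_eq_inner by (simp add: inner_simps inner_commute power2_eq_square)
    then have "J (x + t *\<^sub>R y) = J x - t * d + t\<^sup>2 * (norm y)\<^sup>2 / 2"
      by (simp add: J_def d_def L.add L.scale field_simps)
    also have "\<dots> = J x - d\<^sup>2 / (norm y)\<^sup>2 / 2"
      using \<open>y \<noteq> 0\<close> by (simp add: t_def power2_eq_square field_simps)
    also have "\<dots> < J x" using ne \<open>y \<noteq> 0\<close> by (simp add: d_def)
    finally show False using Jx[of "x + t *\<^sub>R y"] by simp
  qed
  then show ?thesis by blast
qed

lemma integrable_bergman_cinner: "integrable disk_area (\<lambda>z. bergman_fun f z * cnj (bergman_fun g z))"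
  by (rule integrable_bergman_product[OF bergman_fun bergman_fun])

lemma cinner_add_left: "cinner (f + g) h = cinner f h + cinner g h"
  by (simp add: cinner_def bergman_fun_add distrib_right integrable_bergman_cinner)

lemma cinner_scale_left [simp]: "cinner (cscale c f) g = c * cinner f g"
  by (simp add: cinner_def mult.assoc)

lemma cinner_commute: "cinner g f = cnj (cinner f g)"
  unfolding cinner_def by (subst Bochner_Integration.integral_cnj[symmetric]) (simp add: mult.commute)

lemma cinner_add_right: "cinner h (f + g) = cinner h f + cinner h g"
  by (subst (1 2 3) cinner_commute) (simp add: cinner_add_left)

lemma cinner_scale_right [simp]: "cinner f (cscale c g) = cnj c * cinner f g"
  by (subst (1 2) cinner_commute) simp

lemma Re_cinner: "Re (cinner f g) = inner f g"
  by (simp add: cinner_def inner_bergman_def)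

lemma Im_cinner: "Im (cinner f g) = inner f (cscale \<i> g)"
  unfolding Re_cinner[symmetric] by simp

lemma inner_eqI: "(\<And>x. inner x y = inner x z) \<Longrightarrow> y = z"
  by (metis inner_commute vector_eq_ldot)

lemma cinner_eqI:
  assumes "\<And>f. cinner f g = cinner f h"
  shows "g = h"
proof (rule inner_eqI)
  fix f show "inner f g = inner f h" using assms[of f] Re_cinner by metis
qed

lemma cscale_add: "cscale c (f + g) = cscale c f + cscale c g"
  by (rule bergman_eqI) (simp add: bergman_fun_add algebra_simps)

lemma cscale_cscale [simp]: "cscale c (cscale d f) = cscale (c * d) f"
  by (rule bergman_eqI) simp

lemma scaleR_cscale: "r *\<^sub>R f = cscale (complex_of_real r) f"
  by (rule bergman_eqI) (simp add: scaleR_bergman.rep_eq)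

lemma norm_cscale: "norm (cscale c f) = cmod c * norm f"
proof -
  have "(norm (cscale c f))\<^sup>2 = (cmod c * norm f)\<^sup>2"
    unfolding power_mult_distrib power2_norm_eq_inner[where 'a = bergman] integral_cmod2_eq_inner[symmetric]
    by (simp add: norm_mult power_mult_distrib)
  then show ?thesis by (simp add: power2_eq_iff_nonneg)
qed

lemma bounded_opsI:
  assumes "\<And>f g. T (f + g) = T f + T g" "\<And>c f. T (cscale c f) = cscale c (T f)"
    and "\<And>f. norm (T f) \<le> norm f * K"
  shows "T \<in> bounded_ops"
  using assms unfolding bounded_ops_def
  by (auto intro!: bounded_linear_intro simp: scaleR_cscale)

lemma bounded_ops_add: "T \<in> bounded_ops \<Longrightarrow> T (f + g) = T f + T g"
  by (simp add: bounded_ops_def linear_simps)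

lemma bounded_ops_diff: "T \<in> bounded_ops \<Longrightarrow> T (f - g) = T f - T g"
  by (simp add: bounded_ops_def linear_simps)

lemma bounded_ops_cscale: "T \<in> bounded_ops \<Longrightarrow> T (cscale c f) = cscale c (T f)"
  by (simp add: bounded_ops_def)

lemma bounded_ops_bounded: "T \<in> bounded_ops \<Longrightarrow> \<exists>K. \<forall>f. norm (T f) \<le> norm f * K"
  by (auto simp: bounded_ops_def dest: bounded_linear.bounded)

text \<open>Riesz for the real inner product yields the real adjoint. It commutes with
  multiplication by the imaginary unit, because \<open>T\<close> does and that multiplication is
  skew for \<open>inner\<close>; since \<open>Im_cinner\<close> expresses imaginary parts by
  \<open>inner\<close>, the real adjoint is the complex one.\<close>

lemma adjoint_exists:
  assumes T: "T \<in> bounded_ops"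
  shows "\<exists>S. \<forall>f g. cinner (T f) g = cinner f (S g)"
proof -
  have bl: "bounded_linear T" using T by (simp add: bounded_ops_def)
  have "\<exists>x. \<forall>f. inner (T f) g = inner x f" for g
    using riesz_representation[OF bounded_linear_compose[OF bounded_linear_inner_left bl]] .
  then obtain S where S: "\<And>g f. inner (T f) g = inner f (S g)" by (metis inner_commute)
  have Si: "S (cscale \<i> g) = cscale \<i> (S g)" for g
  proof (rule inner_eqI)
    fix f
    have rot: "inner h (cscale \<i> k) = - inner (cscale \<i> h) k" for h k
      unfolding Re_cinner[symmetric] by simp
    show "inner f (S (cscale \<i> g)) = inner f (cscale \<i> (S g))"
      by (simp add: S[symmetric] rot bounded_ops_cscale[OF T, symmetric])
  qed
  have "cinner (T f) g = cinner f (S g)" for f g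
    by (simp add: complex_eq_iff Re_cinner Im_cinner S Si)
  then show ?thesis by blast
qed

lemma adj_eqI:
  assumes "\<And>f g. cinner (T f) g = cinner f (S g)"
  shows "adj T = S"
  unfolding adj_def
proof (rule the_equality)
  fix S' assume "\<forall>f g. cinner (T f) g = cinner f (S' g)"
  then show "S' = S" using assms by (intro ext cinner_eqI) metis
qed (use assms in blast)

lemma cinner_adj:
  assumes "T \<in> bounded_ops"
  shows "cinner (T f) g = cinner f (adj T g)"
  using adjoint_exists[OF assms] adj_eqI by metis

lemma cinner_adj':
  assumes "T \<in> bounded_ops"
  shows "cinner (adj T f) g = cinner f (T g)"
  by (metis assms cinner_adj cinner_commute)

lemma adj_bounded_ops:
  assumes T: "T \<in> bounded_ops"
  shows "adj T \<in> bounded_ops"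
proof -
  obtain K where K: "\<And>f. norm (T f) \<le> norm f * K" using bounded_ops_bounded[OF T] by blast
  show ?thesis
  proof (rule bounded_opsI[where K = K])
    show "adj T (f + g) = adj T f + adj T g" for f g
      by (rule cinner_eqI) (simp add: cinner_adj[OF T, symmetric] cinner_add_right)
    show "adj T (cscale c f) = cscale c (adj T f)" for c f
      by (rule cinner_eqI) (simp add: cinner_adj[OF T, symmetric])
    show "norm (adj T f) \<le> norm f * K" for f
    proof (cases "adj T f = 0")
      case True
      have "0 \<le> norm f * K" using K[of f] norm_ge_zero[of "T f"] by linarith
      then show ?thesis using True by simp
    next
      case False
      have "norm (adj T f) * norm (adj T f) = Re (cinner (adj T f) (adj T f))"
        by (simp add: Re_cinner power2_norm_eq_inner[symmetric] power2_eq_square)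
      also have "\<dots> = inner (T (adj T f)) f"
        by (simp add: cinner_adj[OF T, symmetric] Re_cinner)
      also have "\<dots> \<le> norm (T (adj T f)) * norm f" by (rule norm_cauchy_schwarz)
      also have "\<dots> \<le> norm (adj T f) * K * norm f" by (intro mult_right_mono K) simp
      finally show ?thesis using False by (simp add: mult.commute mult.left_commute mult_le_cancel_left)
    qed
  qed
qed

lemma adj_adj: "T \<in> bounded_ops \<Longrightarrow> adj (adj T) = T"
  by (rule adj_eqI) (rule cinner_adj')

lemma comp_bounded_ops:
  assumes S: "S \<in> bounded_ops" and T: "T \<in> bounded_ops"
  shows "S \<circ> T \<in> bounded_ops"
  using assms bounded_linear_compose[of S T] by (auto simp: bounded_ops_def comp_def)

lemma op_scale_bounded_ops: "T \<in> bounded_ops \<Longrightarrow> op_scale c T \<in> bounded_ops"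
proof -
  assume T: "T \<in> bounded_ops"
  obtain K where K: "\<And>f. norm (T f) \<le> norm f * K" using bounded_ops_bounded[OF T] by blast
  show ?thesis
  proof (rule bounded_opsI[where K = "cmod c * K"])
    show "norm (op_scale c T f) \<le> norm f * (cmod c * K)" for f
      using mult_left_mono[OF K, of "cmod c" f] by (simp add: op_scale_def norm_cscale mult_ac)
  qed (auto simp: op_scale_def bounded_ops_add[OF T] bounded_ops_cscale[OF T] cscale_add mult.commute)
qed

lemma subspace_bounded_ops: "ops.subspace bounded_ops"
proof (rule ops.subspaceI)
  show "0 \<in> bounded_ops"
    by (rule bounded_opsI[where K = 0]) (auto simp: bergman_eqI)
  show "S + T \<in> bounded_ops" if "S \<in> bounded_ops" "T \<in> bounded_ops" for S T
    using that bounded_linear_add[of S T] by (auto simp: bounded_ops_def plus_fun_def cscale_add)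
qed (rule op_scale_bounded_ops)

section \<open>Commutants as von Neumann algebras\<close>

lemma subspace_commutant:
  assumes "X \<subseteq> bounded_ops"
  shows "ops.subspace (commutant X)"
proof (rule ops.subspaceI)
  show "0 \<in> commutant X"
    using ops.subspace_0[OF subspace_bounded_ops] assms
      bounded_ops_diff[of _ 0 0] by (force simp: commutant_def fun_eq_iff)
  show "S + T \<in> commutant X" if "S \<in> commutant X" "T \<in> commutant X" for S T
    using that assms ops.subspace_add[OF subspace_bounded_ops]
    by (auto simp: commutant_def fun_eq_iff bounded_ops_add subset_iff)
  show "op_scale c T \<in> commutant X" if "T \<in> commutant X" for c T
    using that assms op_scale_bounded_ops
    by (auto simp: commutant_def fun_eq_iff op_scale_def bounded_ops_cscale subset_iff)
qed

lemma commutant_adj: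
  assumes M: "M \<in> bounded_ops" and T: "T \<in> commutant {M}"
  shows "adj T \<in> commutant {adj M}"
proof -
  have T': "T \<in> bounded_ops" "\<And>f. T (M f) = M (T f)"
    using T by (auto simp: commutant_def fun_eq_iff)
  have "adj T (adj M f) = adj M (adj T f)" for f
    by (rule cinner_eqI) (simp add: cinner_adj[OF M, symmetric] cinner_adj[OF T'(1), symmetric] T'(2))
  then show ?thesis using adj_bounded_ops[OF T'(1)] by (auto simp: commutant_def fun_eq_iff)
qed

text \<open>Commutation with \<open>M\<close> says that the matrix entries of \<open>T\<close> at
  \<open>(M f, g)\<close> and at \<open>(f, adj M g)\<close> agree for all \<open>f\<close> and
  \<open>g\<close>. This equates pairs of coordinates in the product topology, hence is a closed
  condition.\<close>

lemma closedin_commutant: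
  assumes M: "M \<in> bounded_ops"
  shows "closedin weak_operator_topology (commutant {M})"
proof -
  let ?F = "\<lambda>T. \<lambda>(f, g). cinner (T f) g"
  define C where "C = (\<Inter>f. \<Inter>g. {p :: bergman \<times> bergman \<Rightarrow> complex. p (M f, g) = p (f, adj M g)})"
  have "closed C"
    unfolding C_def
    by (intro closed_INT ballI closed_Collect_eq continuous_on_product_coordinates)
  have mem: "T \<in> commutant {M} \<longleftrightarrow> T \<in> bounded_ops \<and> ?F T \<in> C" for T
  proof -
    have "(\<forall>f. T (M f) = M (T f)) \<longleftrightarrow> (\<forall>f g. cinner (T (M f)) g = cinner (T f) (adj M g))"
      unfolding cinner_adj[OF M, symmetric]
      by (metis cinner_commute cinner_eqI)
    then show ?thesis by (auto simp: commutant_def C_def fun_eq_iff)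
  qed
  have ts: "topspace weak_operator_topology = bounded_ops"
    by (simp add: weak_operator_topology_def topspace_pullback_topology)
  have "bounded_ops - commutant {M} = ?F -` (- C) \<inter> bounded_ops" using mem by blast
  moreover have "open (- C)" using \<open>closed C\<close> by (simp add: open_Compl)
  ultimately have "openin weak_operator_topology (bounded_ops - commutant {M})"
    unfolding weak_operator_topology_def openin_pullback_topology by (auto intro!: exI[of _ "- C"])
  then show ?thesis unfolding closedin_def ts by (auto simp: mem)
qed

text \<open>Passing to adjoints exchanges the two commutants, so their intersection is closed under
  \<open>adj\<close>; the other closure properties hold for each of them.\<close>

theorem von_neumann_algebra_commutant:
  assumes M: "M \<in> bounded_ops"
  shows "von_neumann_algebra (commutant {M} \<inter> commutant {adj M})"
  unfolding von_neumann_algebra_def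
proof (intro conjI ballI)
  note M' = adj_bounded_ops[OF M]
  show "ops.subspace (commutant {M} \<inter> commutant {adj M})"
    using M M' by (intro ops.subspace_inter subspace_commutant) auto
  show "id \<in> commutant {M} \<inter> commutant {adj M}"
    by (auto simp: commutant_def bounded_ops_def id_def)
  show "S \<circ> T \<in> commutant {M} \<inter> commutant {adj M}"
    if "S \<in> commutant {M} \<inter> commutant {adj M}" "T \<in> commutant {M} \<inter> commutant {adj M}" for S T
    using that comp_bounded_ops by (auto simp: commutant_def fun_eq_iff)
  show "adj T \<in> commutant {M} \<inter> commutant {adj M}" if "T \<in> commutant {M} \<inter> commutant {adj M}" for T
    using that commutant_adj[OF M, of T] commutant_adj[OF M', of T] by (simp add: adj_adj[OF M])
  show "closedin weak_operator_topology (commutant {M} \<inter> commutant {adj M})"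
    by (intro closedin_Int closedin_commutant M M')
qed

text \<open>The content is that the product lies in \<open>bergman_set\<close>, so that
  \<open>Bergman\<close> in \<open>mult_op\<close> is applied inside its domain.\<close>

lemma mult_op_fun:
  assumes hol: "\<phi> holomorphic_on ball 0 1" and le: "\<And>z. z \<in> ball 0 1 \<Longrightarrow> cmod (\<phi> z) \<le> 1"
  shows "bergman_fun (mult_op \<phi> h) z = \<phi> z * bergman_fun h z"
proof -
  let ?g = "\<lambda>z. \<phi> z * bergman_fun h z"
  \<comment> \<open>\<open>h\<close> vanishes outside the disk, so \<open>\<phi>\<close>, arbitrary
    there, can be cut off to a measurable function.\<close>
  have eq: "?g = (\<lambda>z. (if z \<in> ball 0 1 then \<phi> z else 0) * bergman_fun h z)"
    by (auto simp: bergman_fun_outside)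
  have m: "(\<lambda>z. if z \<in> ball 0 1 then \<phi> z else 0) \<in> borel_measurable borel"
    using hol by (intro borel_measurable_continuous_on_if) (auto simp: holomorphic_on_imp_continuous_on)
  have gm[measurable]: "?g \<in> borel_measurable borel" unfolding eq using m by measurable
  have "integrable disk_area (\<lambda>z. (cmod (?g z))\<^sup>2)"
  proof (rule Bochner_Integration.integrable_bound[OF integrable_bergman_cmod2[of h]])
    show "(\<lambda>z. (cmod (?g z))\<^sup>2) \<in> borel_measurable disk_area"
      by (simp only: measurable_disk_area) measurable
    have "norm ((cmod (?g z))\<^sup>2) \<le> norm ((cmod (bergman_fun h z))\<^sup>2)" for z
    proof (cases "z \<in> ball 0 1")
      case True
      have "cmod (?g z) \<le> 1 * cmod (bergman_fun h z)"
        unfolding norm_mult by (intro mult_right_mono le True) simp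
      then show ?thesis by simp
    qed (simp add: bergman_fun_outside)
    then show "AE z in disk_area. norm ((cmod (?g z))\<^sup>2) \<le> norm ((cmod (bergman_fun h z))\<^sup>2)" by simp
  qed
  then have "?g \<in> bergman_set"
    using hol bergman_fun_holomorphic[of h] by (auto simp: bergman_set_def bergman_fun_outside intro!: holomorphic_intros)
  then show ?thesis by (simp add: mult_op_def Bergman_inverse)
qed

lemma mult_op_bounded_ops:
  assumes hol: "\<phi> holomorphic_on ball 0 1" and le: "\<And>z. z \<in> ball 0 1 \<Longrightarrow> cmod (\<phi> z) \<le> 1"
  shows "mult_op \<phi> \<in> bounded_ops"
proof (rule bounded_opsI[where K = 1])
  have [simp]: "bergman_fun (mult_op \<phi> h) z = \<phi> z * bergman_fun h z" for h z
    using mult_op_fun[OF hol] le by blast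
  show "mult_op \<phi> (f + g) = mult_op \<phi> f + mult_op \<phi> g" for f g
    by (rule bergman_eqI) (simp add: bergman_fun_add algebra_simps)
  show "mult_op \<phi> (cscale c f) = cscale c (mult_op \<phi> f)" for c f
    by (rule bergman_eqI) simp
  show "norm (mult_op \<phi> f) \<le> norm f * 1" for f
  proof -
    have "(norm (mult_op \<phi> f))\<^sup>2 \<le> (norm f)\<^sup>2"
      unfolding power2_norm_eq_inner[where 'a = bergman] integral_cmod2_eq_inner[symmetric]
    proof (intro integral_mono integrable_bergman_cmod2)
      fix z
      show "(cmod (bergman_fun (mult_op \<phi> f) z))\<^sup>2 \<le> (cmod (bergman_fun f z))\<^sup>2"
      proof (cases "z \<in> ball 0 1")
        case True
        have "cmod (\<phi> z) * cmod (bergman_fun f z) \<le> 1 * cmod (bergman_fun f z)"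
          by (intro mult_right_mono le True) simp
        then show ?thesis by (simp add: norm_mult)
      qed (simp add: bergman_fun_outside)
    qed
    then show ?thesis by (simp add: power2_le_iff_abs_le)
  qed
qed

section \<open>Proper holomorphic self-maps of the disk\<close>

text \<open>What the argument takes from a finite Blaschke product. Continuity on the closed disk
  and unimodular boundary values make \<open>\<phi>\<close> proper: preimages of compact sets stay
  away from the circle. \<open>N\<close> bounds all fibres uniformly and becomes the constant in the
  norm estimates.\<close>

locale proper_disk_map =
  fixes \<phi> :: "complex \<Rightarrow> complex" and N :: nat
  assumes holo: "\<phi> holomorphic_on ball 0 1"
    and cont: "continuous_on (cball 0 1) \<phi>"
    and less_one: "z \<in> ball 0 1 \<Longrightarrow> cmod (\<phi> z) < 1"
    and eq_one: "cmod z = 1 \<Longrightarrow> cmod (\<phi> z) = 1"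
    and finite_fibre: "finite {w \<in> ball 0 1. \<phi> w = v}"
    and card_fibre_le: "card {w \<in> ball 0 1. \<phi> w = v} \<le> N"
    and finite_critical: "finite (critical_points \<phi>)"
begin

section \<open>Fibres, regular values and local sections\<close>

definition fibre :: "complex \<Rightarrow> complex set" where
  "fibre v = {w \<in> ball 0 1. \<phi> w = v}"

text \<open>By \<open>regular_iff\<close> the regular set is the full preimage of this set, so the
  fibres over it avoid every critical point and \<open>\<phi>\<close> restricts to a finite
  covering.\<close>

definition regular_values :: "complex set" where
  "regular_values = ball 0 1 - \<phi> ` critical_points \<phi>"

lemma finite_fib [simp]: "finite (fibre v)"
  and card_fib: "card (fibre v) \<le> N"
  using finite_fibre card_fibre_le by (auto simp: fibre_def)

lemma fibreD: "w \<in> fibre v \<Longrightarrow> w \<in> ball 0 1" "w \<in> fibre v \<Longrightarrow> \<phi> w = v"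
  by (auto simp: fibre_def)

lemma regular_iff: "z \<in> regular_set \<phi> \<longleftrightarrow> z \<in> ball 0 1 \<and> \<phi> z \<in> regular_values"
  using less_one by (auto simp: regular_set_def singular_set_def regular_values_def)

lemma regular_fibre: "v \<in> regular_values \<Longrightarrow> w \<in> fibre v \<Longrightarrow> w \<in> regular_set \<phi>"
  by (auto simp: regular_iff fibre_def)

lemma regular_ball: "z \<in> regular_set \<phi> \<Longrightarrow> z \<in> ball 0 1"
  by (simp add: regular_iff)

lemma deriv_nonzero: "z \<in> regular_set \<phi> \<Longrightarrow> deriv \<phi> z \<noteq> 0"
  by (auto simp: regular_iff regular_values_def critical_points_def)

lemma open_regular_values: "open regular_values"
  unfolding regular_values_def using finite_critical by (intro open_Diff finite_imp_closed) auto

lemma finite_singular: "finite (singular_set \<phi>)"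
proof -
  have "singular_set \<phi> = (\<Union>c\<in>critical_points \<phi>. fibre (\<phi> c))"
    by (auto simp: singular_set_def fibre_def)
  then show ?thesis using finite_critical by simp
qed

lemma open_regular: "open (regular_set \<phi>)"
  unfolding regular_set_def using finite_singular by (intro open_Diff finite_imp_closed) auto

lemma path_connected_regular: "path_connected (regular_set \<phi>)"
  unfolding regular_set_def using finite_singular
  by (intro path_connected_open_diff_countable) (auto simp: countable_finite)

lemma connected_regular: "connected (regular_set \<phi>)"
  using path_connected_regular path_connected_imp_connected by blast

text \<open>\<open>\<sigma>\<close> is indexed by the points of the central fibre:
  \<open>\<sigma> w\<close> is the sheet through \<open>w\<close>. The base is a ball, so that
  sheets and pairs of sheets are path connected.\<close>

definition evenly_covered :: "complex \<Rightarrow> real \<Rightarrow> (complex \<Rightarrow> complex \<Rightarrow> complex) \<Rightarrow> bool" where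
  "evenly_covered v0 r \<sigma> \<longleftrightarrow> 0 < r \<and> ball v0 r \<subseteq> regular_values \<and>
     (\<forall>w\<in>fibre v0. \<sigma> w holomorphic_on ball v0 r \<and> \<sigma> w v0 = w) \<and>
     (\<forall>v\<in>ball v0 r. bij_betw (\<lambda>w. \<sigma> w v) (fibre v0) (fibre v))"

text \<open>Each point of the fibre has a small ball on which \<open>\<phi>\<close> is invertible.
  What remains of the closed disk is compact and its image misses \<open>v0\<close>, so over values
  close to \<open>v0\<close> all preimages lie in these balls. This is where properness is
  used.\<close>

lemma evenly_covered_exists:
  assumes v0: "v0 \<in> regular_values"
  shows "\<exists>r \<sigma>. evenly_covered v0 r \<sigma>"
proof -
  let ?W = "fibre v0"
  have "\<exists>r>0. ball w r \<subseteq> ball 0 1 \<and> inj_on \<phi> (ball w r)" if "w \<in> ?W" for w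
    using has_complex_derivative_locally_invertible[OF holo, of w] fibreD[OF that]
      deriv_nonzero[OF regular_fibre[OF v0 that]] by auto
  then obtain \<rho> where \<rho>: "\<And>w. w \<in> ?W \<Longrightarrow> \<rho> w > 0 \<and> ball w (\<rho> w) \<subseteq> ball 0 1 \<and> inj_on \<phi> (ball w (\<rho> w))"
    by metis
  \<comment> \<open>Candidates for a common radius: the injectivity radii, and half distances that
    keep the balls disjoint; the 1 serves an empty fibre.\<close>
  define S where "S = insert 1 (\<rho> ` ?W \<union> (\<lambda>(w, z). dist w z / 2) ` {(w, z) \<in> ?W \<times> ?W. w \<noteq> z})"
  have fS: "finite S"
    unfolding S_def by (intro finite.insertI finite_UnI finite_imageI) (auto intro: finite_subset[of _ "?W \<times> ?W"])
  define e where "e = Min S"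
  have "\<And>x. x \<in> S \<Longrightarrow> x > 0" unfolding S_def using \<rho> by auto
  then have e0: "e > 0" unfolding e_def using fS by (subst Min_gr_iff) (auto simp: S_def)
  have e1: "e \<le> \<rho> w" if "w \<in> ?W" for w
    unfolding e_def using that fS by (intro Min_le) (auto simp: S_def)
  have e2: "e \<le> dist w z / 2" if "w \<in> ?W" "z \<in> ?W" "w \<noteq> z" for w z
    unfolding e_def using that fS by (intro Min_le) (auto simp: S_def image_iff)
  have disj: "w = z" if "w \<in> ?W" "z \<in> ?W" "x \<in> ball w e" "x \<in> ball z e" for w z x
    using e2[of w z] that dist_triangle2[of w z x] by (force simp: dist_commute)
  have eb: "ball w e \<subseteq> ball 0 1" "inj_on \<phi> (ball w e)" if "w \<in> ?W" for w
    using \<rho>[OF that] e1[OF that] by (auto intro: inj_on_subset)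
  have hw: "\<phi> holomorphic_on ball w e" if "w \<in> ?W" for w
    using holo eb(1)[OF that] holomorphic_on_subset by blast
  have opn: "open (\<phi> ` ball w e)" if "w \<in> ?W" for w
    using open_mapping_thm3[OF hw _ eb(2)] that by simp
  have "\<exists>g. g holomorphic_on (\<phi> ` ball w e) \<and> (\<forall>z\<in>ball w e. g (\<phi> z) = z)" if "w \<in> ?W" for w
    using holomorphic_has_inverse[OF hw _ eb(2)] that by (metis open_ball)
  then obtain \<sigma> where \<sigma>: "\<And>w. w \<in> ?W \<Longrightarrow> \<sigma> w holomorphic_on (\<phi> ` ball w e)"
    "\<And>w z. w \<in> ?W \<Longrightarrow> z \<in> ball w e \<Longrightarrow> \<sigma> w (\<phi> z) = z" by metis
  define K where "K = cball 0 1 - (\<Union>w\<in>?W. ball w e)"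
  have "compact K" unfolding K_def by (intro compact_diff open_UN) auto
  then have "compact (\<phi> ` K)"
    using cont by (intro compact_continuous_image) (auto simp: K_def intro: continuous_on_subset)
  define G where "G = regular_values \<inter> (\<Inter>w\<in>?W. \<phi> ` ball w e) - \<phi> ` K"
  have "open G" unfolding G_def using opn open_regular_values compact_imp_closed[OF \<open>compact (\<phi> ` K)\<close>]
    by (intro open_Diff open_Int open_INT) auto
  have "v0 \<notin> \<phi> ` K"
  proof
    assume "v0 \<in> \<phi> ` K"
    then obtain z where z: "z \<in> K" "\<phi> z = v0" by auto
    \<comment> \<open>A point of the circle has an image of modulus 1, so a preimage of
      \<open>v0\<close> in \<open>K\<close> lies in the open disk, hence in the fibre and in its own
      removed ball.\<close>
    have "cmod v0 < 1" using v0 by (auto simp: regular_values_def)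
    then have "z \<in> ball 0 1" using z eq_one[of z] by (cases "cmod z = 1") (auto simp: K_def)
    then have "z \<in> ?W" using z by (simp add: fibre_def)
    then show False using z e0 unfolding K_def by (metis DiffD2 UN_I centre_in_ball)
  qed
  moreover have "v0 \<in> \<phi> ` ball w e" if "w \<in> ?W" for w
    using fibreD[OF that] e0 by force
  ultimately have "v0 \<in> G" using v0 by (auto simp: G_def)
  then obtain r where r: "r > 0" "ball v0 r \<subseteq> G" using \<open>open G\<close> openE by blast
  have \<sigma>v: "\<sigma> w v \<in> ball w e" "\<phi> (\<sigma> w v) = v" if "w \<in> ?W" "v \<in> ball v0 r" for w v
  proof -
    have "v \<in> \<phi> ` ball w e" using that r by (auto simp: G_def)
    then obtain z where "z \<in> ball w e" "v = \<phi> z" by blast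
    then show "\<sigma> w v \<in> ball w e" "\<phi> (\<sigma> w v) = v" using \<sigma>(2)[OF that(1)] by auto
  qed
  have "evenly_covered v0 r \<sigma>"
    unfolding evenly_covered_def
  proof (intro conjI ballI)
    show "0 < r" "ball v0 r \<subseteq> regular_values" using r by (auto simp: G_def)
    fix w assume w: "w \<in> ?W"
    have "ball v0 r \<subseteq> \<phi> ` ball w e" using r w by (auto simp: G_def)
    then show "\<sigma> w holomorphic_on ball v0 r" using \<sigma>(1)[OF w] holomorphic_on_subset by blast
    show "\<sigma> w v0 = w" using \<sigma>(2)[OF w, of w] e0 fibreD[OF w] by simp
  next
    fix v assume v: "v \<in> ball v0 r"
    show "bij_betw (\<lambda>w. \<sigma> w v) ?W (fibre v)"
      unfolding bij_betw_def
    proof (intro conjI inj_onI equalityI subsetI)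
      show "w = z" if "w \<in> ?W" "z \<in> ?W" "\<sigma> w v = \<sigma> z v" for w z
        using disj[OF that(1,2)] \<sigma>v(1)[OF that(1) v] \<sigma>v(1)[OF that(2) v] that(3) by simp
      show "z \<in> fibre v" if "z \<in> (\<lambda>w. \<sigma> w v) ` ?W" for z
        using that \<sigma>v v eb(1) by (force simp: fibre_def)
      fix z assume z: "z \<in> fibre v"
      have "v \<notin> \<phi> ` K" using r v by (auto simp: G_def)
      then have "z \<notin> K" using fibreD[OF z] by auto
      then obtain w where w: "w \<in> ?W" "z \<in> ball w e" using fibreD[OF z] by (auto simp: K_def)
      then show "z \<in> (\<lambda>w. \<sigma> w v) ` ?W" using \<sigma>(2)[OF w] fibreD[OF z] by (intro image_eqI[of _ _ w]) auto
    qed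
  qed
  then show ?thesis by blast
qed

context
  fixes v0 r \<sigma>
  assumes ec: "evenly_covered v0 r \<sigma>"
begin

lemma ec_pos: "0 < r" and ec_regular: "v \<in> ball v0 r \<Longrightarrow> v \<in> regular_values"
  and ec_hol: "w \<in> fibre v0 \<Longrightarrow> \<sigma> w holomorphic_on ball v0 r"
  and ec_centre: "w \<in> fibre v0 \<Longrightarrow> \<sigma> w v0 = w"
  and ec_bij: "v \<in> ball v0 r \<Longrightarrow> bij_betw (\<lambda>w. \<sigma> w v) (fibre v0) (fibre v)"
  using ec by (auto simp: evenly_covered_def)

lemma ec_inj: "v \<in> ball v0 r \<Longrightarrow> w \<in> fibre v0 \<Longrightarrow> z \<in> fibre v0 \<Longrightarrow> \<sigma> w v = \<sigma> z v \<longleftrightarrow> w = z"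
  using ec_bij by (meson bij_betw_def inj_on_eq_iff)

lemma ec_image: "v \<in> ball v0 r \<Longrightarrow> fibre v = (\<lambda>w. \<sigma> w v) ` fibre v0"
  using ec_bij by (metis bij_betw_def)

lemma ec_fibre: "v \<in> ball v0 r \<Longrightarrow> w \<in> fibre v0 \<Longrightarrow> \<sigma> w v \<in> fibre v"
  using ec_image by blast

lemma ec_ball: "v \<in> ball v0 r \<Longrightarrow> w \<in> fibre v0 \<Longrightarrow> \<sigma> w v \<in> ball 0 1"
  and ec_phi: "v \<in> ball v0 r \<Longrightarrow> w \<in> fibre v0 \<Longrightarrow> \<phi> (\<sigma> w v) = v"
  using ec_fibre fibreD by blast+

lemma ec_deriv:
  assumes v: "v \<in> ball v0 r" and w: "w \<in> fibre v0"
  shows "(\<sigma> w has_field_derivative 1 / deriv \<phi> (\<sigma> w v)) (at v)"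
    and "deriv (\<sigma> w) v = 1 / deriv \<phi> (\<sigma> w v)"
proof -
  have d: "(\<sigma> w has_field_derivative deriv (\<sigma> w) v) (at v)"
    using holomorphic_derivI[OF ec_hol[OF w] open_ball v] .
  have "(\<phi> has_field_derivative deriv \<phi> (\<sigma> w v)) (at (\<sigma> w v))"
    using holomorphic_derivI[OF holo open_ball] ec_ball[OF v w] by blast
  from DERIV_chain2[OF this d]
  have "((\<lambda>x. \<phi> (\<sigma> w x)) has_field_derivative deriv \<phi> (\<sigma> w v) * deriv (\<sigma> w) v) (at v)" .
  moreover have "((\<lambda>x. \<phi> (\<sigma> w x)) has_field_derivative 1) (at v)"
    by (rule DERIV_ident[THEN has_field_derivative_transform_within_open, of "ball v0 r"])
       (use v ec_phi w in auto)
  ultimately have *: "deriv \<phi> (\<sigma> w v) * deriv (\<sigma> w) v = 1" using DERIV_unique by blast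
  then show e: "deriv (\<sigma> w) v = 1 / deriv \<phi> (\<sigma> w v)"
    by (metis mult_cancel_left nonzero_mult_div_cancel_left mult_zero_left zero_neq_one)
  show "(\<sigma> w has_field_derivative 1 / deriv \<phi> (\<sigma> w v)) (at v)" using d e by simp
qed

lemma ec_inj_on: "w \<in> fibre v0 \<Longrightarrow> inj_on (\<sigma> w) (ball v0 r)"
  by (metis ec_phi inj_onI)

lemma ec_open: "w \<in> fibre v0 \<Longrightarrow> open (\<sigma> w ` ball v0 r)"
  using open_mapping_thm3[OF ec_hol open_ball ec_inj_on] by blast

lemma ec_path_connected:
  assumes "w \<in> fibre v0" "z \<in> fibre v0"
  shows "path_connected ((\<lambda>v. (\<sigma> w v, \<sigma> z v)) ` ball v0 r)"
  using assms
  by (intro path_connected_continuous_image continuous_intros)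
     (auto intro: holomorphic_on_imp_continuous_on ec_hol convex_imp_path_connected)

lemma ec_subset_cover:
  assumes "w \<in> fibre v0" "z \<in> fibre v0"
  shows "(\<lambda>v. (\<sigma> w v, \<sigma> z v)) ` ball v0 r \<subseteq> unbranched_cover \<phi>"
  using assms ec_ball ec_phi ec_regular by (auto simp: unbranched_cover_def regular_iff)

text \<open>If a point of the cover has its entries on the two sheets, both parameters equal the
  common value under \<open>\<phi>\<close>; so the piece is the cover intersected with an open
  product.\<close>

lemma ec_openin:
  assumes "w \<in> fibre v0" "z \<in> fibre v0"
  shows "openin (top_of_set (unbranched_cover \<phi>)) ((\<lambda>v. (\<sigma> w v, \<sigma> z v)) ` ball v0 r)"
proof -
  have "(\<lambda>v. (\<sigma> w v, \<sigma> z v)) ` ball v0 r = unbranched_cover \<phi> \<inter> (\<sigma> w ` ball v0 r \<times> \<sigma> z ` ball v0 r)"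
    using ec_subset_cover[OF assms] ec_phi assms
    by (auto simp: unbranched_cover_def image_iff)
  then show ?thesis using open_Times[OF ec_open ec_open] assms by (metis openin_open_Int)
qed

end

section \<open>Components of the unbranched cover\<close>

lemma cover_iff: "(w, z) \<in> unbranched_cover \<phi> \<longleftrightarrow> \<phi> z \<in> regular_values \<and> w \<in> fibre (\<phi> z) \<and> z \<in> fibre (\<phi> z)"
  by (auto simp: unbranched_cover_def regular_iff fibre_def)

abbreviation cover_components :: "(complex \<times> complex) set set" where
  "cover_components \<equiv> components (unbranched_cover \<phi>)"

text \<open>The piece of the cover over the disk is connected, so it lies inside \<open>C\<close> or
  misses it. This moves membership between any \<open>v\<close> and the centre.\<close>

lemma component_section_iff:
  assumes ec: "evenly_covered v0 r \<sigma>" and C: "C \<in> cover_components"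
    and wz: "w \<in> fibre v0" "z \<in> fibre v0" and v: "v \<in> ball v0 r"
  shows "(\<sigma> w v, \<sigma> z v) \<in> C \<longleftrightarrow> (w, z) \<in> C"
proof -
  let ?S = "(\<lambda>v. (\<sigma> w v, \<sigma> z v)) ` ball v0 r"
  have conn: "connected ?S" using path_connected_imp_connected[OF ec_path_connected[OF ec wz]] .
  have "v0 \<in> ball v0 r" using ec_pos[OF ec] by simp
  then have mem: "(w, z) \<in> ?S" "(\<sigma> w v, \<sigma> z v) \<in> ?S"
    using ec_centre[OF ec] wz v by (auto intro!: rev_image_eqI[of v0])
  have "?S \<subseteq> C" if "?S \<inter> C \<noteq> {}"
    using components_maximal[OF C conn ec_subset_cover[OF ec wz]] that by blast
  then show ?thesis using mem by blast
qed

lemma component_openin: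
  assumes C: "C \<in> cover_components"
  shows "openin (top_of_set (unbranched_cover \<phi>)) C"
proof (subst openin_subopen, intro ballI)
  fix x assume x: "x \<in> C"
  obtain w z where wz: "x = (w, z)" by force
  have "(w, z) \<in> unbranched_cover \<phi>" using x wz in_components_subset[OF C] by blast
  then have v: "\<phi> z \<in> regular_values" "w \<in> fibre (\<phi> z)" "z \<in> fibre (\<phi> z)" by (auto simp: cover_iff)
  obtain r \<sigma> where ec: "evenly_covered (\<phi> z) r \<sigma>" using evenly_covered_exists[OF v(1)] by blast
  let ?T = "(\<lambda>v. (\<sigma> w v, \<sigma> z v)) ` ball (\<phi> z) r"
  have "\<phi> z \<in> ball (\<phi> z) r" using ec_pos[OF ec] by simp
  moreover have "x = (\<sigma> w (\<phi> z), \<sigma> z (\<phi> z))" using wz ec_centre[OF ec] v by simp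
  ultimately have "x \<in> ?T" by (rule rev_image_eqI)
  moreover have "?T \<subseteq> C" using component_section_iff[OF ec C v(2,3)] x wz by auto
  ultimately show "\<exists>T. openin (top_of_set (unbranched_cover \<phi>)) T \<and> x \<in> T \<and> T \<subseteq> C"
    using ec_openin[OF ec v(2,3)] by blast
qed

text \<open>Pieces over evenly covered disks are path connected neighbourhoods. Path connectedness
  is what turns membership in one component into analytic continuation.\<close>

lemma component_path_connected:
  assumes C: "C \<in> cover_components"
  shows "path_connected C"
proof -
  have "path_component C x y" if xy: "x \<in> C" "y \<in> C" for x y
  proof (rule connected_equivalence_relation[OF in_components_connected[OF C] xy])
    show "path_component C b a" if "path_component C a b" for a b using that by (rule path_component_sym)
    show "path_component C a c" if "path_component C a b" "path_component C b c" for a b c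
      using that by (rule path_component_trans)
    fix x assume x: "x \<in> C"
    obtain w z where wz: "x = (w, z)" by force
    have "(w, z) \<in> unbranched_cover \<phi>" using x wz in_components_subset[OF C] by blast
    then have v: "\<phi> z \<in> regular_values" "w \<in> fibre (\<phi> z)" "z \<in> fibre (\<phi> z)" by (auto simp: cover_iff)
    obtain r \<sigma> where ec: "evenly_covered (\<phi> z) r \<sigma>" using evenly_covered_exists[OF v(1)] by blast
    let ?T = "(\<lambda>v. (\<sigma> w v, \<sigma> z v)) ` ball (\<phi> z) r"
    have "\<phi> z \<in> ball (\<phi> z) r" using ec_pos[OF ec] by simp
    moreover have "x = (\<sigma> w (\<phi> z), \<sigma> z (\<phi> z))" using wz ec_centre[OF ec] v by simp
    ultimately have xT: "x \<in> ?T" by (rule rev_image_eqI)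
    have TC: "?T \<subseteq> C" using component_section_iff[OF ec C v(2,3)] x wz by auto
    have "openin (top_of_set C) ?T"
      using ec_openin[OF ec v(2,3)] TC in_components_subset[OF C] by (rule openin_subset_trans)
    moreover have "\<forall>y\<in>?T. path_component C x y"
      using ec_path_connected[OF ec v(2,3)] xT TC path_component_of_subset
      unfolding path_connected_component by blast
    ultimately show "\<exists>T. openin (top_of_set C) T \<and> x \<in> T \<and> (\<forall>y\<in>T. path_component C x y)"
      using xT by blast
  qed
  then show ?thesis unfolding path_connected_component by blast
qed

text \<open>Having a point over \<open>z\<close> is locally constant in \<open>z\<close>, as
  sections carry such points along, and the regular set is connected. So every component shows up in
  every fibre, which makes the components finite in number and comparable over a fixed base
  point.\<close>

lemma component_snd:
  assumes C: "C \<in> cover_components" and z: "z \<in> regular_set \<phi>"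
  shows "\<exists>w. (w, z) \<in> C"
proof -
  let ?f = "\<lambda>z. \<exists>w. (w, z) \<in> C"
  have "?f constant_on regular_set \<phi>"
  proof (rule locally_constant_imp_constant[OF connected_regular])
    fix z assume "z \<in> regular_set \<phi>"
    then have v: "\<phi> z \<in> regular_values" "z \<in> fibre (\<phi> z)" by (auto simp: regular_iff fibre_def)
    obtain r \<sigma> where ec: "evenly_covered (\<phi> z) r \<sigma>" using evenly_covered_exists[OF v(1)] by blast
    let ?T = "\<sigma> z ` ball (\<phi> z) r"
    have "?T \<subseteq> regular_set \<phi>"
      using ec_regular[OF ec] ec_phi[OF ec] ec_ball[OF ec] v by (auto simp: regular_iff)
    then have "openin (top_of_set (regular_set \<phi>)) ?T"
      using ec_open[OF ec v(2)] by (metis inf.absorb_iff2 openin_open)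
    moreover have "z \<in> ?T" using ec_centre[OF ec v(2)] ec_pos[OF ec] by (metis centre_in_ball image_eqI)
    moreover have "?f x = ?f z" if x: "x \<in> ?T" for x
    proof -
      obtain v where v': "v \<in> ball (\<phi> z) r" "x = \<sigma> z v" using x by blast
      have inX: "(w, y) \<in> unbranched_cover \<phi>" if "(w, y) \<in> C" for w y
        using that in_components_subset[OF C] by blast
      have "(\<exists>w. (w, x) \<in> C) \<longleftrightarrow> (\<exists>w\<in>fibre v. (w, x) \<in> C)"
        using inX[of _ x] cover_iff[of _ x] v'(2) ec_phi[OF ec v'(1) v(2)] by auto
      also have "\<dots> \<longleftrightarrow> (\<exists>w\<in>fibre (\<phi> z). (\<sigma> w v, \<sigma> z v) \<in> C)"
        unfolding ec_image[OF ec v'(1)] v'(2) by blast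
      also have "\<dots> \<longleftrightarrow> (\<exists>w\<in>fibre (\<phi> z). (w, z) \<in> C)"
        using component_section_iff[OF ec C _ v(2) v'(1)] by blast
      also have "\<dots> \<longleftrightarrow> (\<exists>w. (w, z) \<in> C)" using inX cover_iff by blast
      finally show ?thesis .
    qed
    ultimately show "\<exists>T. openin (top_of_set (regular_set \<phi>)) T \<and> z \<in> T \<and> (\<forall>x\<in>T. ?f x = ?f z)" by blast
  qed
  then obtain b where b: "\<And>z. z \<in> regular_set \<phi> \<Longrightarrow> ?f z = b" unfolding constant_on_def by blast
  obtain w' z' where wz': "(w', z') \<in> C" using in_components_nonempty[OF C] by fast
  then have "z' \<in> regular_set \<phi>" using in_components_subset[OF C] by (auto simp: unbranched_cover_def)
  then show ?thesis using b[of z'] b[OF z] wz' by blast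
qed

text \<open>Disjoint components pick distinct points of the finite fibre over
  \<open>\<phi> z\<close>.\<close>

lemma finite_cover_components:
  assumes "z \<in> regular_set \<phi>"
  shows "finite cover_components"
proof -
  have "\<exists>w. (w, z) \<in> C" if "C \<in> cover_components" for C using component_snd[OF that assms] .
  then obtain f where f: "\<And>C. C \<in> cover_components \<Longrightarrow> (f C, z) \<in> C" by metis
  have "f ` cover_components \<subseteq> fibre (\<phi> z)"
    using f in_components_subset cover_iff by blast
  moreover have "inj_on f cover_components"
  proof (rule inj_onI)
    fix C D assume CD: "C \<in> cover_components" "D \<in> cover_components" "f C = f D"
    then have "C \<inter> D \<noteq> {}" using f by (metis IntI empty_iff)
    then show "C = D" using components_nonoverlap CD(1,2) by blast
  qed
  ultimately show ?thesis using finite_fib finite_imageD finite_subset by metis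
qed

definition component_fibre :: "(complex \<times> complex) set \<Rightarrow> complex \<Rightarrow> complex set" where
  "component_fibre C z = {w. (w, z) \<in> C}"

lemma component_fibre_subset:
  assumes "C \<in> cover_components"
  shows "component_fibre C z \<subseteq> fibre (\<phi> z)"
  using in_components_subset[OF assms] cover_iff by (auto simp: component_fibre_def)

lemma finite_component_fibre: "C \<in> cover_components \<Longrightarrow> finite (component_fibre C z)"
  using component_fibre_subset finite_fib finite_subset by metis

text \<open>Re-indexes sums over the component fibre at a moving point by the fixed fibre at the
  centre, so that they can be differentiated termwise.\<close>

lemma component_fibre_section:
  assumes ec: "evenly_covered v0 r \<sigma>" and C: "C \<in> cover_components"
    and z: "z \<in> fibre v0" and v: "v \<in> ball v0 r"
  shows "bij_betw (\<lambda>w. \<sigma> w v) (component_fibre C z) (component_fibre C (\<sigma> z v))"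
proof -
  have sub: "component_fibre C z \<subseteq> fibre v0" using component_fibre_subset[OF C, of z] fibreD(2)[OF z] by simp
  have sub2: "component_fibre C (\<sigma> z v) \<subseteq> fibre v"
    using component_fibre_subset[OF C, of "\<sigma> z v"] ec_phi[OF ec v z] by simp
  have "component_fibre C (\<sigma> z v) = (\<lambda>w. \<sigma> w v) ` component_fibre C z"
  proof (intro equalityI subsetI)
    fix w assume w: "w \<in> component_fibre C (\<sigma> z v)"
    then obtain w' where w': "w' \<in> fibre v0" "w = \<sigma> w' v" using sub2 ec_image[OF ec v] by blast
    then show "w \<in> (\<lambda>w. \<sigma> w v) ` component_fibre C z"
      using w component_section_iff[OF ec C w'(1) z v] by (auto simp: component_fibre_def)
  next
    fix w assume "w \<in> (\<lambda>w. \<sigma> w v) ` component_fibre C z"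
    then obtain w' where w': "(w', z) \<in> C" "w = \<sigma> w' v" by (auto simp: component_fibre_def)
    then have "w' \<in> fibre v0" using sub by (auto simp: component_fibre_def)
    then show "w \<in> component_fibre C (\<sigma> z v)"
      using w' component_section_iff[OF ec C _ z v] by (auto simp: component_fibre_def)
  qed
  moreover have "inj_on (\<lambda>w. \<sigma> w v) (component_fibre C z)"
    using sub ec_bij[OF ec v] by (meson bij_betw_def inj_on_subset)
  ultimately show ?thesis by (simp add: bij_betw_def)
qed

end

section \<open>Integration over fibres\<close>

lemma holomorphic_extension_measurable:
  fixes f :: "complex \<Rightarrow> complex"
  assumes "f holomorphic_on S" "open S"
  shows "(\<lambda>z. if z \<in> S then f z else c) \<in> borel_measurable borel"
  using assms by (intro borel_measurable_continuous_on_if) (auto simp: holomorphic_on_imp_continuous_on)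

context proper_disk_map
begin

lemma preimage_borel:
  assumes A: "A \<in> sets borel" "A \<subseteq> ball 0 1"
  shows "{z \<in> ball 0 1. \<phi> z \<in> A} \<in> sets borel"
proof -
  \<comment> \<open>The filler 2 lies outside the disk and hence outside \<open>A\<close>, so
    nothing beyond the disk is counted.\<close>
  have "(\<lambda>z. if z \<in> ball 0 1 then \<phi> z else 2) -` A \<in> sets borel"
    using measurable_sets[OF holomorphic_extension_measurable[OF holo open_ball, of 2] A(1)] by simp
  also have "(\<lambda>z. if z \<in> ball 0 1 then \<phi> z else 2) -` A = {z \<in> ball 0 1. \<phi> z \<in> A}"
  proof -
    have "2 \<notin> A" using A(2) by auto
    then show ?thesis by (auto split: if_splits)
  qed
  finally show ?thesis .
qed

text \<open>Density of the push-forward under \<open>\<phi>\<close> of \<open>h\<close> times area;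
  the weight is the Jacobian of the inverse branch through \<open>z\<close>.\<close>

definition fibre_integral :: "(complex \<Rightarrow> ennreal) \<Rightarrow> complex \<Rightarrow> ennreal" where
  "fibre_integral h v = (\<Sum>z\<in>fibre v. h z * ennreal (1 / (cmod (deriv \<phi> z))\<^sup>2))"

text \<open>Substitution on each sheet separately, then addition over the sheets.\<close>

lemma nn_integral_evenly_covered:
  assumes ec: "evenly_covered v0 r \<sigma>" and A: "A \<in> sets borel" "A \<subseteq> ball v0 r"
    and h[measurable]: "h \<in> borel_measurable borel"
  shows "(\<integral>\<^sup>+z\<in>{z \<in> ball 0 1. \<phi> z \<in> A}. h z \<partial>lborel) = (\<integral>\<^sup>+v\<in>A. fibre_integral h v \<partial>lborel)"
proof -
  let ?W = "fibre v0" and ?B = "ball v0 r"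
  define P where "P = {z \<in> ball 0 1. \<phi> z \<in> A}"
  have AD: "A \<subseteq> ball 0 1" using A(2) ec_regular[OF ec] by (auto simp: regular_values_def)
  have P[measurable]: "P \<in> sets borel" unfolding P_def by (rule preimage_borel[OF A(1) AD])
  have opn: "open (\<sigma> w ` ?B)" if "w \<in> ?W" for w using ec_open[OF ec that] .
  define k where "k = (\<lambda>z. h z * indicator P z)"
  have k[measurable]: "k \<in> borel_measurable borel" unfolding k_def by measurable
  \<comment> \<open>Each point over \<open>A\<close> lies on exactly one sheet.\<close>
  have split: "k z = (\<Sum>w\<in>?W. k z * indicator (\<sigma> w ` ?B) z)" for z
  proof (cases "z \<in> P")
    case True
    then have v: "\<phi> z \<in> ?B" "z \<in> fibre (\<phi> z)" using A(2) by (auto simp: P_def fibre_def)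
    then obtain w where w: "w \<in> ?W" "z = \<sigma> w (\<phi> z)" using ec_image[OF ec v(1)] by blast
    have ind: "indicator (\<sigma> w' ` ?B) z = (if w' = w then 1 else 0 :: ennreal)" if "w' \<in> ?W" for w'
    proof -
      have "z \<in> \<sigma> w' ` ?B \<longleftrightarrow> w' = w"
      proof
        assume "z \<in> \<sigma> w' ` ?B"
        then obtain v' where "v' \<in> ?B" "z = \<sigma> w' v'" by blast
        moreover from this have "v' = \<phi> z" using ec_phi[OF ec] that by simp
        ultimately have "\<sigma> w' (\<phi> z) = \<sigma> w (\<phi> z)" using w(2) by metis
        then show "w' = w" using ec_inj[OF ec v(1) that w(1)] by blast
      next
        assume "w' = w"
        then show "z \<in> \<sigma> w' ` ?B" using w(2) v(1) by (metis imageI)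
      qed
      then show ?thesis by (simp add: indicator_def)
    qed
    have "(\<Sum>w'\<in>?W. k z * indicator (\<sigma> w' ` ?B) z) = (\<Sum>w'\<in>?W. if w' = w then k z else 0)"
      by (rule sum.cong[OF refl]) (simp only: ind, simp)
    then show ?thesis using w(1) by simp
  next
    case False
    then show ?thesis by (simp add: k_def)
  qed
  have sm: "(\<lambda>v. ennreal ((cmod (deriv (\<sigma> w) v))\<^sup>2) * k (\<sigma> w v) * indicator ?B v) \<in> borel_measurable borel"
    if w: "w \<in> ?W" for w
  proof -
    define s where "s = (\<lambda>v. if v \<in> ?B then \<sigma> w v else 0)"
    define d where "d = (\<lambda>v. if v \<in> ?B then deriv (\<sigma> w) v else 0)"
    have [measurable]: "s \<in> borel_measurable borel" "d \<in> borel_measurable borel" "?B \<in> sets borel"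
      unfolding s_def d_def
      by (intro holomorphic_extension_measurable holomorphic_deriv ec_hol[OF ec w] open_ball borel_open)+
    have "(\<lambda>v. ennreal ((cmod (d v))\<^sup>2) * k (s v) * indicator ?B v) \<in> borel_measurable borel"
      by measurable
    also have "(\<lambda>v. ennreal ((cmod (d v))\<^sup>2) * k (s v) * indicator ?B v)
      = (\<lambda>v. ennreal ((cmod (deriv (\<sigma> w) v))\<^sup>2) * k (\<sigma> w v) * indicator ?B v)"
      by (auto simp: indicator_def s_def d_def)
    finally show ?thesis .
  qed
  have "(\<integral>\<^sup>+z\<in>P. h z \<partial>lborel) = (\<integral>\<^sup>+z. (\<Sum>w\<in>?W. k z * indicator (\<sigma> w ` ?B) z) \<partial>lborel)"
    by (subst split[symmetric]) (simp add: k_def)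
  also have "\<dots> = (\<Sum>w\<in>?W. \<integral>\<^sup>+z\<in>\<sigma> w ` ?B. k z \<partial>lborel)"
    using opn by (intro nn_integral_sum) auto
  also have "\<dots> = (\<Sum>w\<in>?W. \<integral>\<^sup>+v\<in>?B. ennreal ((cmod (deriv (\<sigma> w) v))\<^sup>2) * k (\<sigma> w v) \<partial>lborel)"
    by (intro sum.cong refl nn_integral_holomorphic_substitution)
       (auto intro: ec_hol[OF ec] ec_inj_on[OF ec])
  also have "\<dots> = (\<integral>\<^sup>+v. (\<Sum>w\<in>?W. ennreal ((cmod (deriv (\<sigma> w) v))\<^sup>2) * k (\<sigma> w v) * indicator ?B v) \<partial>lborel)"
    using sm by (intro nn_integral_sum[symmetric]) auto
  also have "\<dots> = (\<integral>\<^sup>+v\<in>A. fibre_integral h v \<partial>lborel)"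
  proof (rule nn_integral_cong)
    fix v
    show "(\<Sum>w\<in>?W. ennreal ((cmod (deriv (\<sigma> w) v))\<^sup>2) * k (\<sigma> w v) * indicator ?B v) = fibre_integral h v * indicator A v"
    proof (cases "v \<in> A")
      case True
      then have v: "v \<in> ?B" using A by blast
      have "(\<Sum>w\<in>?W. ennreal ((cmod (deriv (\<sigma> w) v))\<^sup>2) * k (\<sigma> w v) * indicator ?B v)
          = (\<Sum>w\<in>?W. h (\<sigma> w v) * ennreal (1 / (cmod (deriv \<phi> (\<sigma> w v)))\<^sup>2))"
      proof (rule sum.cong[OF refl])
        fix w assume w: "w \<in> ?W"
        have "\<sigma> w v \<in> P" using True ec_phi[OF ec v w] ec_ball[OF ec v w] by (simp add: P_def)
        then show "ennreal ((cmod (deriv (\<sigma> w) v))\<^sup>2) * k (\<sigma> w v) * indicator ?B v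
            = h (\<sigma> w v) * ennreal (1 / (cmod (deriv \<phi> (\<sigma> w v)))\<^sup>2)"
          using v by (simp add: k_def ec_deriv(2)[OF ec v w] norm_divide power_divide mult.commute)
      qed
      also have "\<dots> = (\<Sum>z\<in>fibre v. h z * ennreal (1 / (cmod (deriv \<phi> z))\<^sup>2))"
        using sum.reindex_bij_betw[OF ec_bij[OF ec v]] .
      finally show ?thesis using True by (simp add: fibre_integral_def)
    next
      case False
      have "k (\<sigma> w v) = 0" if "w \<in> ?W" "v \<in> ?B" for w
        using False ec_phi[OF ec that(2,1)] by (simp add: k_def P_def)
      then have "(\<Sum>w\<in>?W. ennreal ((cmod (deriv (\<sigma> w) v))\<^sup>2) * k (\<sigma> w v) * indicator ?B v) = 0"
        by (intro sum.neutral) (auto simp: indicator_def)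
      then show ?thesis using False by simp
    qed
  qed
  finally show ?thesis by (simp add: P_def)
qed

lemma regular_values_nonempty: "regular_values \<noteq> {}"
proof
  assume "regular_values = {}"
  then have "ball (0::complex) 1 \<subseteq> \<phi> ` critical_points \<phi>" by (auto simp: regular_values_def)
  then have "finite (ball (0::complex) 1)" using finite_critical finite_subset by blast
  then show False using uncountable_ball[of 1 "0::complex"] countable_finite by auto
qed

text \<open>Disjoint Borel pieces of countably many evenly covered disks exhaust the regular values,
  so the integral is a series of integrals of fibre sums; the finite singular set is null. The form
  with inequalities yields norm bounds directly and identities by antisymmetry.\<close>

lemma nn_integral_disk_mono_aux:
  assumes h1[measurable]: "h1 \<in> borel_measurable borel" and h2[measurable]: "h2 \<in> borel_measurable borel"
    and le: "\<And>v. v \<in> regular_values \<Longrightarrow> fibre_integral h1 v \<le> fibre_integral h2 v"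
  shows "(\<integral>\<^sup>+z\<in>ball 0 1. h1 z \<partial>lborel) \<le> (\<integral>\<^sup>+z\<in>ball 0 1. h2 z \<partial>lborel)"
proof -
  obtain r \<sigma> where ec: "\<And>v. v \<in> regular_values \<Longrightarrow> evenly_covered v (r v) (\<sigma> v)"
    using evenly_covered_exists by metis
  define \<F> where "\<F> = (\<lambda>v. ball v (r v)) ` regular_values"
  have "\<And>S. S \<in> \<F> \<Longrightarrow> open S" by (auto simp: \<F>_def)
  then obtain \<F>' where F': "\<F>' \<subseteq> \<F>" "countable \<F>'" "\<Union>\<F>' = \<Union>\<F>"
    using Lindelof by metis
  have UF: "\<Union>\<F> = regular_values"
  proof (intro equalityI subsetI)
    fix v assume "v \<in> \<Union>\<F>"
    then show "v \<in> regular_values" using ec_regular[OF ec] by (auto simp: \<F>_def)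
  next
    fix v assume v: "v \<in> regular_values"
    then have "v \<in> ball v (r v)" using ec_pos[OF ec] by simp
    then show "v \<in> \<Union>\<F>" using v unfolding \<F>_def by blast
  qed
  have ne: "\<F>' \<noteq> {}" using F'(3) UF regular_values_nonempty by auto
  define B where "B = from_nat_into \<F>'"
  have B: "range B = \<F>'" unfolding B_def using ne F'(2) by (simp add: range_from_nat_into)
  define A where "A = disjointed B"
  have UA: "(\<Union>k. A k) = regular_values" unfolding A_def UN_disjointed_eq using B F'(3) UF by simp
  have disj: "disjoint_family A" unfolding A_def by (rule disjoint_family_disjointed)
  have Bk: "\<exists>v\<in>regular_values. B k = ball v (r v)" for k
    using B F'(1) unfolding \<F>_def by blast
  have "range B \<subseteq> sets borel" using Bk by (metis borel_open image_subsetI open_ball)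
  then have Ab[measurable]: "A k \<in> sets borel" for k
    unfolding A_def using sets.range_disjointed_sets by blast
  have AB: "A k \<subseteq> B k" for k unfolding A_def by (rule disjointed_subset)
  define P where "P = (\<lambda>k. {z \<in> ball 0 1. \<phi> z \<in> A k})"
  have AD: "A k \<subseteq> ball 0 1" for k using UA by (auto simp: regular_values_def)
  have P[measurable]: "P k \<in> sets borel" for k unfolding P_def by (rule preimage_borel[OF Ab AD])
  have null: "AE z in lborel. z \<notin> singular_set \<phi>"
    using finite_singular by (intro AE_not_in finite_imp_null_set_lborel)
  have split: "(\<integral>\<^sup>+z\<in>ball 0 1. h z \<partial>lborel) = (\<Sum>k. \<integral>\<^sup>+v\<in>A k. fibre_integral h v \<partial>lborel)"
    if h[measurable]: "h \<in> borel_measurable borel" for h :: "complex \<Rightarrow> ennreal"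
  proof -
    have "(\<integral>\<^sup>+z\<in>ball 0 1. h z \<partial>lborel) = (\<integral>\<^sup>+z. (\<Sum>k. h z * indicator (P k) z) \<partial>lborel)"
    proof (rule nn_integral_cong_AE, rule AE_mp[OF null], rule AE_I2, rule impI)
      fix z assume z: "z \<notin> singular_set \<phi>"
      show "h z * indicator (ball 0 1) z = (\<Sum>k. h z * indicator (P k) z)"
      proof (cases "z \<in> ball 0 1")
        case True
        then have "\<phi> z \<in> regular_values" using z regular_iff by (auto simp: regular_set_def)
        then obtain k where k: "\<phi> z \<in> A k" using UA by blast
        have "\<phi> z \<notin> A j" if "j \<noteq> k" for j
          using disj k that by (auto simp: disjoint_family_on_def)
        then have "(\<Sum>k. h z * indicator (P k) z) = (\<Sum>j\<in>{k}. h z * indicator (P j) z)"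
          by (intro suminf_finite) (auto simp: P_def)
        also have "\<dots> = h z * indicator (P k) z" by (subst sum.insert) auto
        also have "\<dots> = h z * indicator (ball 0 1) z" using True k by (simp add: P_def)
        finally show ?thesis ..
      qed (simp add: P_def)
    qed
    also have "\<dots> = (\<Sum>k. \<integral>\<^sup>+z\<in>P k. h z \<partial>lborel)"
      by (rule nn_integral_suminf) measurable
    also have "\<dots> = (\<Sum>k. \<integral>\<^sup>+v\<in>A k. fibre_integral h v \<partial>lborel)"
    proof (rule suminf_cong)
      fix k
      obtain v where v: "v \<in> regular_values" "B k = ball v (r v)" using Bk by blast
      show "(\<integral>\<^sup>+z\<in>P k. h z \<partial>lborel) = (\<integral>\<^sup>+v\<in>A k. fibre_integral h v \<partial>lborel)"
        unfolding P_def using AB[of k] v(2)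
        by (intro nn_integral_evenly_covered[OF ec[OF v(1)]]) auto
    qed
    finally show ?thesis .
  qed
  have "(\<Sum>k. \<integral>\<^sup>+v\<in>A k. fibre_integral h1 v \<partial>lborel) \<le> (\<Sum>k. \<integral>\<^sup>+v\<in>A k. fibre_integral h2 v \<partial>lborel)"
    using UA le by (intro suminf_le nn_integral_mono) (auto simp: indicator_def)
  then show ?thesis by (simp add: split[OF h1] split[OF h2])
qed

theorem nn_integral_fibre_mono:
  assumes h1[measurable]: "h1 \<in> borel_measurable borel" and h2[measurable]: "h2 \<in> borel_measurable borel"
    and le: "\<And>v. v \<in> regular_values \<Longrightarrow> fibre_integral h1 v \<le> fibre_integral h2 v"
  shows "(\<integral>\<^sup>+z. h1 z \<partial>disk_area) \<le> (\<integral>\<^sup>+z. h2 z \<partial>disk_area)"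
  using nn_integral_disk_mono_aux[OF assms]
  by (simp add: nn_integral_disk_area divide_right_mono_ennreal)

lemma fibre_integral_ennreal:
  assumes "\<And>z. 0 \<le> g z"
  shows "fibre_integral (\<lambda>z. ennreal (g z)) v = ennreal (\<Sum>z\<in>fibre v. g z / (cmod (deriv \<phi> z))\<^sup>2)"
  unfolding fibre_integral_def using assms by (subst sum_ennreal[symmetric]) (auto simp: ennreal_mult[symmetric])

theorem integral_fibre_mono:
  fixes h1 h2 :: "complex \<Rightarrow> real"
  assumes i1: "integrable disk_area h1" and i2: "integrable disk_area h2"
    and le: "\<And>v. v \<in> regular_values \<Longrightarrow>
      (\<Sum>z\<in>fibre v. h1 z / (cmod (deriv \<phi> z))\<^sup>2) \<le> (\<Sum>z\<in>fibre v. h2 z / (cmod (deriv \<phi> z))\<^sup>2)"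
  shows "(LINT z|disk_area. h1 z) \<le> (LINT z|disk_area. h2 z)"
proof -
  have m[measurable]: "h1 \<in> borel_measurable borel" "h2 \<in> borel_measurable borel"
    using borel_measurable_integrable[OF i1] borel_measurable_integrable[OF i2] by simp_all
  \<comment> \<open>Negative parts change sides: \<open>g1\<close> and \<open>g2\<close> are
    nonnegative and have the same difference as \<open>h1\<close> and \<open>h2\<close>, pointwise
    and so in every fibre sum.\<close>
  define g1 where "g1 = (\<lambda>z. max 0 (h1 z) + max 0 (- h2 z))"
  define g2 where "g2 = (\<lambda>z. max 0 (h2 z) + max 0 (- h1 z))"
  have gi: "integrable disk_area g1" "integrable disk_area g2"
    unfolding g1_def g2_def using i1 i2 by auto
  have g0: "0 \<le> g1 z" "0 \<le> g2 z" for z by (auto simp: g1_def g2_def)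
  have gm[measurable]: "g1 \<in> borel_measurable borel" "g2 \<in> borel_measurable borel"
    unfolding g1_def g2_def by measurable
  have diff: "h1 z - h2 z = g1 z - g2 z" for z by (auto simp: g1_def g2_def max_def)
  have "(\<integral>\<^sup>+z. ennreal (g1 z) \<partial>disk_area) \<le> (\<integral>\<^sup>+z. ennreal (g2 z) \<partial>disk_area)"
  proof (rule nn_integral_fibre_mono)
    fix v assume v: "v \<in> regular_values"
    have "(\<Sum>z\<in>fibre v. g1 z / (cmod (deriv \<phi> z))\<^sup>2) - (\<Sum>z\<in>fibre v. g2 z / (cmod (deriv \<phi> z))\<^sup>2)
       = (\<Sum>z\<in>fibre v. h1 z / (cmod (deriv \<phi> z))\<^sup>2) - (\<Sum>z\<in>fibre v. h2 z / (cmod (deriv \<phi> z))\<^sup>2)"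
      by (simp add: sum_subtractf[symmetric] diff_divide_distrib[symmetric] diff)
    then show "fibre_integral (\<lambda>z. ennreal (g1 z)) v \<le> fibre_integral (\<lambda>z. ennreal (g2 z)) v"
      unfolding fibre_integral_ennreal[of g1, OF g0(1)] fibre_integral_ennreal[of g2, OF g0(2)] using le[OF v] by (intro ennreal_leI) linarith
  qed measurable
  then have "(LINT z|disk_area. g1 z) \<le> (LINT z|disk_area. g2 z)"
    using gi g0 Bochner_Integration.integral_nonneg[of disk_area g2] by (simp add: nn_integral_eq_integral)
  moreover have "(LINT z|disk_area. h1 z) - (LINT z|disk_area. h2 z) = (LINT z|disk_area. g1 z) - (LINT z|disk_area. g2 z)"
  proof -
    have "(LINT z|disk_area. h1 z - h2 z) = (LINT z|disk_area. g1 z - g2 z)" by (simp only: diff)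
    then show ?thesis
      by (simp only: Bochner_Integration.integral_diff[OF gi] Bochner_Integration.integral_diff[OF i1 i2])
  qed
  ultimately show ?thesis by linarith
qed

lemma integral_fibre_eq:
  fixes h1 h2 :: "complex \<Rightarrow> complex"
  assumes i1: "integrable disk_area h1" and i2: "integrable disk_area h2"
    and eq: "\<And>v. v \<in> regular_values \<Longrightarrow>
      (\<Sum>z\<in>fibre v. h1 z / (cmod (deriv \<phi> z))\<^sup>2) = (\<Sum>z\<in>fibre v. h2 z / (cmod (deriv \<phi> z))\<^sup>2)"
  shows "(LINT z|disk_area. h1 z) = (LINT z|disk_area. h2 z)"
proof -
  have Re: "(\<Sum>z\<in>fibre v. Re (h1 z) / (cmod (deriv \<phi> z))\<^sup>2) = (\<Sum>z\<in>fibre v. Re (h2 z) / (cmod (deriv \<phi> z))\<^sup>2)"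
    and Im: "(\<Sum>z\<in>fibre v. Im (h1 z) / (cmod (deriv \<phi> z))\<^sup>2) = (\<Sum>z\<in>fibre v. Im (h2 z) / (cmod (deriv \<phi> z))\<^sup>2)"
    if "v \<in> regular_values" for v
    using arg_cong[OF eq[OF that], of Re] arg_cong[OF eq[OF that], of Im]
    by (simp_all flip: of_real_power)
  have "(LINT z|disk_area. Re (h1 z)) = (LINT z|disk_area. Re (h2 z))"
    using i1 i2 Re by (intro antisym integral_fibre_mono) auto
  moreover have "(LINT z|disk_area. Im (h1 z)) = (LINT z|disk_area. Im (h2 z))"
    using i1 i2 Im by (intro antisym integral_fibre_mono) auto
  ultimately show ?thesis using i1 i2 by (simp add: complex_eq_iff)
qed

end

section \<open>The operator attached to a component of the cover\<close>

lemma finite_measure_disk_area: "emeasure disk_area (space disk_area) < \<infinity>"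
proof -
  have "emeasure disk_area (space disk_area) = (\<integral>\<^sup>+x. 1 \<partial>disk_area)" by simp
  also have "\<dots> = emeasure lborel (ball (0::complex) 1) / ennreal (measure lborel (ball (0::complex) 1))"
    by (subst nn_integral_disk_area) auto
  also have "\<dots> < \<infinity>"
    using emeasure_lborel_ball_finite[of "0::complex" 1] measure_unit_ball_pos
    by (simp add: emeasure_eq_ennreal_measure less_top divide_ennreal)
  finally show ?thesis .
qed

lemma coordinate_mult:
  "bergman_fun (mult_op (\<lambda>\<zeta>. \<zeta>) h) z = z * bergman_fun h z" "mult_op (\<lambda>\<zeta>. \<zeta>) \<in> bounded_ops"
  by (rule mult_op_fun mult_op_bounded_ops; auto intro: holomorphic_intros)+

lemma one_in_bergman_set: "(\<lambda>z. if z \<in> ball 0 1 then 1 else 0) \<in> bergman_set"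
proof -
  have "integrable disk_area (\<lambda>z. (cmod (if z \<in> ball 0 1 then 1 else 0))\<^sup>2)"
  proof (rule integrableI_nonneg)
    show "(\<lambda>z. (cmod (if z \<in> ball 0 1 then 1 else 0))\<^sup>2) \<in> borel_measurable disk_area"
      by (simp only: measurable_disk_area) (measurable, auto)
    have "(\<integral>\<^sup>+z. ennreal ((cmod (if z \<in> ball 0 1 then 1 else 0))\<^sup>2) \<partial>disk_area) \<le> (\<integral>\<^sup>+z. 1 \<partial>disk_area)"
      by (intro nn_integral_mono) auto
    also have "\<dots> < \<infinity>" using finite_measure_disk_area by simp
    finally show "(\<integral>\<^sup>+z. ennreal ((cmod (if z \<in> ball 0 1 then 1 else 0))\<^sup>2) \<partial>disk_area) < \<infinity>" .
  qed simp
  moreover have "(\<lambda>z. if z \<in> ball 0 1 then 1 else 0) holomorphic_on (ball (0::complex) 1)"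
    by (rule holomorphic_transform[of "\<lambda>_. 1"]) auto
  ultimately show ?thesis by (auto simp: bergman_set_def)
qed

text \<open>The product of the factors z - a, built up by multiplication with the coordinate. In
  this form a bounded operator applied to it can be expanded root by root.\<close>

primrec nodal :: "complex list \<Rightarrow> bergman" where
  "nodal [] = Bergman (\<lambda>z. if z \<in> ball 0 1 then 1 else 0)"
| "nodal (a # as) = mult_op (\<lambda>\<zeta>. \<zeta>) (nodal as) - cscale a (nodal as)"

lemma nodal_fun: "z \<in> ball 0 1 \<Longrightarrow> bergman_fun (nodal as) z = (\<Prod>a\<leftarrow>as. z - a)"
  by (induction as)
     (simp_all add: Bergman_inverse[OF one_in_bergman_set] bergman_fun_diff coordinate_mult(1) algebra_simps
       del: mem_ball mem_ball_0)

lemma op_sum_apply: "(\<Sum>x\<in>S. F x) f = (\<Sum>x\<in>S. F x f)" for F :: "'i \<Rightarrow> bergman \<Rightarrow> bergman"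
  by (induction S rule: infinite_finite_induct) auto

context proper_disk_map
begin

lemma regular_nonempty: "regular_set \<phi> \<noteq> {}"
proof
  assume "regular_set \<phi> = {}"
  then have "ball (0::complex) 1 \<subseteq> singular_set \<phi>" by (auto simp: regular_set_def)
  then have "finite (ball (0::complex) 1)" using finite_singular finite_subset by blast
  then show False using uncountable_ball[of 1 "0::complex"] countable_finite by auto
qed

lemma holomorphic_eq_on_regular:
  assumes "f holomorphic_on ball 0 1" "g holomorphic_on ball 0 1"
    and eq: "\<And>z. z \<in> regular_set \<phi> \<Longrightarrow> f z = g z" and z: "z \<in> ball 0 1"
  shows "f z = g z"
  by (rule analytic_continuation_open[OF open_regular open_ball regular_nonempty _ _ assms(1,2) eq z])
     (use regular_ball in auto)

lemma bergman_eq_on_regular: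
  assumes "\<And>z. z \<in> regular_set \<phi> \<Longrightarrow> bergman_fun f z = bergman_fun g z"
  shows "f = g"
  by (rule bergman_eqI) (rule holomorphic_eq_on_regular[OF bergman_fun_holomorphic bergman_fun_holomorphic assms])

text \<open>\<open>deriv \<phi> z / deriv \<phi> w\<close> is the derivative at \<open>z\<close> of
  the local inverse with value \<open>w\<close>, so this is the sum over the class belonging to
  \<open>C\<close>, written without germs.\<close>

definition component_sum :: "(complex \<times> complex) set \<Rightarrow> (complex \<Rightarrow> complex) \<Rightarrow> complex \<Rightarrow> complex" where
  "component_sum C f z = (\<Sum>w\<in>component_fibre C z. deriv \<phi> z / deriv \<phi> w * f w)"

lemma component_sum_fibre:
  assumes C: "C \<in> cover_components" and z: "z \<in> fibre v"
  shows "component_sum C f z = (\<Sum>w\<in>fibre v. if (w, z) \<in> C then deriv \<phi> z / deriv \<phi> w * f w else 0)"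
proof -
  have "component_fibre C z = {w \<in> fibre v. (w, z) \<in> C}"
    using component_fibre_subset[OF C, of z] fibreD(2)[OF z] by (auto simp: component_fibre_def)
  then show ?thesis unfolding component_sum_def by (simp only: sum.inter_filter[OF finite_fib])
qed

text \<open>With a primitive \<open>F\<close> of \<open>f\<close>, the component sum of \<open>f\<close> is the derivative of
  \<open>\<Sum> F(w)\<close>, which stays bounded near the singular points although \<open>\<phi>'(z)/\<phi>'(w)\<close> does not.\<close>

lemma component_sum_extends:
  assumes C: "C \<in> cover_components" and f: "f holomorphic_on ball 0 1"
  shows "\<exists>H. H holomorphic_on ball 0 1 \<and> (\<forall>z\<in>regular_set \<phi>. H z = component_sum C f z)"
proof -
  obtain F where F: "\<And>z. z \<in> ball 0 1 \<Longrightarrow> (F has_field_derivative f z) (at z)"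
    using holomorphic_convex_primitive'[OF _ open_ball f] by (auto simp: at_within_open[OF _ open_ball])
  define S where "S = (\<lambda>z. \<Sum>w\<in>component_fibre C z. F w)"
  have der: "(S has_field_derivative component_sum C f z) (at z)" if z: "z \<in> regular_set \<phi>" for z
  proof -
    have v: "\<phi> z \<in> regular_values" "z \<in> fibre (\<phi> z)" using z by (auto simp: regular_iff fibre_def)
    obtain r \<sigma> where ec: "evenly_covered (\<phi> z) r \<sigma>" using evenly_covered_exists[OF v(1)] by blast
    have c: "\<phi> z \<in> ball (\<phi> z) r" using ec_pos[OF ec] by simp
    have sub: "component_fibre C z \<subseteq> fibre (\<phi> z)" by (rule component_fibre_subset[OF C])
    have dphi: "(\<phi> has_field_derivative deriv \<phi> z) (at z)"
      using holomorphic_derivI[OF holo open_ball regular_ball[OF z]] .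
    have "((\<lambda>z'. \<Sum>w\<in>component_fibre C z. F (\<sigma> w (\<phi> z'))) has_field_derivative
       (\<Sum>w\<in>component_fibre C z. f w * (1 / deriv \<phi> w * deriv \<phi> z))) (at z)"
    proof (rule DERIV_sum)
      fix w assume "w \<in> component_fibre C z"
      then have w: "w \<in> fibre (\<phi> z)" using sub by blast
      have "((\<lambda>z'. \<sigma> w (\<phi> z')) has_field_derivative 1 / deriv \<phi> w * deriv \<phi> z) (at z)"
        using DERIV_chain2[OF _ dphi, of "\<sigma> w" "1 / deriv \<phi> w"] ec_deriv(1)[OF ec c w] ec_centre[OF ec w] by simp
      moreover have "(F has_field_derivative f w) (at (\<sigma> w (\<phi> z)))"
        using F fibreD(1)[OF w] ec_centre[OF ec w] by simp
      ultimately show "((\<lambda>z'. F (\<sigma> w (\<phi> z'))) has_field_derivative f w * (1 / deriv \<phi> w * deriv \<phi> z)) (at z)"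
        by (rule DERIV_chain2[rotated])
    qed
    also have "(\<Sum>w\<in>component_fibre C z. f w * (1 / deriv \<phi> w * deriv \<phi> z)) = component_sum C f z"
      unfolding component_sum_def by (intro sum.cong) auto
    finally show ?thesis
    proof (rule has_field_derivative_transform_within_open)
      show "open (\<sigma> z ` ball (\<phi> z) r)" by (rule ec_open[OF ec v(2)])
      show "z \<in> \<sigma> z ` ball (\<phi> z) r" using c ec_centre[OF ec v(2)] by (metis imageI)
      fix z' assume "z' \<in> \<sigma> z ` ball (\<phi> z) r"
      then obtain v' where v': "v' \<in> ball (\<phi> z) r" "z' = \<sigma> z v'" by blast
      then have "\<phi> z' = v'" using ec_phi[OF ec v'(1) v(2)] by simp
      then show "(\<Sum>w\<in>component_fibre C z. F (\<sigma> w (\<phi> z'))) = S z'"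
        unfolding S_def using sum.reindex_bij_betw[OF component_fibre_section[OF ec C v(2) v'(1)], of F] v' by simp
    qed
  qed
  then have Shol: "S holomorphic_on regular_set \<phi>"
    using open_regular by (auto simp: holomorphic_on_open)
  have Fcont: "continuous_on (ball 0 1) F"
    using F by (meson DERIV_continuous continuous_at_imp_continuous_on)
  have "\<exists>G. G holomorphic_on ball 0 1 \<and> (\<forall>z\<in>ball 0 1 - singular_set \<phi>. G z = S z)"
  proof (rule removable_singularities)
    show "finite (singular_set \<phi>)" by (rule finite_singular)
    show "singular_set \<phi> \<subseteq> interior (ball 0 1)" by (auto simp: singular_set_def)
    show "S holomorphic_on ball 0 1 - singular_set \<phi>" using Shol by (simp add: regular_set_def)
    fix b assume "b \<in> singular_set \<phi>"
    then have b: "b \<in> ball 0 1" by (simp add: singular_set_def)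
    obtain \<rho> where \<rho>: "\<rho> > 0" "cball b \<rho> \<subseteq> ball 0 1" using b open_contains_cball open_ball by blast
    \<comment> \<open>All points sharing a value with the small disk around \<open>b\<close>. By
      properness this is a compact part of the open disk, so \<open>F\<close> is bounded on it and
      \<open>S\<close> is near \<open>b\<close> a sum of at most \<open>N\<close> bounded
      terms.\<close>
    define L where "L = cball 0 1 \<inter> \<phi> -` (\<phi> ` cball b \<rho>)"
    have "compact (\<phi> ` cball b \<rho>)"
      by (rule compact_continuous_image[OF continuous_on_subset[OF holomorphic_on_imp_continuous_on[OF holo] \<rho>(2)] compact_cball])
    then have "closed L" unfolding L_def
      by (intro continuous_closed_preimage[OF cont] compact_imp_closed) auto
    moreover have "bounded L" by (rule bounded_subset[OF bounded_cball[of 0 1]]) (simp add: L_def)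
    ultimately have cL: "compact L" by (simp add: compact_eq_bounded_closed)
    have LD: "L \<subseteq> ball 0 1"
    proof
      fix x assume x: "x \<in> L"
      then obtain y where "y \<in> cball b \<rho>" "\<phi> x = \<phi> y" by (auto simp: L_def)
      then have "cmod (\<phi> x) < 1" using \<rho>(2) less_one by auto
      then have "cmod x \<noteq> 1" using eq_one by auto
      then show "x \<in> ball 0 1" using x by (auto simp: L_def)
    qed
    have "compact (F ` L)" by (rule compact_continuous_image[OF continuous_on_subset[OF Fcont LD] cL])
    then obtain B where B: "\<And>x. x \<in> L \<Longrightarrow> cmod (F x) \<le> B" "B > 0"
      using compact_imp_bounded[of "F ` L"] unfolding bounded_pos by auto
    have bound: "cmod (S z) \<le> real N * B" if z: "z \<in> cball b \<rho>" for z
    proof -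
      have sub: "component_fibre C z \<subseteq> fibre (\<phi> z)" by (rule component_fibre_subset[OF C])
      have "cmod (S z) \<le> (\<Sum>w\<in>component_fibre C z. B)"
        unfolding S_def
      proof (rule sum_norm_le)
        fix w assume "w \<in> component_fibre C z"
        then have "w \<in> fibre (\<phi> z)" using sub by blast
        then have "w \<in> L" using z by (auto simp: L_def fibre_def)
        then show "cmod (F w) \<le> B" using B by blast
      qed
      also have "\<dots> \<le> real N * B"
        using B(2) card_mono[OF finite_fib sub] card_fib[of "\<phi> z"] by (simp add: mult_right_mono)
      finally show ?thesis .
    qed
    have "\<forall>\<^sub>F z in at b. norm (S z) \<le> (real N * B) * norm (1::complex)"
      using \<rho>(1) bound
      by (auto simp: eventually_at intro!: exI[of _ \<rho>] simp: dist_commute)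
    then show "S \<in> O[at b](\<lambda>_. 1)" by (rule bigoI)
  qed
  then obtain G where G: "G holomorphic_on ball 0 1" "\<And>z. z \<in> regular_set \<phi> \<Longrightarrow> G z = S z"
    by (auto simp: regular_set_def)
  \<comment> \<open>\<open>G\<close> agrees with \<open>S\<close> on the open regular set, so its
    derivative is the desired extension.\<close>
  have "deriv G z = component_sum C f z" if z: "z \<in> regular_set \<phi>" for z
  proof -
    have "(G has_field_derivative component_sum C f z) (at z)"
      by (rule has_field_derivative_transform_within_open[OF der[OF z] open_regular z]) (simp add: G(2))
    then show ?thesis by (rule DERIV_imp_deriv)
  qed
  then show ?thesis using holomorphic_deriv[OF G(1) open_ball] by blast
qed

text \<open>Once the factor \<open>deriv \<phi> z\<close> is pulled out, this is the Cauchy-Schwarz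
  inequality for at most \<open>N\<close> terms; the weights on both sides match those of
  \<open>fibre_integral\<close>.\<close>

lemma component_sum_bound:
  assumes C: "C \<in> cover_components" and z: "z \<in> fibre v" and v: "v \<in> regular_values"
  shows "(cmod (component_sum C f z))\<^sup>2 / (cmod (deriv \<phi> z))\<^sup>2
    \<le> real N * (\<Sum>w\<in>fibre v. (cmod (f w))\<^sup>2 / (cmod (deriv \<phi> w))\<^sup>2)"
proof -
  have dz: "deriv \<phi> z \<noteq> 0" using deriv_nonzero regular_fibre[OF v z] by blast
  have sub: "component_fibre C z \<subseteq> fibre v" using component_fibre_subset[OF C, of z] fibreD(2)[OF z] by simp
  have fin: "finite (component_fibre C z)" using finite_component_fibre[OF C] .
  have "component_sum C f z = deriv \<phi> z * (\<Sum>w\<in>component_fibre C z. f w / deriv \<phi> w)"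
    by (simp add: component_sum_def sum_distrib_left)
  then have "(cmod (component_sum C f z))\<^sup>2 / (cmod (deriv \<phi> z))\<^sup>2
      = (cmod (\<Sum>w\<in>component_fibre C z. f w / deriv \<phi> w))\<^sup>2"
    using dz by (simp add: norm_mult power_mult_distrib)
  also have "\<dots> \<le> (\<Sum>w\<in>component_fibre C z. cmod (f w / deriv \<phi> w))\<^sup>2"
    by (intro power_mono norm_sum) simp
  also have "\<dots> \<le> (\<Sum>w\<in>component_fibre C z. (cmod (f w / deriv \<phi> w))\<^sup>2) * card (component_fibre C z)"
    by (rule sum_squared_le_sum_of_squares)
  also have "\<dots> \<le> (\<Sum>w\<in>fibre v. (cmod (f w / deriv \<phi> w))\<^sup>2) * real N"
    using card_mono[OF finite_fib sub] card_fib[of v]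
    by (intro mult_mono sum_mono2 sub) (auto intro: sum_nonneg)
  finally show ?thesis by (simp add: norm_divide power_divide mult.commute)
qed

text \<open>\<open>component_sum_bound\<close> costs a factor \<open>N\<close>, and summation over
  the fibre points \<open>z\<close> another one; the resulting \<open>(real N)\<^sup>2\<close> for
  squared norms gives the constant \<open>real N\<close>.\<close>

lemma component_op_exists:
  assumes C: "C \<in> cover_components"
  shows "\<exists>h. (\<forall>z\<in>regular_set \<phi>. bergman_fun h z = component_sum C (bergman_fun f) z) \<and>
    norm h \<le> norm f * real N"
proof -
  let ?f = "bergman_fun f"
  obtain H where H: "H holomorphic_on ball 0 1" "\<And>z. z \<in> regular_set \<phi> \<Longrightarrow> H z = component_sum C ?f z"
    using component_sum_extends[OF C bergman_fun_holomorphic] by metis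
  define h where "h = (\<lambda>z. if z \<in> ball 0 1 then H z else 0)"
  have hm[measurable]: "h \<in> borel_measurable borel"
    unfolding h_def by (rule holomorphic_extension_measurable[OF H(1) open_ball])
  have "(\<integral>\<^sup>+z. ennreal ((cmod (h z))\<^sup>2) \<partial>disk_area) \<le> (\<integral>\<^sup>+z. ennreal ((real N)\<^sup>2 * (cmod (?f z))\<^sup>2) \<partial>disk_area)"
  proof (rule nn_integral_fibre_mono)
    fix v assume v: "v \<in> regular_values"
    let ?R = "\<Sum>w\<in>fibre v. (cmod (?f w))\<^sup>2 / (cmod (deriv \<phi> w))\<^sup>2"
    have "(\<Sum>z\<in>fibre v. (cmod (h z))\<^sup>2 / (cmod (deriv \<phi> z))\<^sup>2) \<le> (\<Sum>z\<in>fibre v. real N * ?R)"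
    proof (rule sum_mono)
      fix z assume z: "z \<in> fibre v"
      have "h z = component_sum C ?f z" using H(2)[OF regular_fibre[OF v z]] fibreD(1)[OF z] by (simp add: h_def)
      then show "(cmod (h z))\<^sup>2 / (cmod (deriv \<phi> z))\<^sup>2 \<le> real N * ?R"
        using component_sum_bound[OF C z v] by simp
    qed
    also have "\<dots> \<le> real N * (real N * ?R)"
      using card_fib[of v] by (simp add: mult_right_mono sum_nonneg)
    also have "\<dots> = (\<Sum>z\<in>fibre v. ((real N)\<^sup>2 * (cmod (?f z))\<^sup>2) / (cmod (deriv \<phi> z))\<^sup>2)"
      by (simp add: sum_distrib_left power2_eq_square mult.assoc)
    finally show "fibre_integral (\<lambda>z. ennreal ((cmod (h z))\<^sup>2)) v \<le> fibre_integral (\<lambda>z. ennreal ((real N)\<^sup>2 * (cmod (?f z))\<^sup>2)) v"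
      by (simp add: fibre_integral_ennreal ennreal_leI)
  qed measurable
  also have "\<dots> = ennreal ((real N)\<^sup>2) * (\<integral>\<^sup>+z. ennreal ((cmod (?f z))\<^sup>2) \<partial>disk_area)"
    by (subst nn_integral_cmult[symmetric]) (simp_all add: ennreal_mult)
  also have "\<dots> = ennreal ((norm f * real N)\<^sup>2)"
    by (simp add: bergman_norm_nn_integral ennreal_mult[symmetric] power_mult_distrib mult.commute)
  finally have le: "(\<integral>\<^sup>+z. ennreal ((cmod (h z))\<^sup>2) \<partial>disk_area) \<le> ennreal ((norm f * real N)\<^sup>2)" .
  have "integrable disk_area (\<lambda>z. (cmod (h z))\<^sup>2)"
  proof (rule integrableI_nonneg)
    show "(\<lambda>z. (cmod (h z))\<^sup>2) \<in> borel_measurable disk_area"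
      by (simp only: measurable_disk_area) measurable
    show "(\<integral>\<^sup>+z. ennreal ((cmod (h z))\<^sup>2) \<partial>disk_area) < \<infinity>" using le by (rule le_less_trans) simp
  qed simp
  moreover have "h holomorphic_on ball 0 1"
    using H(1) by (rule holomorphic_transform) (simp add: h_def)
  ultimately have "h \<in> bergman_set" by (auto simp: bergman_set_def h_def)
  then have h: "bergman_fun (Bergman h) = h" by (rule Bergman_inverse)
  have "ennreal ((norm (Bergman h))\<^sup>2) \<le> ennreal ((norm f * real N)\<^sup>2)"
    using le unfolding bergman_norm_nn_integral[symmetric] h .
  then have "(norm (Bergman h))\<^sup>2 \<le> (norm f * real N)\<^sup>2" by simp
  then have "norm (Bergman h) \<le> norm f * real N" by (rule power2_le_imp_le) simp
  moreover have "\<forall>z\<in>regular_set \<phi>. bergman_fun (Bergman h) z = component_sum C ?f z"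
    unfolding h using H(2) regular_ball by (simp add: h_def)
  ultimately show ?thesis by blast
qed

definition component_op :: "(complex \<times> complex) set \<Rightarrow> bergman \<Rightarrow> bergman" where
  "component_op C f = (THE h. \<forall>z\<in>regular_set \<phi>. bergman_fun h z = component_sum C (bergman_fun f) z)"

lemma component_op_eqI:
  assumes "\<And>z. z \<in> regular_set \<phi> \<Longrightarrow> bergman_fun h z = component_sum C (bergman_fun f) z"
  shows "component_op C f = h"
  unfolding component_op_def by (rule the_equality) (use assms in \<open>auto intro: bergman_eq_on_regular\<close>)

lemma component_op_fun:
  assumes C: "C \<in> cover_components" and z: "z \<in> regular_set \<phi>"
  shows "bergman_fun (component_op C f) z = component_sum C (bergman_fun f) z"
  using component_op_exists[OF C, of f] component_op_eqI z by metis

lemma component_op_norm: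
  assumes C: "C \<in> cover_components"
  shows "norm (component_op C f) \<le> norm f * real N"
  using component_op_exists[OF C, of f] component_op_eqI by metis

lemma component_op_bounded:
  assumes C: "C \<in> cover_components"
  shows "component_op C \<in> bounded_ops"
proof (rule bounded_opsI[where K = "real N"])
  show "component_op C (f + g) = component_op C f + component_op C g" for f g
    by (rule component_op_eqI)
       (simp add: bergman_fun_add component_op_fun[OF C] component_sum_def distrib_left add_divide_distrib sum.distrib)
  show "component_op C (cscale c f) = cscale c (component_op C f)" for c f
    by (rule component_op_eqI)
       (simp add: component_op_fun[OF C] component_sum_def sum_distrib_left mult_ac)
qed (rule component_op_norm[OF C])

text \<open>Transposition is a homeomorphic involution of the cover, so it permutes the components;
  maximality is checked by swapping back.\<close>

lemma component_swap:
  assumes C: "C \<in> cover_components"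
  shows "prod.swap ` C \<in> cover_components"
proof -
  have sw: "prod.swap ` unbranched_cover \<phi> \<subseteq> unbranched_cover \<phi>"
    by (auto simp: unbranched_cover_def regular_iff)
  have cont: "continuous_on S prod.swap" for S :: "(complex \<times> complex) set"
    unfolding prod.swap_def by (intro continuous_intros)
  have D: "D = prod.swap ` C" if D: "D \<noteq> {}" "prod.swap ` C \<subseteq> D" "D \<subseteq> unbranched_cover \<phi>" "connected D" for D
  proof -
    have "connected (prod.swap ` D)" using connected_continuous_image[OF cont D(4)] .
    moreover have "C \<subseteq> prod.swap ` D" using image_mono[OF D(2), of prod.swap] by (simp add: image_image)
    moreover have "prod.swap ` D \<subseteq> unbranched_cover \<phi>" using D(3) sw by blast
    moreover have "prod.swap ` D \<noteq> {}" using D(1) by simp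
    moreover have "\<forall>E. E \<noteq> {} \<and> C \<subseteq> E \<and> E \<subseteq> unbranched_cover \<phi> \<and> connected E \<longrightarrow> E = C"
      using C[unfolded in_components_maximal] by (elim conjE)
    ultimately have "prod.swap ` D = C" by (elim allE[of _ "prod.swap ` D"]) (simp only: simp_thms)
    then have "prod.swap ` C = prod.swap ` prod.swap ` D" by simp
    then show ?thesis by (simp add: image_image)
  qed
  show ?thesis
    unfolding in_components_maximal
    using D in_components_nonempty[OF C] in_components_subset[OF C] sw
      connected_continuous_image[OF cont in_components_connected[OF C]] by auto
qed

text \<open>In each fibre both integrands sum to the same double sum over pairs
  \<open>(w, z)\<close> in \<open>C\<close>, with denominator
  \<open>deriv \<phi> w * cnj (deriv \<phi> z)\<close>; only the order of summation differs.\<close>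

lemma component_op_adjoint:
  assumes C: "C \<in> cover_components"
  shows "cinner (component_op C f) g = cinner f (component_op (prod.swap ` C) g)"
  unfolding cinner_def
proof (rule integral_fibre_eq)
  fix v assume v: "v \<in> regular_values"
  note C' = component_swap[OF C]
  let ?f = "bergman_fun f" and ?g = "bergman_fun g"
  have nz: "deriv \<phi> z \<noteq> 0" if "z \<in> fibre v" for z using deriv_nonzero regular_fibre[OF v that] by blast
  have "(\<Sum>z\<in>fibre v. bergman_fun (component_op C f) z * cnj (?g z) / (cmod (deriv \<phi> z))\<^sup>2)
     = (\<Sum>z\<in>fibre v. \<Sum>w\<in>fibre v. if (w, z) \<in> C then ?f w * cnj (?g z) / (deriv \<phi> w * cnj (deriv \<phi> z)) else 0)"
  proof (rule sum.cong[OF refl])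
    fix z assume z: "z \<in> fibre v"
    have "bergman_fun (component_op C f) z * cnj (?g z) / (cmod (deriv \<phi> z))\<^sup>2
      = (\<Sum>w\<in>fibre v. (if (w, z) \<in> C then deriv \<phi> z / deriv \<phi> w * ?f w else 0) * (cnj (?g z) / (cmod (deriv \<phi> z))\<^sup>2))"
      unfolding component_op_fun[OF C regular_fibre[OF v z]] component_sum_fibre[OF C z]
      by (simp only: sum_distrib_right sum_divide_distrib times_divide_eq_right)
    also have "\<dots> = (\<Sum>w\<in>fibre v. if (w, z) \<in> C then ?f w * cnj (?g z) / (deriv \<phi> w * cnj (deriv \<phi> z)) else 0)"
      using nz[OF z] by (intro sum.cong refl) (simp add: complex_norm_square[unfolded of_real_power])
    finally show "bergman_fun (component_op C f) z * cnj (?g z) / (cmod (deriv \<phi> z))\<^sup>2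
      = (\<Sum>w\<in>fibre v. if (w, z) \<in> C then ?f w * cnj (?g z) / (deriv \<phi> w * cnj (deriv \<phi> z)) else 0)" .
  qed
  also have "\<dots> = (\<Sum>w\<in>fibre v. \<Sum>z\<in>fibre v. if (w, z) \<in> C then ?f w * cnj (?g z) / (deriv \<phi> w * cnj (deriv \<phi> z)) else 0)"
    by (rule sum.swap)
  also have "\<dots> = (\<Sum>w\<in>fibre v. ?f w * cnj (bergman_fun (component_op (prod.swap ` C) g) w) / (cmod (deriv \<phi> w))\<^sup>2)"
  proof (rule sum.cong[OF refl])
    fix w assume w: "w \<in> fibre v"
    have mem: "(z, w) \<in> prod.swap ` C \<longleftrightarrow> (w, z) \<in> C" for z by force
    have "?f w * cnj (bergman_fun (component_op (prod.swap ` C) g) w) / (cmod (deriv \<phi> w))\<^sup>2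
      = (\<Sum>z\<in>fibre v. (?f w / (cmod (deriv \<phi> w))\<^sup>2) * cnj (if (w, z) \<in> C then deriv \<phi> w / deriv \<phi> z * ?g z else 0))"
      unfolding component_op_fun[OF C' regular_fibre[OF v w]] component_sum_fibre[OF C' w] mem
      by (simp add: sum_distrib_left sum_divide_distrib cnj_sum)
    also have "\<dots> = (\<Sum>z\<in>fibre v. if (w, z) \<in> C then ?f w * cnj (?g z) / (deriv \<phi> w * cnj (deriv \<phi> z)) else 0)"
      using nz[OF w] by (intro sum.cong refl) (simp add: complex_norm_square[unfolded of_real_power])
    finally show "(\<Sum>z\<in>fibre v. if (w, z) \<in> C then ?f w * cnj (?g z) / (deriv \<phi> w * cnj (deriv \<phi> z)) else 0)
      = ?f w * cnj (bergman_fun (component_op (prod.swap ` C) g) w) / (cmod (deriv \<phi> w))\<^sup>2" by simp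
  qed
  finally show "(\<Sum>z\<in>fibre v. bergman_fun (component_op C f) z * cnj (?g z) / (cmod (deriv \<phi> z))\<^sup>2)
    = (\<Sum>w\<in>fibre v. ?f w * cnj (bergman_fun (component_op (prod.swap ` C) g) w) / (cmod (deriv \<phi> w))\<^sup>2)" .
qed (rule integrable_bergman_cinner)+

lemma mult_fun [simp]: "bergman_fun (mult_op \<phi> h) z = \<phi> z * bergman_fun h z"
  by (rule mult_op_fun[OF holo]) (simp add: less_one less_imp_le)

lemma mult_bounded: "mult_op \<phi> \<in> bounded_ops"
  by (rule mult_op_bounded_ops[OF holo]) (simp add: less_one less_imp_le)

lemma component_op_commute:
  assumes C: "C \<in> cover_components"
  shows "component_op C \<in> commutant {mult_op \<phi>}"
proof -
  have "component_op C (mult_op \<phi> f) = mult_op \<phi> (component_op C f)" for f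
  proof (rule component_op_eqI)
    fix z assume z: "z \<in> regular_set \<phi>"
    have "\<phi> w = \<phi> z" if "w \<in> component_fibre C z" for w
      using that component_fibre_subset[OF C, of z] fibreD by blast
    then show "bergman_fun (mult_op \<phi> (component_op C f)) z = component_sum C (bergman_fun (mult_op \<phi> f)) z"
      by (simp add: component_op_fun[OF C z] component_sum_def sum_distrib_left mult_ac)
  qed
  then show ?thesis using component_op_bounded[OF C] by (auto simp: commutant_def fun_eq_iff)
qed

text \<open>The given operator is the adjoint of the one for the swapped component; that it commutes
  with \<open>adj (mult_op \<phi>)\<close> is the adjoint form of the swapped operator commuting
  with \<open>mult_op \<phi>\<close>.\<close>

theorem component_op_blaschke_algebra:
  assumes C: "C \<in> cover_components"
  shows "component_op C \<in> blaschke_algebra \<phi>"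
proof -
  note C' = component_swap[OF C]
  have "adj (component_op (prod.swap ` C)) = component_op C"
  proof (rule adj_eqI)
    show "cinner (component_op (prod.swap ` C) f) g = cinner f (component_op C g)" for f g
      using component_op_adjoint[OF C, of g f] cinner_commute by metis
  qed
  then have "component_op C \<in> commutant {adj (mult_op \<phi>)}"
    using commutant_adj[OF mult_bounded component_op_commute[OF C']] by simp
  then show ?thesis using component_op_commute[OF C] by (simp add: blaschke_algebra_def)
qed

section \<open>Interpolation on a fibre and linear independence\<close>

lemma interpolation:
  assumes w: "w \<in> fibre v"
  shows "\<exists>p. \<forall>z\<in>fibre v. bergman_fun p z = (if z = w then 1 else 0)"
proof -
  obtain as where as: "set as = fibre v - {w}" using finite_list[of "fibre v - {w}"] by auto
  let ?p = "nodal as"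
  have 0: "bergman_fun ?p z = 0 \<longleftrightarrow> z \<noteq> w" if "z \<in> fibre v" for z
  proof -
    have "bergman_fun ?p z = 0 \<longleftrightarrow> z \<in> set as"
      unfolding nodal_fun[OF fibreD(1)[OF that]] by (induction as) auto
    then show ?thesis using as that by simp
  qed
  then show ?thesis using w by (intro exI[of _ "cscale (1 / bergman_fun ?p w) ?p"]) auto
qed

text \<open>The only summand left is the one at \<open>w\<close>, and \<open>C\<close> is the only
  component containing \<open>(w, z)\<close>: such test functions read off a single
  coefficient.\<close>

lemma component_op_interpolate:
  assumes C: "C \<in> cover_components" and D: "D \<in> cover_components" and wz: "(w, z) \<in> C"
    and p: "\<forall>x\<in>fibre (\<phi> z). bergman_fun p x = (if x = w then 1 else 0)"
  shows "bergman_fun (component_op D p) z = (if D = C then deriv \<phi> z / deriv \<phi> w else 0)"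
proof -
  have "(w, z) \<in> unbranched_cover \<phi>" using wz in_components_subset[OF C] by blast
  then have z: "z \<in> fibre (\<phi> z)" "w \<in> fibre (\<phi> z)" "z \<in> regular_set \<phi>"
    by (auto simp: unbranched_cover_def fibre_def regular_iff)
  have "bergman_fun (component_op D p) z
      = (\<Sum>x\<in>fibre (\<phi> z). if (x, z) \<in> D then deriv \<phi> z / deriv \<phi> x * bergman_fun p x else 0)"
    by (simp add: component_op_fun[OF D z(3)] component_sum_fibre[OF D z(1)])
  also have "\<dots> = (\<Sum>x\<in>fibre (\<phi> z). if x = w then (if (w, z) \<in> D then deriv \<phi> z / deriv \<phi> w else 0) else 0)"
    using p by (intro sum.cong refl) auto
  also have "\<dots> = (if (w, z) \<in> D then deriv \<phi> z / deriv \<phi> w else 0)" using z by simp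
  also have "(w, z) \<in> D \<longleftrightarrow> D = C" using components_nonoverlap[OF C D] wz by blast
  finally show ?thesis .
qed

lemma component_op_combination_zero:
  assumes eq: "\<And>f. (\<Sum>D\<in>cover_components. cscale (c D) (component_op D f)) = 0"
    and C: "C \<in> cover_components"
  shows "c C = 0"
proof -
  obtain w z where wz: "(w, z) \<in> C" using in_components_nonempty[OF C] by fast
  then have X: "(w, z) \<in> unbranched_cover \<phi>" using in_components_subset[OF C] by blast
  then have w: "w \<in> fibre (\<phi> z)" and z: "z \<in> regular_set \<phi>" by (auto simp: fibre_def unbranched_cover_def)
  have wr: "w \<in> regular_set \<phi>" using w z regular_fibre by (auto simp: regular_iff)
  obtain p where p: "\<forall>x\<in>fibre (\<phi> z). bergman_fun p x = (if x = w then 1 else 0)"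
    using interpolation[OF w] by blast
  have sumfun: "bergman_fun (\<Sum>D\<in>S. cscale (c D) (component_op D p)) z
      = (\<Sum>D\<in>S. c D * bergman_fun (component_op D p) z)" for S
    by (induction S rule: infinite_finite_induct) (auto simp: bergman_fun_add)
  have "0 = bergman_fun (\<Sum>D\<in>cover_components. cscale (c D) (component_op D p)) z" by (simp add: eq)
  also have "\<dots> = (\<Sum>D\<in>cover_components. if D = C then c C * (deriv \<phi> z / deriv \<phi> w) else 0)"
    unfolding sumfun using component_op_interpolate[OF C _ wz p] by (intro sum.cong refl) auto
  also have "\<dots> = c C * (deriv \<phi> z / deriv \<phi> w)" using C finite_cover_components[OF z] by simp
  finally show ?thesis using deriv_nonzero[OF z] deriv_nonzero[OF wr] by simp
qed

text \<open>Independence and dimension refer to the set of operators, in which equal operators would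
  merge; this excludes merging.\<close>

lemma component_op_inj: "inj_on component_op cover_components"
proof (rule inj_onI)
  fix C D assume C: "C \<in> cover_components" and D: "D \<in> cover_components" and eq: "component_op C = component_op D"
  obtain w z where wz: "(w, z) \<in> C" using in_components_nonempty[OF C] by fast
  then have X: "(w, z) \<in> unbranched_cover \<phi>" using in_components_subset[OF C] by blast
  then have w: "w \<in> fibre (\<phi> z)" and z: "z \<in> regular_set \<phi>" by (auto simp: fibre_def unbranched_cover_def)
  have wr: "w \<in> regular_set \<phi>" using w z regular_fibre by (auto simp: regular_iff)
  obtain p where p: "\<forall>x\<in>fibre (\<phi> z). bergman_fun p x = (if x = w then 1 else 0)"
    using interpolation[OF w] by blast
  have "deriv \<phi> z / deriv \<phi> w \<noteq> 0" using deriv_nonzero[OF z] deriv_nonzero[OF wr] by simp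
  then have "(if D = C then deriv \<phi> z / deriv \<phi> w else 0) \<noteq> 0"
    using component_op_interpolate[OF C C wz p] component_op_interpolate[OF C D wz p]
    unfolding eq[symmetric] by (simp only: if_True simp_thms)
  then show "C = D" by (metis (full_types))
qed

theorem component_op_independent: "ops.independent (component_op ` cover_components)"
proof
  obtain z where "z \<in> regular_set \<phi>" using regular_nonempty by blast
  then have fin: "finite cover_components" by (rule finite_cover_components)
  assume "ops.dependent (component_op ` cover_components)"
  then obtain u T where u: "T \<in> component_op ` cover_components" "u T \<noteq> 0"
    "(\<Sum>T\<in>component_op ` cover_components. op_scale (u T) T) = 0"
    using ops.dependent_finite[of "component_op ` cover_components"] fin by auto
  then obtain C where C: "C \<in> cover_components" "T = component_op C" by blast
  have "(\<Sum>D\<in>cover_components. cscale (u (component_op D)) (component_op D f)) = 0" for f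
    using fun_cong[OF u(3), of f] by (simp add: sum.reindex[OF component_op_inj] op_sum_apply op_scale_def)
  from component_op_combination_zero[of "\<lambda>D. u (component_op D)", OF this C(1)]
  show False using u C by simp
qed

end

section \<open>Operators commuting with the multiplication operator and its adjoint\<close>

lemma AE_disk_area_open:
  assumes AE: "AE z in disk_area. z \<notin> G" and G: "open G" "G \<subseteq> ball 0 1"
  shows "G = {}"
proof (rule ccontr)
  assume "G \<noteq> {}"
  then obtain z where "z \<in> G" by blast
  then obtain r where r: "r > 0" "ball z r \<subseteq> G" using G(1) openE by blast
  have "(\<integral>\<^sup>+x. indicator (ball z r) x \<partial>disk_area) = (\<integral>\<^sup>+x. 0 \<partial>disk_area)"
    by (rule nn_integral_cong_AE) (use AE r(2) in \<open>auto elim!: eventually_mono simp: indicator_def\<close>)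
  then have "(\<integral>\<^sup>+x\<in>ball 0 1. indicator (ball z r) x \<partial>lborel) / ennreal (measure lborel (ball (0::complex) 1)) = 0"
    by (subst (asm) nn_integral_disk_area) (auto intro!: borel_measurable_indicator)
  then have "(\<integral>\<^sup>+x\<in>ball 0 1. indicator (ball z r) x \<partial>lborel) = 0"
    using ennreal_divide_eq_0_iff by auto
  moreover have "(\<integral>\<^sup>+x\<in>ball 0 1. indicator (ball z r) x \<partial>lborel) = (\<integral>\<^sup>+x. indicator (ball z r) x \<partial>lborel)"
  proof (rule nn_integral_cong)
    fix x
    show "indicator (ball z r) x * indicator (ball 0 1) x = (indicator (ball z r) x :: ennreal)"
    proof (cases "x \<in> ball z r")
      case True
      then have "x \<in> ball 0 1" using r(2) G(2) by blast
      then show ?thesis by (simp only: indicator_simps mult_1_right)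
    qed simp
  qed
  ultimately have "emeasure lborel (ball z r) = 0" by simp
  then have "measure lborel (ball z r) = 0" by (simp add: measure_def)
  then show False using content_ball_pos[OF r(1), of z] by simp
qed

text \<open>\<open>f + g\<close> and \<open>\<i> * (f - g)\<close> are real valued, hence constant
  by the open mapping theorem, and \<open>f\<close> is a combination of the two.\<close>

lemma holomorphic_eq_cnj_constant:
  assumes f: "f holomorphic_on S" and g: "g holomorphic_on S" and S: "open S" "connected S"
    and eq: "\<And>z. z \<in> S \<Longrightarrow> f z = cnj (g z)"
  shows "f constant_on S"
proof -
  have real_const: "h constant_on S" if h: "h holomorphic_on S" "\<And>z. z \<in> S \<Longrightarrow> Im (h z) = 0" for h
  proof (rule ccontr)
    assume nc: "\<not> h constant_on S"
    then have "open (h ` S)" using open_mapping_thm[OF h(1) S S(1) subset_refl] by blast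
    moreover have "S \<noteq> {}" using nc by (auto simp: constant_on_def)
    ultimately obtain x e where e: "x \<in> S" "e > 0" "ball (h x) e \<subseteq> h ` S" by (metis ex_in_conv imageI openE)
    have "h x + \<i> * (e / 2) \<in> ball (h x) e" using e(2) by (simp add: dist_norm norm_mult)
    then obtain y where "y \<in> S" "h x + \<i> * (e / 2) = h y" using e(3) by blast
    then have "Im (h x + \<i> * (e / 2)) = 0" using h(2) by simp
    then show False using h(2)[OF e(1)] e(2) by simp
  qed
  have 1: "(\<lambda>z. f z + g z) constant_on S"
    by (rule real_const) (auto intro!: holomorphic_intros f g simp: eq)
  have 2: "(\<lambda>z. \<i> * (f z - g z)) constant_on S"
    by (rule real_const) (auto intro!: holomorphic_intros f g simp: eq)
  obtain a b where ab: "\<And>z. z \<in> S \<Longrightarrow> f z + g z = a" "\<And>z. z \<in> S \<Longrightarrow> \<i> * (f z - g z) = b"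
    using 1 2 unfolding constant_on_def by blast
  have "f z = (a - \<i> * b) / 2" if "z \<in> S" for z
    unfolding ab(1)[OF that, symmetric] ab(2)[OF that, symmetric] by (simp add: algebra_simps)
  then show ?thesis unfolding constant_on_def by blast
qed

context proper_disk_map
begin

context
  fixes T :: "bergman \<Rightarrow> bergman"
  assumes T: "T \<in> blaschke_algebra \<phi>"
begin

lemma blaschke_algebra_bounded: "T \<in> bounded_ops"
  and blaschke_algebra_mult: "T (mult_op \<phi> f) = mult_op \<phi> (T f)"
  and blaschke_algebra_adj_mult: "adj T (mult_op \<phi> f) = mult_op \<phi> (adj T f)"
  and blaschke_algebra_adj: "adj T \<in> blaschke_algebra \<phi>"
proof -
  note a = adj_bounded_ops[OF mult_bounded]
  have c: "T \<in> commutant {mult_op \<phi>}" "T \<in> commutant {adj (mult_op \<phi>)}"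
    using T by (auto simp: blaschke_algebra_def)
  show "T \<in> bounded_ops" "T (mult_op \<phi> f) = mult_op \<phi> (T f)"
    using c by (auto simp: commutant_def fun_eq_iff)
  have c': "adj T \<in> commutant {mult_op \<phi>}" "adj T \<in> commutant {adj (mult_op \<phi>)}"
    using commutant_adj[OF a c(2)] commutant_adj[OF mult_bounded c(1)] by (simp_all add: adj_adj[OF mult_bounded])
  then show "adj T (mult_op \<phi> f) = mult_op \<phi> (adj T f)" "adj T \<in> blaschke_algebra \<phi>"
    by (auto simp: commutant_def fun_eq_iff blaschke_algebra_def)
qed

definition defect :: "bergman \<Rightarrow> bergman \<Rightarrow> complex \<Rightarrow> complex" where
  "defect f g z = bergman_fun (T f) z * cnj (bergman_fun g z) - bergman_fun f z * cnj (bergman_fun (adj T g) z)"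

lemma defect_integrable: "integrable disk_area (defect f g)"
  unfolding defect_def by (intro Bochner_Integration.integrable_diff integrable_bergman_cinner)

lemma defect_outside: "z \<notin> ball 0 1 \<Longrightarrow> defect f g z = 0"
  by (simp add: defect_def bergman_fun_outside)

text \<open>Commutation absorbs \<open>\<phi>\<close> into \<open>f\<close> and its conjugate into
  \<open>g\<close>; iteration reaches all polynomials in \<open>\<phi>\<close> and its
  conjugate.\<close>

lemma defect_mult: "\<phi> z * defect f g z = defect (mult_op \<phi> f) g z"
  and defect_mult_cnj: "cnj (\<phi> z) * defect f g z = defect f (mult_op \<phi> g) z"
  by (simp_all add: defect_def blaschke_algebra_mult blaschke_algebra_adj_mult algebra_simps)

lemma compose_phi_integrable:
  fixes u :: "complex \<Rightarrow> complex"
  assumes u: "continuous_on (cball 0 1) u"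
  shows "integrable disk_area (\<lambda>z. u (\<phi> z) * defect f g z)"
proof -
  have "compact (u ` cball 0 1)" using u by (rule compact_continuous_image) simp
  then obtain B where "\<forall>y\<in>u ` cball 0 1. cmod y \<le> B"
    using compact_imp_bounded[of "u ` cball 0 1"] unfolding bounded_iff by blast
  then have B: "\<And>x. x \<in> cball 0 1 \<Longrightarrow> cmod (u x) \<le> B" by blast
  define k where "k = (\<lambda>z. if z \<in> ball 0 1 then u (\<phi> z) else 0)"
  have "continuous_on (ball 0 1) (\<lambda>z. u (\<phi> z))"
  proof (rule continuous_on_compose2[OF u holomorphic_on_imp_continuous_on[OF holo]])
    show "\<phi> ` ball 0 1 \<subseteq> cball 0 1" using less_one by (force simp: less_imp_le)
  qed
  then have [measurable]: "k \<in> borel_measurable borel"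
    unfolding k_def by (intro borel_measurable_continuous_on_if) auto
  have [measurable]: "defect f g \<in> borel_measurable borel"
    using borel_measurable_integrable[OF defect_integrable] by simp
  have eq: "(\<lambda>z. u (\<phi> z) * defect f g z) = (\<lambda>z. k z * defect f g z)"
    by (auto simp: k_def defect_outside)
  have kB: "cmod (k z) \<le> \<bar>B\<bar>" for z
    using B[of "\<phi> z"] less_one[of z] by (auto simp: k_def less_imp_le intro: order_trans)
  show ?thesis unfolding eq
  proof (rule Bochner_Integration.integrable_bound)
    show "integrable disk_area (\<lambda>z. \<bar>B\<bar> * cmod (defect f g z))"
      by (intro integrable_mult_right integrable_norm defect_integrable)
    show "(\<lambda>z. k z * defect f g z) \<in> borel_measurable disk_area"
      by (simp only: measurable_disk_area) measurable
    show "AE z in disk_area. norm (k z * defect f g z) \<le> norm (\<bar>B\<bar> * cmod (defect f g z))"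
      using kB by (intro AE_I2) (simp add: norm_mult mult_right_mono)
  qed
qed

text \<open>Quantified over all \<open>f\<close> and \<open>g\<close>, because multiplication of
  \<open>u\<close> by the variable or by its conjugate replaces \<open>f\<close> or
  \<open>g\<close>.\<close>

definition annihilating :: "(complex \<Rightarrow> complex) \<Rightarrow> bool" where
  "annihilating u \<longleftrightarrow> continuous_on (cball 0 1) u \<and>
     (\<forall>f g. (LINT z|disk_area. u (\<phi> z) * defect f g z) = 0)"

lemma annihilating_one: "annihilating (\<lambda>_. 1)"
proof -
  have "(LINT z|disk_area. defect f g z) = cinner (T f) g - cinner f (adj T g)" for f g
    unfolding defect_def cinner_def
    by (rule Bochner_Integration.integral_diff[OF integrable_bergman_cinner integrable_bergman_cinner])
  then show ?thesis by (simp add: annihilating_def cinner_adj[OF blaschke_algebra_bounded])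
qed

lemma annihilating_add:
  assumes "annihilating u" "annihilating v"
  shows "annihilating (\<lambda>x. u x + v x)"
  using assms compose_phi_integrable
  by (auto simp: annihilating_def distrib_right intro!: continuous_intros)

lemma annihilating_cmult:
  assumes "annihilating u" shows "annihilating (\<lambda>x. c * u x)"
  using assms by (auto simp: annihilating_def mult.assoc intro!: continuous_intros)

lemma annihilating_id:
  assumes "annihilating u" shows "annihilating (\<lambda>x. x * u x)"
proof -
  have "\<phi> z * u (\<phi> z) * defect f g z = u (\<phi> z) * defect (mult_op \<phi> f) g z" for f g z
    by (simp add: defect_mult[symmetric])
  then show ?thesis unfolding annihilating_def
    using assms by (simp only:) (auto simp: annihilating_def intro!: continuous_intros)
qed

lemma annihilating_cnj:
  assumes "annihilating u" shows "annihilating (\<lambda>x. cnj x * u x)"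
proof -
  have "cnj (\<phi> z) * u (\<phi> z) * defect f g z = u (\<phi> z) * defect f (mult_op \<phi> g) z" for f g z
    by (simp add: defect_mult_cnj[symmetric])
  then show ?thesis unfolding annihilating_def
    using assms by (simp only:) (auto simp: annihilating_def intro!: continuous_intros)
qed

text \<open>Real valued, as Stone-Weierstrass is applied to a real algebra, and phrased through
  multiplication so that closure under products is immediate. Since the constant 1 is annihilating,
  every multiplier is.\<close>

definition multiplier :: "(complex \<Rightarrow> real) \<Rightarrow> bool" where
  "multiplier u \<longleftrightarrow> continuous_on (cball 0 1) u \<and>
     (\<forall>v. annihilating v \<longrightarrow> annihilating (\<lambda>x. complex_of_real (u x) * v x))"

lemma multiplier_Re: "multiplier Re" and multiplier_Im: "multiplier Im"
proof -
  show "multiplier Re" unfolding multiplier_def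
  proof (intro conjI allI impI)
    fix v assume v: "annihilating v"
    have "(\<lambda>x. complex_of_real (Re x) * v x) = (\<lambda>x. (1/2) * (x * v x + cnj x * v x))"
      by (auto simp: fun_eq_iff complex_eq_iff)
    then show "annihilating (\<lambda>x. complex_of_real (Re x) * v x)"
      using annihilating_cmult[OF annihilating_add[OF annihilating_id[OF v] annihilating_cnj[OF v]], of "1/2"] by simp
  qed (intro continuous_intros)
  show "multiplier Im" unfolding multiplier_def
  proof (intro conjI allI impI)
    fix v assume v: "annihilating v"
    have "(\<lambda>x. complex_of_real (Im x) * v x) = (\<lambda>x. (-\<i>/2) * (x * v x + (-1) * (cnj x * v x)))"
      by (auto simp: fun_eq_iff complex_eq_iff)
    then show "annihilating (\<lambda>x. complex_of_real (Im x) * v x)"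
      using annihilating_cmult[OF annihilating_add[OF annihilating_id[OF v]
          annihilating_cmult[OF annihilating_cnj[OF v], of "-1"]], of "-\<i>/2"] by simp
  qed (intro continuous_intros)
qed

lemma defect_continuous_symbol:
  fixes u :: "complex \<Rightarrow> real"
  assumes u: "continuous_on (cball 0 1) u"
  shows "(LINT z|disk_area. complex_of_real (u (\<phi> z)) * defect f g z) = 0"
proof -
  have approx: "\<exists>p. multiplier p \<and> (\<forall>x\<in>cball 0 1. \<bar>u x - p x\<bar> < e)" if e: "e > 0" for e
  proof (rule Stone_Weierstrass_HOL[OF compact_cball _ _ _ _ _ u e])
    show "multiplier (\<lambda>x. c)" for c by (simp add: multiplier_def annihilating_cmult)
    show "continuous_on (cball 0 1) p" if "multiplier p" for p using that by (simp add: multiplier_def)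
    show "multiplier (\<lambda>x. p x + q x)" if "multiplier p \<and> multiplier q" for p q
      using that annihilating_add by (auto simp: multiplier_def distrib_right intro!: continuous_intros)
    show "multiplier (\<lambda>x. p x * q x)" if "multiplier p \<and> multiplier q" for p q
      using that by (auto simp: multiplier_def mult.assoc intro!: continuous_intros)
    show "\<exists>p. multiplier p \<and> p x \<noteq> p y" if "x \<in> cball 0 1 \<and> y \<in> cball 0 1 \<and> x \<noteq> y" for x y
      using that multiplier_Re multiplier_Im complex_eqI by blast
  qed
  \<comment> \<open>Total mass of the defect; the \<open>+ 1\<close> in the tolerance
    \<open>e / (D + 1)\<close> avoids division by 0.\<close>
  define D where "D = (LINT z|disk_area. cmod (defect f g z))"
  have D0: "D \<ge> 0" unfolding D_def by simp
  have cu: "continuous_on (cball 0 1) (\<lambda>x. complex_of_real (u x))" using u by (intro continuous_intros)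
  have "cmod (LINT z|disk_area. complex_of_real (u (\<phi> z)) * defect f g z) \<le> e" if e: "e > 0" for e
  proof -
    have "e / (D + 1) > 0" using e D0 by simp
    then obtain p where p: "multiplier p" "\<And>x. x \<in> cball 0 1 \<Longrightarrow> \<bar>u x - p x\<bar> < e / (D + 1)"
      using approx by blast
    have cp: "continuous_on (cball 0 1) (\<lambda>x. complex_of_real (p x))"
      using p(1) by (auto simp: multiplier_def intro!: continuous_intros)
    have "annihilating (\<lambda>x. complex_of_real (p x))"
      using p(1) annihilating_one unfolding multiplier_def by force
    then have "(LINT z|disk_area. complex_of_real (u (\<phi> z)) * defect f g z)
      = (LINT z|disk_area. complex_of_real (u (\<phi> z)) * defect f g z) - (LINT z|disk_area. complex_of_real (p (\<phi> z)) * defect f g z)"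
      by (simp add: annihilating_def)
    also have "\<dots> = (LINT z|disk_area. complex_of_real (u (\<phi> z)) * defect f g z - complex_of_real (p (\<phi> z)) * defect f g z)"
      by (rule Bochner_Integration.integral_diff[symmetric]) (rule compose_phi_integrable cu cp)+
    also have "cmod \<dots> \<le> (LINT z|disk_area. e / (D + 1) * cmod (defect f g z))"
    proof (rule order_trans[OF integral_norm_bound integral_mono])
      show "integrable disk_area (\<lambda>z. cmod (complex_of_real (u (\<phi> z)) * defect f g z - complex_of_real (p (\<phi> z)) * defect f g z))"
        by (intro integrable_norm Bochner_Integration.integrable_diff compose_phi_integrable[of "\<lambda>x. complex_of_real (u x)"]
            compose_phi_integrable[of "\<lambda>x. complex_of_real (p x)"] cu cp)
      show "integrable disk_area (\<lambda>z. e / (D + 1) * cmod (defect f g z))"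
        by (intro integrable_mult_right integrable_norm defect_integrable)
      fix z
      show "norm (complex_of_real (u (\<phi> z)) * defect f g z - complex_of_real (p (\<phi> z)) * defect f g z) \<le> e / (D + 1) * cmod (defect f g z)"
      proof (cases "z \<in> ball 0 1")
        case True
        have "\<bar>u (\<phi> z) - p (\<phi> z)\<bar> \<le> e / (D + 1)" using p(2)[of "\<phi> z"] less_one[OF True] by (simp add: less_imp_le)
        then show ?thesis
          using mult_right_mono[OF _ norm_ge_zero, of "\<bar>u (\<phi> z) - p (\<phi> z)\<bar>" "e / (D + 1)" "defect f g z"]
          by (simp add: left_diff_distrib[symmetric] norm_mult of_real_diff[symmetric] del: of_real_diff)
      qed (simp add: defect_outside)
    qed
    also have "\<dots> = e / (D + 1) * D" by (simp add: D_def)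
    also have "\<dots> \<le> e" using e D0 by (simp add: field_simps)
    finally show ?thesis .
  qed
  then have "cmod (LINT z|disk_area. complex_of_real (u (\<phi> z)) * defect f g z) \<le> 0"
    using dense_ge[of 0] by (metis)
  then show ?thesis by simp
qed

lemma defect_continuous: "continuous_on (ball 0 1) (defect f g)"
  unfolding defect_def
  by (intro continuous_intros holomorphic_on_imp_continuous_on bergman_fun_holomorphic)

text \<open>The push-forward of the defect measure under \<open>\<phi>\<close> vanishes, so its continuous density does.\<close>

lemma defect_fibre_sum:
  assumes v0: "v0 \<in> regular_values"
  shows "(\<Sum>z\<in>fibre v0. defect f g z / (cmod (deriv \<phi> z))\<^sup>2) = 0"
proof (rule ccontr)
  define H where "H = (\<lambda>v. \<Sum>z\<in>fibre v. defect f g z / (cmod (deriv \<phi> z))\<^sup>2)"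
  assume "\<not> ?thesis"
  then have H0: "H v0 \<noteq> 0" by (simp add: H_def)
  \<comment> \<open>Turns the supposedly nonzero \<open>H v0\<close> into a positive real number;
    \<open>\<epsilon>\<close> is half of it, so by continuity the real part stays above
    \<open>\<epsilon>\<close> near \<open>v0\<close>.\<close>
  define c where "c = cnj (H v0)"
  define \<epsilon> where "\<epsilon> = (cmod (H v0))\<^sup>2 / 2"
  have "c * H v0 = complex_of_real ((cmod (H v0))\<^sup>2)"
    unfolding complex_norm_square c_def by (rule mult.commute)
  then have \<epsilon>: "\<epsilon> > 0" "Re (c * H v0) > \<epsilon>"
    using H0 by (auto simp: \<epsilon>_def simp flip: of_real_power)
  obtain r \<sigma> where ec: "evenly_covered v0 r \<sigma>" using evenly_covered_exists[OF v0] by blast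
  have r: "r > 0" by (rule ec_pos[OF ec])
  have Hs: "H v = (\<Sum>w\<in>fibre v0. defect f g (\<sigma> w v) / (cmod (deriv \<phi> (\<sigma> w v)))\<^sup>2)" if "v \<in> ball v0 r" for v
    unfolding H_def using sum.reindex_bij_betw[OF ec_bij[OF ec that], of "\<lambda>z. defect f g z / (cmod (deriv \<phi> z))\<^sup>2"] by simp
  have "continuous_on (ball v0 r) (\<lambda>v. \<Sum>w\<in>fibre v0. defect f g (\<sigma> w v) / (cmod (deriv \<phi> (\<sigma> w v)))\<^sup>2)"
  proof (rule continuous_on_sum)
    fix w assume w: "w \<in> fibre v0"
    have s: "continuous_on (ball v0 r) (\<sigma> w)" using ec_hol[OF ec w] holomorphic_on_imp_continuous_on by blast
    have im: "\<sigma> w ` ball v0 r \<subseteq> ball 0 1" using ec_ball[OF ec _ w] by blast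
    have 1: "continuous_on (ball v0 r) (\<lambda>v. defect f g (\<sigma> w v))"
      by (rule continuous_on_compose2[OF defect_continuous s im])
    have 2: "continuous_on (ball v0 r) (\<lambda>v. deriv \<phi> (\<sigma> w v))"
      by (rule continuous_on_compose2[OF holomorphic_on_imp_continuous_on[OF holomorphic_deriv[OF holo open_ball]] s im])
    have 3: "deriv \<phi> (\<sigma> w v) \<noteq> 0" if "v \<in> ball v0 r" for v
      using deriv_nonzero[OF regular_fibre[OF ec_regular[OF ec that] ec_fibre[OF ec that w]]] .
    show "continuous_on (ball v0 r) (\<lambda>v. defect f g (\<sigma> w v) / (cmod (deriv \<phi> (\<sigma> w v)))\<^sup>2)"
      using 3 by (intro continuous_intros 1 2) auto
  qed
  then have "continuous_on (ball v0 r) H"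
    by (rule continuous_on_eq) (simp add: Hs)
  then have "continuous_on (ball v0 r) (\<lambda>v. Re (c * H v))" by (intro continuous_intros)
  then have "isCont (\<lambda>v. Re (c * H v)) v0" using r continuous_on_interior by fastforce
  then have "\<forall>\<^sub>F v in at v0. Re (c * H v) > \<epsilon>"
    using order_tendstoD(1)[OF _ \<epsilon>(2), of "\<lambda>v. Re (c * H v)"] unfolding isCont_def by blast
  then obtain d0 where "d0 > 0" "\<And>v. v \<noteq> v0 \<Longrightarrow> dist v v0 < d0 \<Longrightarrow> Re (c * H v) > \<epsilon>"
    unfolding eventually_at by blast
  then have d0: "d0 > 0" "\<And>v. dist v v0 < d0 \<Longrightarrow> Re (c * H v) > \<epsilon>" using \<epsilon>(2) by metis+
  define d where "d = min d0 r"
  have d: "d > 0" "d \<le> r" using d0 r by (auto simp: d_def)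
  \<comment> \<open>A tent function around \<open>v0\<close> that vanishes from distance
    \<open>d\<close> on; it is continuous, so \<open>defect_continuous_symbol\<close> applies to
    it.\<close>
  define u where "u = (\<lambda>v. max 0 (d - dist v v0))"
  have u0: "u v \<ge> 0" for v by (simp add: u_def)
  have ucont: "continuous_on S u" for S unfolding u_def by (intro continuous_intros)
  have cu: "continuous_on (cball 0 1) (\<lambda>x. complex_of_real (u x))" by (intro continuous_intros ucont)
  define h1 where "h1 = (\<lambda>z. Re (c * (complex_of_real (u (\<phi> z)) * defect f g z)))"
  \<comment> \<open>A nonnegative comparison function. The \<open>min\<close> offsets the weight
    \<open>1 / (cmod (deriv \<phi> z))\<^sup>2\<close> while keeping \<open>h2\<close> bounded, and
    the division by \<open>N\<close> offsets the number of fibre points. So its fibre sums are at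
    most \<open>\<epsilon> * u v\<close>, hence at most those of \<open>h1\<close>, whose integral
    is 0.\<close>
  define h2 where "h2 = (\<lambda>z. if z \<in> ball 0 1 then \<epsilon> / N * (u (\<phi> z) * min 1 ((cmod (deriv \<phi> z))\<^sup>2)) else 0)"
  have fne: "fibre v0 \<noteq> {}" using H0 by (auto simp: H_def)
  then have "card (fibre v0) > 0" by (simp add: card_gt_0_iff)
  then have N: "real N > 0" using card_fib[of v0] by linarith
  have "integrable disk_area (\<lambda>z. c * (complex_of_real (u (\<phi> z)) * defect f g z))"
    by (intro integrable_mult_right compose_phi_integrable[of "\<lambda>x. complex_of_real (u x)"] cu)
  then have i1: "integrable disk_area h1" unfolding h1_def by (rule integrable_Re)
  have "(LINT z|disk_area. h1 z) = Re (LINT z|disk_area. c * (complex_of_real (u (\<phi> z)) * defect f g z))"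
    unfolding h1_def by (rule integral_Re) fact
  also have "\<dots> = 0" using defect_continuous_symbol[OF ucont] by simp
  finally have I1: "(LINT z|disk_area. h1 z) = 0" .
  have h2c: "continuous_on (ball 0 1) (\<lambda>z. \<epsilon> / N * (u (\<phi> z) * min 1 ((cmod (deriv \<phi> z))\<^sup>2)))"
    by (intro continuous_intros continuous_on_compose2[OF ucont] holomorphic_on_imp_continuous_on
        holomorphic_deriv holo) auto
  have h2m: "h2 \<in> borel_measurable borel"
    unfolding h2_def by (intro borel_measurable_continuous_on_if h2c) auto
  have h20: "h2 z \<ge> 0" for z using \<epsilon> N u0 by (simp add: h2_def)
  have h2b: "h2 z \<le> \<epsilon> / N * d" for z
  proof (cases "z \<in> ball 0 1")
    case True
    have "u (\<phi> z) * min 1 ((cmod (deriv \<phi> z))\<^sup>2) \<le> d * 1"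
      using d by (intro mult_mono) (auto simp: u_def)
    then have "\<epsilon> / N * (u (\<phi> z) * min 1 ((cmod (deriv \<phi> z))\<^sup>2)) \<le> \<epsilon> / N * (d * 1)"
      using \<epsilon> N by (intro mult_left_mono) auto
    then show ?thesis using True by (simp add: h2_def)
  next
    case False
    then show ?thesis using \<epsilon> N d by (simp add: h2_def)
  qed
  have i2: "integrable disk_area h2"
  proof (rule Bochner_Integration.integrable_bound)
    show "integrable disk_area (\<lambda>_. \<epsilon> / N * d)" using finite_measure_disk_area by (simp add: finite_measure.integrable_const finite_measureI)
    show "h2 \<in> borel_measurable disk_area" using h2m by simp
    show "AE z in disk_area. norm (h2 z) \<le> norm (\<epsilon> / N * d)" using h20 h2b \<epsilon> N d by (intro AE_I2) (simp add: abs_of_nonneg)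
  qed
  have "(LINT z|disk_area. h2 z) \<le> (LINT z|disk_area. h1 z)"
  proof (rule integral_fibre_mono[OF i2 i1])
    fix v assume v: "v \<in> regular_values"
    have nz: "deriv \<phi> z \<noteq> 0" if "z \<in> fibre v" for z using deriv_nonzero regular_fibre[OF v that] by blast
    have "(\<Sum>z\<in>fibre v. h2 z / (cmod (deriv \<phi> z))\<^sup>2) \<le> (\<Sum>z\<in>fibre v. \<epsilon> / N * u v)"
    proof (rule sum_mono)
      fix z assume z: "z \<in> fibre v"
      have "min 1 ((cmod (deriv \<phi> z))\<^sup>2) / (cmod (deriv \<phi> z))\<^sup>2 \<le> 1" using nz[OF z] by (simp add: divide_le_eq_1)
      then have "\<epsilon> / N * u v * (min 1 ((cmod (deriv \<phi> z))\<^sup>2) / (cmod (deriv \<phi> z))\<^sup>2) \<le> \<epsilon> / N * u v * 1"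
        using \<epsilon> N u0 by (intro mult_left_mono) auto
      then show "h2 z / (cmod (deriv \<phi> z))\<^sup>2 \<le> \<epsilon> / N * u v"
        using fibreD[OF z] by (simp add: h2_def)
    qed
    also have "\<dots> = real (card (fibre v)) * (\<epsilon> / N * u v)" by simp
    also have "\<dots> \<le> real N * (\<epsilon> / N * u v)"
      using card_fib[of v] \<epsilon> N u0 by (intro mult_right_mono) auto
    also have "\<dots> = \<epsilon> * u v" using N by simp
    also have "\<dots> \<le> Re (c * H v) * u v"
    proof (cases "dist v v0 < d")
      case True
      then show ?thesis using d0(2)[of v] u0[of v] by (intro mult_right_mono) (auto simp: d_def)
    qed (simp add: u_def)
    also have "\<dots> = Re (c * complex_of_real (u v) * H v)" by (simp add: algebra_simps)
    also have "c * complex_of_real (u v) * H v = (\<Sum>z\<in>fibre v. c * (complex_of_real (u (\<phi> z)) * defect f g z) / (cmod (deriv \<phi> z))\<^sup>2)"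
      unfolding H_def sum_distrib_left by (intro sum.cong refl) (simp add: fibreD)
    also have "Re \<dots> = (\<Sum>z\<in>fibre v. h1 z / (cmod (deriv \<phi> z))\<^sup>2)"
      unfolding h1_def Re_sum by (simp flip: of_real_power)
    finally show "(\<Sum>z\<in>fibre v. h2 z / (cmod (deriv \<phi> z))\<^sup>2) \<le> (\<Sum>z\<in>fibre v. h1 z / (cmod (deriv \<phi> z))\<^sup>2)" .
  qed
  then have "(LINT z|disk_area. h2 z) = 0"
    unfolding I1 using Bochner_Integration.integral_nonneg[of disk_area h2, OF h20] by (rule antisym)
  then have "AE z in disk_area. h2 z = 0"
    using integral_nonneg_eq_0_iff_AE[OF i2] h20 by simp
  \<comment> \<open>A nonempty open set on which \<open>h2\<close> is positive, which is
    incompatible with \<open>h2\<close> vanishing almost everywhere.\<close>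
  moreover define G where "G = {z \<in> regular_set \<phi>. dist (\<phi> z) v0 < d}"
  ultimately have "AE z in disk_area. z \<notin> G"
  proof (elim eventually_mono)
    fix z assume h2z: "h2 z = 0"
    show "z \<notin> G"
    proof
      assume "z \<in> G"
      then have "z \<in> regular_set \<phi>" "u (\<phi> z) > 0" by (auto simp: G_def u_def)
      then have "h2 z > 0" using \<epsilon> N deriv_nonzero[of z] regular_ball[of z] by (simp add: h2_def)
      then show False using h2z by simp
    qed
  qed
  moreover have "open G"
  proof -
    have "continuous_on (regular_set \<phi>) (\<lambda>z. dist (\<phi> z) v0)"
      by (intro continuous_intros continuous_on_subset[OF holomorphic_on_imp_continuous_on[OF holo]] subsetI
          regular_ball)
    then have "open (regular_set \<phi> \<inter> (\<lambda>z. dist (\<phi> z) v0) -` {..<d})"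
      using continuous_open_preimage[OF _ open_regular open_lessThan] by blast
    also have "regular_set \<phi> \<inter> (\<lambda>z. dist (\<phi> z) v0) -` {..<d} = G" by (auto simp: G_def)
    finally show ?thesis .
  qed
  moreover have "G \<subseteq> ball 0 1" unfolding G_def using regular_ball by blast
  ultimately have "G = {}" by (rule AE_disk_area_open)
  obtain w where w: "w \<in> fibre v0" using fne by blast
  then have "w \<in> G" using regular_fibre[OF v0 w] d fibreD[OF w] by (simp add: G_def)
  then show False using \<open>G = {}\<close> by simp
qed

end

section \<open>Coefficients of an operator in the algebra\<close>

definition interpolant :: "complex \<Rightarrow> complex \<Rightarrow> bergman \<Rightarrow> bool" where
  "interpolant v w p \<longleftrightarrow> (\<forall>z\<in>fibre v. bergman_fun p z = (if z = w then 1 else 0))"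

lemma interpolant_exists: "w \<in> fibre v \<Longrightarrow> \<exists>p. interpolant v w p"
  using interpolation by (simp add: interpolant_def)

text \<open>The vanishing defect sum at \<open>f\<close> and \<open>q\<close>: as \<open>q\<close>
  is 0 at all fibre points but \<open>z\<close>, one term of its first half remains. So the value of
  \<open>T f\<close> at \<open>z\<close> depends only on the values of \<open>f\<close> on the
  fibre.\<close>

lemma interpolant_pairing:
  assumes T: "T \<in> blaschke_algebra \<phi>" and v: "v \<in> regular_values"
    and z: "z \<in> fibre v" and q: "interpolant v z q"
  shows "bergman_fun (T f) z / (cmod (deriv \<phi> z))\<^sup>2
    = (\<Sum>x\<in>fibre v. bergman_fun f x * cnj (bergman_fun (adj T q) x) / (cmod (deriv \<phi> x))\<^sup>2)"
proof -
  have "0 = (\<Sum>x\<in>fibre v. defect T f q x / (cmod (deriv \<phi> x))\<^sup>2)"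
    using defect_fibre_sum[OF T v] by simp
  also have "\<dots> = (\<Sum>x\<in>fibre v. bergman_fun (T f) x * cnj (bergman_fun q x) / (cmod (deriv \<phi> x))\<^sup>2)
      - (\<Sum>x\<in>fibre v. bergman_fun f x * cnj (bergman_fun (adj T q) x) / (cmod (deriv \<phi> x))\<^sup>2)"
    by (simp add: defect_def[OF T] diff_divide_distrib sum_subtractf)
  also have "(\<Sum>x\<in>fibre v. bergman_fun (T f) x * cnj (bergman_fun q x) / (cmod (deriv \<phi> x))\<^sup>2)
      = (\<Sum>x\<in>fibre v. if x = z then bergman_fun (T f) z / (cmod (deriv \<phi> z))\<^sup>2 else 0)"
    using q by (intro sum.cong refl) (auto simp: interpolant_def)
  also have "\<dots> = bergman_fun (T f) z / (cmod (deriv \<phi> z))\<^sup>2" using z by simp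
  finally show ?thesis by simp
qed

lemma interpolant_adjoint:
  assumes T: "T \<in> blaschke_algebra \<phi>" and v: "v \<in> regular_values"
    and w: "w \<in> fibre v" and z: "z \<in> fibre v" and p: "interpolant v w p" and q: "interpolant v z q"
  shows "bergman_fun (T p) z / (cmod (deriv \<phi> z))\<^sup>2 = cnj (bergman_fun (adj T q) w) / (cmod (deriv \<phi> w))\<^sup>2"
proof -
  have "(\<Sum>x\<in>fibre v. bergman_fun p x * cnj (bergman_fun (adj T q) x) / (cmod (deriv \<phi> x))\<^sup>2)
     = (\<Sum>x\<in>fibre v. if x = w then cnj (bergman_fun (adj T q) w) / (cmod (deriv \<phi> w))\<^sup>2 else 0)"
    using p by (intro sum.cong refl) (auto simp: interpolant_def)
  then show ?thesis using interpolant_pairing[OF T v z q, of p] w by simp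
qed

text \<open>Normalised by the derivative of the local inverse, so that a component operator gets the
  coefficients 1 on its component and 0 elsewhere. The chosen interpolant is immaterial by
  \<open>coefficient_eq\<close>.\<close>

definition coefficient :: "(bergman \<Rightarrow> bergman) \<Rightarrow> complex \<Rightarrow> complex \<Rightarrow> complex" where
  "coefficient T w z = bergman_fun (T (SOME p. interpolant (\<phi> z) w p)) z * deriv \<phi> w / deriv \<phi> z"

text \<open>The right side of \<open>interpolant_adjoint\<close> does not mention \<open>p\<close>,
  so all interpolants at \<open>w\<close> give the same value of \<open>T p\<close> at
  \<open>z\<close>.\<close>

lemma coefficient_eq:
  assumes T: "T \<in> blaschke_algebra \<phi>" and v: "v \<in> regular_values"
    and w: "w \<in> fibre v" and z: "z \<in> fibre v" and p: "interpolant v w p"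
  shows "coefficient T w z = bergman_fun (T p) z * deriv \<phi> w / deriv \<phi> z"
proof -
  let ?p = "SOME p. interpolant (\<phi> z) w p"
  have "\<phi> z = v" using fibreD(2)[OF z] .
  then have p': "interpolant v w ?p" using someI[of "interpolant v w" p] p by simp
  obtain q where q: "interpolant v z q" using interpolant_exists[OF z] by blast
  have "deriv \<phi> z \<noteq> 0" using deriv_nonzero regular_fibre[OF v z] by blast
  moreover have "bergman_fun (T ?p) z / (cmod (deriv \<phi> z))\<^sup>2 = bergman_fun (T p) z / (cmod (deriv \<phi> z))\<^sup>2"
    using interpolant_adjoint[OF T v w z p q] interpolant_adjoint[OF T v w z p' q] by (rule trans[rotated, OF sym])
  ultimately have "bergman_fun (T ?p) z = bergman_fun (T p) z" by simp
  then show ?thesis by (simp add: coefficient_def)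
qed

text \<open>The two normalising quotients absorb exactly the squared moduli in
  \<open>interpolant_adjoint\<close>.\<close>

lemma coefficient_adjoint:
  assumes T: "T \<in> blaschke_algebra \<phi>" and v: "v \<in> regular_values"
    and w: "w \<in> fibre v" and z: "z \<in> fibre v"
  shows "coefficient T w z = cnj (coefficient (adj T) z w)"
proof -
  obtain p q where p: "interpolant v w p" and q: "interpolant v z q"
    using interpolant_exists w z by blast
  have nz: "deriv \<phi> z \<noteq> 0" "deriv \<phi> w \<noteq> 0" using deriv_nonzero regular_fibre[OF v] w z by blast+
  have "bergman_fun (T p) z = cnj (bergman_fun (adj T q) w) * (cmod (deriv \<phi> z))\<^sup>2 / (cmod (deriv \<phi> w))\<^sup>2"
    using interpolant_adjoint[OF T v w z p q] nz by (simp add: field_simps)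
  then show ?thesis
    unfolding coefficient_eq[OF T v w z p] coefficient_eq[OF blaschke_algebra_adj[OF T] v z w q]
    using nz by (simp add: complex_norm_square[unfolded of_real_power])
qed

lemma coefficient_expansion:
  assumes T: "T \<in> blaschke_algebra \<phi>" and z: "z \<in> regular_set \<phi>"
  shows "bergman_fun (T f) z = (\<Sum>w\<in>fibre (\<phi> z). coefficient T w z * (deriv \<phi> z / deriv \<phi> w * bergman_fun f w))"
proof -
  have v: "\<phi> z \<in> regular_values" "z \<in> fibre (\<phi> z)" using z by (auto simp: regular_iff fibre_def)
  obtain q where q: "interpolant (\<phi> z) z q" using interpolant_exists[OF v(2)] by blast
  have nz: "deriv \<phi> w \<noteq> 0" if "w \<in> fibre (\<phi> z)" for w using deriv_nonzero regular_fibre[OF v(1) that] by blast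
  have "bergman_fun (T f) z = (\<Sum>x\<in>fibre (\<phi> z). bergman_fun f x * cnj (bergman_fun (adj T q) x) / (cmod (deriv \<phi> x))\<^sup>2) * (cmod (deriv \<phi> z))\<^sup>2"
    using interpolant_pairing[OF T v(1) v(2) q, of f] nz[OF v(2)] by (simp add: field_simps)
  also have "\<dots> = (\<Sum>w\<in>fibre (\<phi> z). coefficient T w z * (deriv \<phi> z / deriv \<phi> w * bergman_fun f w))"
    unfolding sum_distrib_right
  proof (rule sum.cong[OF refl])
    fix w assume w: "w \<in> fibre (\<phi> z)"
    obtain p where p: "interpolant (\<phi> z) w p" using interpolant_exists[OF w] by blast
    show "bergman_fun f w * cnj (bergman_fun (adj T q) w) / (cmod (deriv \<phi> w))\<^sup>2 * (cmod (deriv \<phi> z))\<^sup>2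
      = coefficient T w z * (deriv \<phi> z / deriv \<phi> w * bergman_fun f w)"
      using interpolant_adjoint[OF T v(1) w v(2) p q] nz[OF w] nz[OF v(2)]
      unfolding coefficient_eq[OF T v(1) w v(2) p] by (simp add: field_simps)
  qed
  finally show ?thesis .
qed

text \<open>Split off one root a: \<open>U\<close> applied to (\<zeta> - a) P is \<open>U\<close>
  after multiplication by \<zeta>, applied to P, minus a times \<open>U\<close> applied to P. These
  operators do not depend on \<open>v\<close>, so the root contributes only the holomorphic factor
  \<open>\<sigma> x v\<close>; the induction has to run over all \<open>U\<close> at once.\<close>

lemma nodal_holomorphic:
  assumes ec: "evenly_covered v0 r \<sigma>" and ws: "set ws \<subseteq> fibre v0" and z: "z \<in> fibre v0"
    and U: "U \<in> bounded_ops"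
  shows "(\<lambda>v. bergman_fun (U (nodal (map (\<lambda>x. \<sigma> x v) ws))) (\<sigma> z v)) holomorphic_on ball v0 r"
  using ws U
proof (induction ws arbitrary: U)
  case Nil
  have "\<sigma> z ` ball v0 r \<subseteq> ball 0 1" using ec_ball[OF ec _ z] by blast
  from holomorphic_on_compose_gen[OF ec_hol[OF ec z] bergman_fun_holomorphic this]
  show ?case by (simp add: comp_def)
next
  case (Cons x ws)
  have b: "U \<circ> mult_op (\<lambda>\<zeta>. \<zeta>) \<in> bounded_ops"
    using comp_bounded_ops[OF Cons.prems(2) coordinate_mult(2)] .
  have eq: "bergman_fun (U (nodal (map (\<lambda>x. \<sigma> x v) (x # ws)))) (\<sigma> z v)
    = bergman_fun ((U \<circ> mult_op (\<lambda>\<zeta>. \<zeta>)) (nodal (map (\<lambda>x. \<sigma> x v) ws))) (\<sigma> z v)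
      - \<sigma> x v * bergman_fun (U (nodal (map (\<lambda>x. \<sigma> x v) ws))) (\<sigma> z v)" for v
    by (simp add: bounded_ops_diff[OF Cons.prems(2)] bounded_ops_cscale[OF Cons.prems(2)] bergman_fun_diff)
  show ?case unfolding eq
    using Cons.prems by (intro holomorphic_on_diff holomorphic_on_mult Cons.IH b ec_hol[OF ec]) auto
qed

text \<open>The interpolant at \<open>\<sigma> w v\<close> is taken as the nodal polynomial with its
  roots on the other sheets, divided by its value there. Any interpolant computes the coefficient,
  and with this one every ingredient is holomorphic in \<open>v\<close>.\<close>

lemma coefficient_holomorphic:
  assumes T: "T \<in> blaschke_algebra \<phi>" and ec: "evenly_covered v0 r \<sigma>"
    and w: "w \<in> fibre v0" and z: "z \<in> fibre v0"
  shows "(\<lambda>v. coefficient T (\<sigma> w v) (\<sigma> z v)) holomorphic_on ball v0 r"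
proof -
  obtain ws where ws: "set ws = fibre v0 - {w}" using finite_list[of "fibre v0 - {w}"] by auto
  define P where "P = (\<lambda>v. nodal (map (\<lambda>x. \<sigma> x v) ws))"
  \<comment> \<open>The value of the nodal polynomial at \<open>\<sigma> w v\<close>; distinct
    sheets never meet, so it has no zero on the disk.\<close>
  define c where "c = (\<lambda>v. \<Prod>x\<leftarrow>ws. \<sigma> w v - \<sigma> x v)"
  have Pw: "bergman_fun (P v) (\<sigma> y v) = (\<Prod>x\<leftarrow>ws. \<sigma> y v - \<sigma> x v)"
    if "v \<in> ball v0 r" "y \<in> fibre v0" for v y
    unfolding P_def using nodal_fun[OF ec_ball[OF ec that]] by (simp add: comp_def)
  have zero_iff: "(\<Prod>x\<leftarrow>ws. \<sigma> y v - \<sigma> x v) = 0 \<longleftrightarrow> y \<noteq> w" if v: "v \<in> ball v0 r" and y: "y \<in> fibre v0" for v y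
  proof -
    have "(\<Prod>x\<leftarrow>ws. \<sigma> y v - \<sigma> x v) = 0 \<longleftrightarrow> (\<exists>x\<in>set ws. \<sigma> y v = \<sigma> x v)"
      by (induction ws) auto
    also have "\<dots> \<longleftrightarrow> (\<exists>x\<in>fibre v0 - {w}. y = x)"
      unfolding ws using ec_inj[OF ec v y] by blast
    also have "\<dots> \<longleftrightarrow> y \<noteq> w" using y by blast
    finally show ?thesis .
  qed
  have int: "interpolant v (\<sigma> w v) (cscale (1 / c v) (P v))" if v: "v \<in> ball v0 r" for v
    unfolding interpolant_def ec_image[OF ec v]
    using Pw[OF v] zero_iff[OF v] ec_inj[OF ec v _ w] w by (auto simp: c_def)
  have eq: "coefficient T (\<sigma> w v) (\<sigma> z v)
      = 1 / c v * bergman_fun (T (P v)) (\<sigma> z v) * deriv \<phi> (\<sigma> w v) / deriv \<phi> (\<sigma> z v)" if v: "v \<in> ball v0 r" for v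
    using coefficient_eq[OF T ec_regular[OF ec v] ec_fibre[OF ec v w] ec_fibre[OF ec v z] int[OF v]]
    by (simp add: bounded_ops_cscale[OF blaschke_algebra_bounded[OF T]])
  have chol: "c holomorphic_on ball v0 r"
  proof -
    have "(\<lambda>v. \<Prod>x\<leftarrow>xs. \<sigma> w v - \<sigma> x v) holomorphic_on ball v0 r" if "set xs \<subseteq> fibre v0" for xs
      using that by (induction xs) (auto intro!: holomorphic_intros ec_hol[OF ec] w)
    then show ?thesis unfolding c_def using ws by blast
  qed
  have dhol: "(\<lambda>v. deriv \<phi> (\<sigma> y v)) holomorphic_on ball v0 r" if y: "y \<in> fibre v0" for y
  proof -
    have "\<sigma> y ` ball v0 r \<subseteq> ball 0 1" using ec_ball[OF ec _ y] by blast
    from holomorphic_on_compose_gen[OF ec_hol[OF ec y] holomorphic_deriv[OF holo open_ball] this]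
    show ?thesis by (simp add: comp_def)
  qed
  have dnz: "deriv \<phi> (\<sigma> z v) \<noteq> 0" if "v \<in> ball v0 r" for v
    using deriv_nonzero[OF regular_fibre[OF ec_regular[OF ec that] ec_fibre[OF ec that z]]] .
  have cnz: "c v \<noteq> 0" if "v \<in> ball v0 r" for v using zero_iff[OF that w] by (simp add: c_def)
  have "(\<lambda>v. 1 / c v * bergman_fun (T (P v)) (\<sigma> z v) * deriv \<phi> (\<sigma> w v) / deriv \<phi> (\<sigma> z v)) holomorphic_on ball v0 r"
    unfolding P_def using dnz cnz ws
    by (intro holomorphic_on_divide holomorphic_on_mult holomorphic_on_const chol dhol w z
        nodal_holomorphic[OF ec _ z blaschke_algebra_bounded[OF T]]) auto
  then show ?thesis by (rule holomorphic_transform) (simp add: eq)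
qed

lemma coefficient_component_constant:
  assumes T: "T \<in> blaschke_algebra \<phi>" and C: "C \<in> cover_components"
  shows "(\<lambda>(w, z). coefficient T w z) constant_on C"
proof (rule locally_constant_imp_constant[OF in_components_connected[OF C]])
  fix x assume x: "x \<in> C"
  obtain w z where wz: "x = (w, z)" by force
  have "(w, z) \<in> unbranched_cover \<phi>" using x wz in_components_subset[OF C] by blast
  then have v: "\<phi> z \<in> regular_values" "w \<in> fibre (\<phi> z)" "z \<in> fibre (\<phi> z)" by (auto simp: cover_iff)
  obtain r \<sigma> where ec: "evenly_covered (\<phi> z) r \<sigma>" using evenly_covered_exists[OF v(1)] by blast
  let ?T = "(\<lambda>v. (\<sigma> w v, \<sigma> z v)) ` ball (\<phi> z) r"
  have c: "\<phi> z \<in> ball (\<phi> z) r" using ec_pos[OF ec] by simp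
  have cen: "\<sigma> w (\<phi> z) = w" "\<sigma> z (\<phi> z) = z" using ec_centre[OF ec] v by auto
  have xT: "x \<in> ?T" using c by (rule rev_image_eqI) (simp add: wz cen)
  have "?T \<subseteq> C" using component_section_iff[OF ec C v(2,3)] x wz by auto
  then have "openin (top_of_set C) ?T"
    using ec_openin[OF ec v(2,3)] in_components_subset[OF C] by (metis openin_subset_trans)
  moreover have "(\<lambda>v. coefficient T (\<sigma> w v) (\<sigma> z v)) constant_on ball (\<phi> z) r"
  proof (rule holomorphic_eq_cnj_constant)
    show "(\<lambda>v. coefficient T (\<sigma> w v) (\<sigma> z v)) holomorphic_on ball (\<phi> z) r"
      by (rule coefficient_holomorphic[OF T ec v(2,3)])
    show "(\<lambda>v. coefficient (adj T) (\<sigma> z v) (\<sigma> w v)) holomorphic_on ball (\<phi> z) r"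
      by (rule coefficient_holomorphic[OF blaschke_algebra_adj[OF T] ec v(3,2)])
    show "coefficient T (\<sigma> w y) (\<sigma> z y) = cnj (coefficient (adj T) (\<sigma> z y) (\<sigma> w y))" if "y \<in> ball (\<phi> z) r" for y
      by (rule coefficient_adjoint[OF T ec_regular[OF ec that] ec_fibre[OF ec that v(2)] ec_fibre[OF ec that v(3)]])
  qed auto
  then obtain k where k: "\<And>v. v \<in> ball (\<phi> z) r \<Longrightarrow> coefficient T (\<sigma> w v) (\<sigma> z v) = k"
    unfolding constant_on_def by blast
  have "coefficient T w z = k" using k[OF c] by (simp only: cen)
  then have "\<forall>y\<in>?T. (case y of (w, z) \<Rightarrow> coefficient T w z) = (case x of (w, z) \<Rightarrow> coefficient T w z)"
    using k by (auto simp: wz)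
  ultimately show "\<exists>U. openin (top_of_set C) U \<and> x \<in> U \<and>
      (\<forall>y\<in>U. (case y of (w, z) \<Rightarrow> coefficient T w z) = (case x of (w, z) \<Rightarrow> coefficient T w z))"
    using xT by blast
qed

theorem blaschke_algebra_combination:
  assumes T: "T \<in> blaschke_algebra \<phi>"
  shows "\<exists>d. T = (\<Sum>C\<in>cover_components. op_scale (d C) (component_op C))"
proof -
  obtain d where d: "\<And>C w z. C \<in> cover_components \<Longrightarrow> (w, z) \<in> C \<Longrightarrow> coefficient T w z = d C"
    using coefficient_component_constant[OF T] unfolding constant_on_def by (metis case_prod_conv)
  obtain z1 where "z1 \<in> regular_set \<phi>" using regular_nonempty by blast
  then have fin: "finite cover_components" by (rule finite_cover_components)
  have "T f = (\<Sum>C\<in>cover_components. op_scale (d C) (component_op C)) f" for f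
  proof (rule bergman_eq_on_regular)
    fix z assume z: "z \<in> regular_set \<phi>"
    then have v: "\<phi> z \<in> regular_values" "z \<in> fibre (\<phi> z)" by (auto simp: regular_iff fibre_def)
    let ?t = "\<lambda>w. deriv \<phi> z / deriv \<phi> w * bergman_fun f w"
    have sumfun: "bergman_fun (\<Sum>D\<in>S. cscale (d D) (component_op D f)) z
        = (\<Sum>D\<in>S. d D * bergman_fun (component_op D f) z)" for S
      by (induction S rule: infinite_finite_induct) (auto simp: bergman_fun_add)
    have "bergman_fun ((\<Sum>C\<in>cover_components. op_scale (d C) (component_op C)) f) z
        = (\<Sum>C\<in>cover_components. d C * (\<Sum>w\<in>fibre (\<phi> z). if (w, z) \<in> C then ?t w else 0))"
      unfolding op_sum_apply op_scale_def sumfun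
      by (intro sum.cong refl) (simp add: component_op_fun[OF _ z] component_sum_fibre[OF _ v(2)])
    also have "\<dots> = (\<Sum>w\<in>fibre (\<phi> z). \<Sum>C\<in>cover_components. d C * (if (w, z) \<in> C then ?t w else 0))"
      unfolding sum_distrib_left by (rule sum.swap)
    also have "\<dots> = (\<Sum>w\<in>fibre (\<phi> z). coefficient T w z * ?t w)"
    proof (rule sum.cong[OF refl])
      fix w assume w: "w \<in> fibre (\<phi> z)"
      have "(w, z) \<in> unbranched_cover \<phi>" using cover_iff v w by blast
      then obtain C0 where C0: "C0 \<in> cover_components" "(w, z) \<in> C0"
        using Union_components by (metis UnionE)
      \<comment> \<open>Every pair of the cover lies in exactly one component, so the inner sum has
        a single nonzero term at most.\<close>
      have "(w, z) \<in> C \<longleftrightarrow> C = C0" if "C \<in> cover_components" for C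
        using components_nonoverlap[OF that C0(1)] C0 by blast
      then have "(\<Sum>C\<in>cover_components. d C * (if (w, z) \<in> C then ?t w else 0))
          = (\<Sum>C\<in>cover_components. if C = C0 then d C0 * ?t w else 0)"
        by (intro sum.cong refl) auto
      also have "\<dots> = d C0 * ?t w" using fin C0(1) by simp
      finally show "(\<Sum>C\<in>cover_components. d C * (if (w, z) \<in> C then ?t w else 0)) = coefficient T w z * ?t w"
        using d[OF C0] by simp
    qed
    also have "\<dots> = bergman_fun (T f) z" by (rule coefficient_expansion[OF T z, symmetric])
    finally show "bergman_fun (T f) z = bergman_fun ((\<Sum>C\<in>cover_components. op_scale (d C) (component_op C)) f) z" ..
  qed
  then show ?thesis by blast
qed

lemma subspace_blaschke_algebra: "ops.subspace (blaschke_algebra \<phi>)"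
  and von_neumann_blaschke_algebra: "von_neumann_algebra (blaschke_algebra \<phi>)"
  using von_neumann_algebra_commutant[OF mult_bounded]
  by (auto simp: blaschke_algebra_def von_neumann_algebra_def)

theorem span_component_op: "ops.span (component_op ` cover_components) = blaschke_algebra \<phi>"
proof (rule ops.span_unique)
  show "component_op ` cover_components \<subseteq> blaschke_algebra \<phi>"
    using component_op_blaschke_algebra by blast
  show "ops.subspace (blaschke_algebra \<phi>)" by (rule subspace_blaschke_algebra)
  fix V assume V: "component_op ` cover_components \<subseteq> V" "ops.subspace V"
  show "blaschke_algebra \<phi> \<subseteq> V"
  proof
    fix T assume "T \<in> blaschke_algebra \<phi>"
    then obtain d where "T = (\<Sum>C\<in>cover_components. op_scale (d C) (component_op C))"
      using blaschke_algebra_combination by blast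
    then show "T \<in> V"
      using V by (auto intro!: ops.subspace_sum ops.subspace_scale)
  qed
qed

text \<open>A von Neumann algebra containing the operators contains their linear span, and the span
  is already the whole algebra, itself a von Neumann algebra.\<close>

theorem von_neumann_generated_component_op:
  "von_neumann_generated (component_op ` cover_components) = blaschke_algebra \<phi>"
proof
  show "von_neumann_generated (component_op ` cover_components) \<subseteq> blaschke_algebra \<phi>"
    unfolding von_neumann_generated_def
    using von_neumann_blaschke_algebra component_op_blaschke_algebra by blast
  have "blaschke_algebra \<phi> \<subseteq> M" if M: "von_neumann_algebra M" "component_op ` cover_components \<subseteq> M" for M
    unfolding span_component_op[symmetric]
    using M by (intro ops.span_minimal) (auto simp: von_neumann_algebra_def)
  then show "blaschke_algebra \<phi> \<subseteq> von_neumann_generated (component_op ` cover_components)"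
    unfolding von_neumann_generated_def by blast
qed

theorem dim_blaschke_algebra: "ops.dim (blaschke_algebra \<phi>) = card cover_components"
  unfolding span_component_op[symmetric] ops.dim_span
  using ops.dim_eq_card_independent[OF component_op_independent] card_image[OF component_op_inj] by simp

end

section \<open>Germs of local inverses\<close>

lemma germ_eq_iff: "germ z f = germ z g \<longleftrightarrow> (\<forall>\<^sub>F w in nhds z. f w = g w)"
proof
  assume "germ z f = germ z g"
  moreover have "f \<in> germ z f" by (simp add: germ_def)
  ultimately show "\<forall>\<^sub>F w in nhds z. f w = g w" by (simp add: germ_def)
next
  assume "\<forall>\<^sub>F w in nhds z. f w = g w"
  then have "(\<forall>\<^sub>F w in nhds z. h w = f w) \<longleftrightarrow> (\<forall>\<^sub>F w in nhds z. h w = g w)" for h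
    by (auto elim: eventually_elim2)
  then show "germ z f = germ z g" by (simp add: germ_def)
qed

text \<open>The representative is an arbitrary member of the class, but it agrees with
  \<open>f\<close> near \<open>z\<close>; its value and derivative at \<open>z\<close> are therefore
  those of \<open>f\<close>.\<close>

lemma germ_rep_eventually: "\<forall>\<^sub>F w in nhds z. germ_rep (germ z f) w = f w"
proof -
  have "f \<in> germ z f" by (simp add: germ_def)
  then have "germ_rep (germ z f) \<in> germ z f" unfolding germ_rep_def by (rule someI[of "\<lambda>h. h \<in> germ z f"])
  then show ?thesis by (simp add: germ_def)
qed

lemma germ_rep_value [simp]: "germ_rep (germ z f) z = f z"
  using germ_rep_eventually eventually_nhds_x_imp_x by fastforce

lemma germ_rep_deriv: "deriv (germ_rep (germ z f)) z = deriv f z"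
  using germ_rep_eventually by (rule deriv_cong_ev) simp

context proper_disk_map
begin

lemma local_inverse_subset:
  "local_inverse \<phi> V \<rho> \<Longrightarrow> open U \<Longrightarrow> U \<subseteq> V \<Longrightarrow> local_inverse \<phi> U \<rho>"
  unfolding local_inverse_def using holomorphic_on_subset by (meson image_mono order_trans subsetD)

lemma local_inverse_cover:
  "local_inverse \<phi> V \<rho> \<Longrightarrow> z \<in> V \<Longrightarrow> z \<in> regular_set \<phi> \<Longrightarrow> (\<rho> z, z) \<in> unbranched_cover \<phi>"
  by (auto simp: local_inverse_def unbranched_cover_def)

lemma local_inverse_cong:
  assumes "local_inverse \<phi> V \<rho>" "\<And>x. x \<in> V \<Longrightarrow> \<rho>' x = \<rho> x"
  shows "local_inverse \<phi> V \<rho>'"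
proof -
  have "\<rho> holomorphic_on V" using assms(1) by (simp add: local_inverse_def)
  then have "\<rho>' holomorphic_on V" by (rule holomorphic_transform) (simp add: assms(2))
  moreover have "\<rho>' ` V = \<rho> ` V" using assms(2) by simp
  ultimately show ?thesis using assms by (simp add: local_inverse_def)
qed

lemma branch_exists:
  assumes "(w, z) \<in> unbranched_cover \<phi>"
  shows "\<exists>\<rho> V. z \<in> V \<and> local_inverse \<phi> V \<rho> \<and> \<rho> z = w"
proof -
  have v: "\<phi> z \<in> regular_values" "w \<in> fibre (\<phi> z)" "z \<in> fibre (\<phi> z)" using assms by (auto simp: cover_iff)
  obtain r \<sigma> where ec: "evenly_covered (\<phi> z) r \<sigma>" using evenly_covered_exists[OF v(1)] by blast
  have c: "\<phi> z \<in> ball (\<phi> z) r" using ec_pos[OF ec] by simp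
  let ?V = "\<sigma> z ` ball (\<phi> z) r" and ?\<rho> = "\<lambda>x. \<sigma> w (\<phi> x)"
  have "z \<in> ?V" using c ec_centre[OF ec v(3)] by (metis imageI)
  moreover have "local_inverse \<phi> ?V ?\<rho>"
    unfolding local_inverse_def
  proof (intro conjI)
    show "open ?V" by (rule ec_open[OF ec v(3)])
    show sub: "?V \<subseteq> ball 0 1" using ec_ball[OF ec _ v(3)] by blast
    have im: "\<phi> ` ?V \<subseteq> ball (\<phi> z) r" using ec_phi[OF ec _ v(3)] by auto
    show "?\<rho> holomorphic_on ?V"
      using holomorphic_on_compose_gen[OF holomorphic_on_subset[OF holo sub] ec_hol[OF ec v(2)] im]
      by (simp add: comp_def)
    show "?\<rho> ` ?V \<subseteq> ball 0 1" using im ec_ball[OF ec _ v(2)] by blast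
    show "\<forall>x\<in>?V. \<phi> (?\<rho> x) = \<phi> x" using im ec_phi[OF ec _ v(2)] by blast
  qed
  moreover have "?\<rho> z = w" using ec_centre[OF ec v(2)] .
  ultimately show ?thesis by blast
qed

text \<open>Only the germ at \<open>z\<close> of this choice matters, and \<open>germ_eqI\<close>
  shows that the value \<open>w\<close> determines it.\<close>

definition branch :: "complex \<Rightarrow> complex \<Rightarrow> complex \<Rightarrow> complex" where
  "branch w z = (SOME \<rho>. \<exists>V. z \<in> V \<and> local_inverse \<phi> V \<rho> \<and> \<rho> z = w)"

lemma branch:
  assumes "(w, z) \<in> unbranched_cover \<phi>"
  shows "\<exists>V. z \<in> V \<and> local_inverse \<phi> V (branch w z)" "branch w z z = w"
  using someI_ex[OF branch_exists[OF assms]] unfolding branch_def by blast+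

lemma locally_injective:
  assumes "w \<in> regular_set \<phi>"
  shows "\<exists>B. open B \<and> w \<in> B \<and> inj_on \<phi> B"
  using has_complex_derivative_locally_invertible[OF holo _ open_ball deriv_nonzero[OF assms]] regular_ball[OF assms]
  by (metis centre_in_ball open_ball)

lemma cover_regular:
  assumes "(w, z) \<in> unbranched_cover \<phi>"
  shows "w \<in> regular_set \<phi>" "z \<in> regular_set \<phi>" "\<phi> w = \<phi> z"
  using assms by (auto simp: unbranched_cover_def regular_iff)

text \<open>Near the common value \<open>\<phi>\<close> is injective, and both functions stay there
  by continuity, so the functional equation forces them to agree.\<close>

lemma germ_eqI:
  assumes 1: "local_inverse \<phi> V \<rho>" "z \<in> V" and 2: "local_inverse \<phi> V' \<rho>'" "z \<in> V'"
    and z: "z \<in> regular_set \<phi>" and eq: "\<rho> z = \<rho>' z"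
  shows "germ z \<rho> = germ z \<rho>'"
proof -
  have "\<rho> z \<in> regular_set \<phi>" using cover_regular(1)[OF local_inverse_cover[OF 1 z]] .
  then obtain B where B: "open B" "\<rho> z \<in> B" "inj_on \<phi> B" using locally_injective by blast
  have ev: "\<forall>\<^sub>F x in nhds z. x \<in> W \<and> f x \<in> B" if "local_inverse \<phi> W f" "z \<in> W" "f z \<in> B" for W f
  proof -
    have "open W" "continuous_on W f"
      using that by (auto simp: local_inverse_def holomorphic_on_imp_continuous_on)
    then have "open (W \<inter> f -` B)" using continuous_open_preimage B(1) by blast
    then show ?thesis using that eventually_nhds_in_open[of "W \<inter> f -` B" z] by simp
  qed
  have "\<forall>\<^sub>F x in nhds z. \<rho> x = \<rho>' x"
  proof (rule eventually_mono[OF eventually_conj[OF ev[OF 1 B(2)] ev[OF 2]]])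
    show "\<rho>' z \<in> B" using B(2) eq by simp
    fix x assume x: "(x \<in> V \<and> \<rho> x \<in> B) \<and> (x \<in> V' \<and> \<rho>' x \<in> B)"
    then have "\<phi> (\<rho> x) = \<phi> (\<rho>' x)" using 1(1) 2(1) by (simp add: local_inverse_def)
    then show "\<rho> x = \<rho>' x" using x B(3) by (simp add: inj_on_eq_iff)
  qed
  then show ?thesis by (simp add: germ_eq_iff)
qed

lemma branch_germ:
  assumes "(w, z) \<in> unbranched_cover \<phi>"
  shows "germ z (branch w z) \<in> local_inverse_germs \<phi> z"
  using branch(1)[OF assms] by (auto simp: local_inverse_germs_def)

lemma local_inverse_germ_cases:
  assumes "g \<in> local_inverse_germs \<phi> z" and z: "z \<in> regular_set \<phi>"
  shows "(germ_rep g z, z) \<in> unbranched_cover \<phi>" and "g = germ z (branch (germ_rep g z) z)"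
proof -
  obtain \<rho> V where r: "g = germ z \<rho>" "z \<in> V" "local_inverse \<phi> V \<rho>"
    using assms(1) by (auto simp: local_inverse_germs_def)
  show c: "(germ_rep g z, z) \<in> unbranched_cover \<phi>"
    using local_inverse_cover[OF r(3,2) z] r(1) by simp
  obtain V' where V': "z \<in> V'" "local_inverse \<phi> V' (branch (germ_rep g z) z)" using branch(1)[OF c] by blast
  have "\<rho> z = branch (germ_rep g z) z z" using branch(2)[OF c] r(1) by simp
  from germ_eqI[OF r(3,2) V'(2,1) z this] show "g = germ z (branch (germ_rep g z) z)" by (rule trans[OF r(1)])
qed

lemma germ_rep_branch:
  "(w, z) \<in> unbranched_cover \<phi> \<Longrightarrow> germ_rep (germ z (branch w z)) z = w"
  by (simp add: branch(2))

lemma germ_rep_inj: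
  "g \<in> local_inverse_germs \<phi> z \<Longrightarrow> h \<in> local_inverse_germs \<phi> z \<Longrightarrow> z \<in> regular_set \<phi> \<Longrightarrow>
    germ_rep g z = germ_rep h z \<Longrightarrow> g = h"
  using local_inverse_germ_cases(2) by metis

text \<open>Differentiation of the functional equation at \<open>z\<close>; this links the summands
  of \<open>class_sum\<close> with those of \<open>component_sum\<close>.\<close>

lemma germ_rep_deriv_local_inverse:
  assumes g: "g \<in> local_inverse_germs \<phi> z" and z: "z \<in> regular_set \<phi>"
  shows "deriv (germ_rep g) z = deriv \<phi> z / deriv \<phi> (germ_rep g z)"
proof -
  obtain \<rho> V where r: "g = germ z \<rho>" "z \<in> V" "local_inverse \<phi> V \<rho>"
    using g by (auto simp: local_inverse_germs_def)
  then have V: "open V" "\<rho> holomorphic_on V" "\<And>x. x \<in> V \<Longrightarrow> \<phi> (\<rho> x) = \<phi> x" "\<rho> z \<in> ball 0 1"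
    by (auto simp: local_inverse_def)
  have reg: "\<rho> z \<in> regular_set \<phi>" using cover_regular(1)[OF local_inverse_cover[OF r(3,2) z]] .
  have d: "(\<rho> has_field_derivative deriv \<rho> z) (at z)"
    using holomorphic_derivI[OF V(2,1) r(2)] .
  have "(\<phi> has_field_derivative deriv \<phi> (\<rho> z)) (at (\<rho> z))"
    using holomorphic_derivI[OF holo open_ball V(4)] .
  from DERIV_chain2[OF this d]
  have "((\<lambda>x. \<phi> (\<rho> x)) has_field_derivative deriv \<phi> (\<rho> z) * deriv \<rho> z) (at z)" .
  moreover have "((\<lambda>x. \<phi> (\<rho> x)) has_field_derivative deriv \<phi> z) (at z)"
    by (rule has_field_derivative_transform_within_open[OF holomorphic_derivI[OF holo open_ball regular_ball[OF z]] V(1) r(2)])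
       (simp add: V(3))
  ultimately have "deriv \<phi> (\<rho> z) * deriv \<rho> z = deriv \<phi> z" by (rule DERIV_unique)
  then show ?thesis using deriv_nonzero[OF reg] by (simp add: r(1) germ_rep_deriv field_simps)
qed

text \<open>The first conjunct is not automatic along a path: \<open>analytic_continuation\<close>
  only asks the intermediate germs to be analytic, so being a local inverse has to be propagated
  together with the component.\<close>

definition over_component :: "(complex \<times> complex) set \<Rightarrow> complex \<Rightarrow> cgerm \<Rightarrow> bool" where
  "over_component C z g \<longleftrightarrow> g \<in> local_inverse_germs \<phi> z \<and> (germ_rep g z, z) \<in> C"

text \<open>The graph of \<open>\<rho>\<close> over a connected set is a connected subset of the
  cover.\<close>

lemma local_inverse_graph_component:
  assumes C: "C \<in> cover_components" and l: "local_inverse \<phi> U \<rho>" and U: "connected U" "U \<subseteq> regular_set \<phi>"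
    and x: "x \<in> U" "(\<rho> x, x) \<in> C" and y: "y \<in> U"
  shows "over_component C y (germ y \<rho>)"
proof -
  have "connected ((\<lambda>u. (\<rho> u, u)) ` U)"
    using l by (intro connected_continuous_image U continuous_intros)
      (auto simp: local_inverse_def holomorphic_on_imp_continuous_on)
  moreover have "(\<lambda>u. (\<rho> u, u)) ` U \<subseteq> unbranched_cover \<phi>" using local_inverse_cover[OF l] U(2) by blast
  ultimately have "(\<lambda>u. (\<rho> u, u)) ` U \<subseteq> C" using components_maximal[OF C] x by blast
  then have "(\<rho> y, y) \<in> C" using y by blast
  then show ?thesis using l y by (auto simp: over_component_def local_inverse_germs_def)
qed

text \<open>A germ fixes the function only near \<open>z\<close>; the disk is cut down until
  \<open>\<rho>\<close> agrees on it with an actual local inverse.\<close>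

lemma local_inverse_ball:
  assumes g: "germ z \<rho> \<in> local_inverse_germs \<phi> z" and W: "open W" "z \<in> W"
  shows "\<exists>\<delta>>0. ball z \<delta> \<subseteq> W \<and> local_inverse \<phi> (ball z \<delta>) \<rho>"
proof -
  obtain \<rho>1 V where r: "germ z \<rho> = germ z \<rho>1" "z \<in> V" "local_inverse \<phi> V \<rho>1"
    using g by (auto simp: local_inverse_germs_def)
  have "\<forall>\<^sub>F x in nhds z. \<rho> x = \<rho>1 x" using r(1) by (simp add: germ_eq_iff)
  moreover have "\<forall>\<^sub>F x in nhds z. x \<in> V \<inter> W"
    using r(2,3) W by (intro eventually_nhds_in_open) (auto simp: local_inverse_def)
  ultimately have "\<forall>\<^sub>F x in nhds z. \<rho> x = \<rho>1 x \<and> x \<in> V \<inter> W" by (rule eventually_conj)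
  then obtain \<delta> where d: "\<delta> > 0" "\<And>x. dist x z < \<delta> \<Longrightarrow> \<rho> x = \<rho>1 x \<and> x \<in> V \<inter> W"
    unfolding eventually_nhds_metric by blast
  have sub: "ball z \<delta> \<subseteq> V \<inter> W" using d(2) by (auto simp: dist_commute)
  have "local_inverse \<phi> (ball z \<delta>) \<rho>"
  proof (rule local_inverse_cong[OF local_inverse_subset[OF r(3) open_ball]])
    show "ball z \<delta> \<subseteq> V" using sub by blast
    show "\<rho> x = \<rho>1 x" if "x \<in> ball z \<delta>" for x using d(2)[of x] that by (simp add: dist_commute)
  qed
  then show ?thesis using d(1) sub by blast
qed

text \<open>If \<open>\<bar>\<rho>(z)\<bar> \<ge> 1\<close>, then by properness of \<open>\<phi>\<close> the function \<open>\<rho>\<close> is not a local inverse anywhere near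
  \<open>z\<close>; otherwise the functional equation spreads over a whole disk by the identity theorem.\<close>

lemma over_component_locally_constant:
  assumes C: "C \<in> cover_components" and z: "z \<in> regular_set \<phi>"
    and V: "open V" "z \<in> V" and hol: "\<rho> holomorphic_on V"
  shows "\<exists>\<delta>>0. ball z \<delta> \<subseteq> V \<and> (\<forall>x\<in>ball z \<delta>. over_component C x (germ x \<rho>) \<longleftrightarrow> over_component C z (germ z \<rho>))"
proof (cases "cmod (\<rho> z) < 1")
  case True
  have cont\<rho>: "continuous_on V \<rho>" using hol holomorphic_on_imp_continuous_on by blast
  have "open (V \<inter> \<rho> -` ball 0 1)" using continuous_open_preimage[OF cont\<rho> V(1) open_ball] .
  then have "open (V \<inter> \<rho> -` ball 0 1 \<inter> regular_set \<phi>)" using open_regular by blast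
  moreover have "z \<in> V \<inter> \<rho> -` ball 0 1 \<inter> regular_set \<phi>" using V z True by simp
  ultimately obtain \<delta> where d: "\<delta> > 0" "ball z \<delta> \<subseteq> V \<inter> \<rho> -` ball 0 1 \<inter> regular_set \<phi>"
    by (meson openE)
  have Uhol: "\<rho> holomorphic_on ball z \<delta>" using hol d(2) holomorphic_on_subset by blast
  have im: "\<rho> ` ball z \<delta> \<subseteq> ball 0 1" and reg: "ball z \<delta> \<subseteq> regular_set \<phi>" and inD: "ball z \<delta> \<subseteq> ball 0 1"
    using d(2) regular_ball by blast+
  \<comment> \<open>One germ of a local inverse anywhere in the disk gives the functional equation
    on the whole disk, and with it the component at every point; used in both directions this is
    constancy.\<close>
  have spread: "over_component C y (germ y \<rho>)"
    if xy: "x \<in> ball z \<delta>" "y \<in> ball z \<delta>" and oc: "over_component C x (germ x \<rho>)" for x y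
  proof -
    obtain \<eta> where e: "\<eta> > 0" "ball x \<eta> \<subseteq> ball z \<delta>" "local_inverse \<phi> (ball x \<eta>) \<rho>"
      using local_inverse_ball[OF _ open_ball xy(1)] oc unfolding over_component_def by blast
    have "\<phi> (\<rho> u) = \<phi> u" if u: "u \<in> ball z \<delta>" for u
    proof (rule analytic_continuation_open[of "ball x \<eta>" "ball z \<delta>" "\<lambda>u. \<phi> (\<rho> u)" \<phi>])
      show "(\<lambda>u. \<phi> (\<rho> u)) holomorphic_on ball z \<delta>"
        using holomorphic_on_compose_gen[OF Uhol holo im] by (simp add: comp_def)
      show "\<phi> holomorphic_on ball z \<delta>" using holo inD holomorphic_on_subset by blast
      show "ball x \<eta> \<noteq> {}" using e(1) by simp
      show "\<phi> (\<rho> y) = \<phi> y" if "y \<in> ball x \<eta>" for y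
        using e(3) that unfolding local_inverse_def by blast
    qed (use e u in auto)
    then have "local_inverse \<phi> (ball z \<delta>) \<rho>"
      unfolding local_inverse_def using Uhol im inD by blast
    then show ?thesis
      using local_inverse_graph_component[OF C _ connected_ball reg xy(1) _ xy(2)] oc
      by (simp add: over_component_def)
  qed
  have "z \<in> ball z \<delta>" using d(1) by simp
  then show ?thesis using d spread by (intro exI[of _ \<delta>]) blast
next
  case False
  \<comment> \<open>A bound strictly between \<open>cmod (\<phi> z)\<close> and 1. The points of the
    closed disk where \<open>\<phi>\<close> has modulus at most \<open>m\<close> form the closed set
    \<open>K\<close>; near \<open>z\<close> the function \<open>\<rho>\<close> avoids it, whereas a
    local inverse would have to take its values there.\<close>
  define m where "m = (1 + cmod (\<phi> z)) / 2"
  have m: "cmod (\<phi> z) < m" "m < 1" using less_one[OF regular_ball[OF z]] by (auto simp: m_def)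
  define K where "K = cball 0 1 \<inter> \<phi> -` cball 0 m"
  have clK: "closed K" unfolding K_def by (rule continuous_closed_preimage[OF cont]) auto
  have "\<rho> z \<notin> K" using False eq_one[of "\<rho> z"] m(2) by (cases "cmod (\<rho> z) = 1") (auto simp: K_def)
  have cont\<rho>: "continuous_on V \<rho>" using hol holomorphic_on_imp_continuous_on by blast
  have 1: "open (V \<inter> \<rho> -` (- K))"
    using continuous_open_preimage[OF cont\<rho> V(1)] clK by (simp add: open_Compl)
  have 2: "open (ball 0 1 \<inter> \<phi> -` ball 0 m)"
    by (rule continuous_open_preimage[OF holomorphic_on_imp_continuous_on[OF holo] open_ball open_ball])
  have "open ((V \<inter> \<rho> -` (- K)) \<inter> (ball 0 1 \<inter> \<phi> -` ball 0 m))" using 1 2 by (rule open_Int)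
  moreover have "z \<in> (V \<inter> \<rho> -` (- K)) \<inter> (ball 0 1 \<inter> \<phi> -` ball 0 m)"
    using V \<open>\<rho> z \<notin> K\<close> regular_ball[OF z] m(1) by simp
  ultimately obtain \<delta> where d: "\<delta> > 0" "ball z \<delta> \<subseteq> (V \<inter> \<rho> -` (- K)) \<inter> (ball 0 1 \<inter> \<phi> -` ball 0 m)"
    by (meson openE)
  have no: "\<not> over_component C x (germ x \<rho>)" if x: "x \<in> ball z \<delta>" for x
  proof
    assume "over_component C x (germ x \<rho>)"
    then have "(\<rho> x, x) \<in> unbranched_cover \<phi>"
      using in_components_subset[OF C] by (auto simp: over_component_def)
    then have "\<rho> x \<in> ball 0 1" "\<phi> (\<rho> x) = \<phi> x" by (auto simp: unbranched_cover_def)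
    moreover have "\<phi> x \<in> ball 0 m" "\<rho> x \<notin> K" using d(2) x by blast+
    ultimately show False by (auto simp: K_def)
  qed
  have "z \<in> ball z \<delta>" using d(1) by simp
  then show ?thesis using d no by (intro exI[of _ \<delta>]) blast
qed

text \<open>Lying over \<open>C\<close> is locally constant on the parameter interval, because near
  each time the germs come from a single function.\<close>

lemma continues_to_over_component:
  assumes C: "C \<in> cover_components" and ct: "continues_to (regular_set \<phi>) z z' g h"
    and g: "over_component C z g"
  shows "over_component C z' h"
proof -
  obtain \<gamma> G where G: "analytic_continuation \<gamma> G" "path_image \<gamma> \<subseteq> regular_set \<phi>"
    "\<gamma> 0 = z" "\<gamma> 1 = z'" "G 0 = g" "G 1 = h"
    using ct by (auto simp: continues_to_def pathstart_def pathfinish_def)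
  have reg: "\<gamma> t \<in> regular_set \<phi>" if "t \<in> {0..1}" for t
    using G(2) that by (auto simp: path_image_def)
  have cont\<gamma>: "continuous_on {0..1} \<gamma>" using G(1) by (simp add: analytic_continuation_def path_def)
  let ?Q = "\<lambda>t. over_component C (\<gamma> t) (G t)"
  have "?Q constant_on {0..1}"
  proof (rule locally_constant_imp_constant)
    show "connected {0..1::real}" by simp
    fix t :: real assume t: "t \<in> {0..1}"
    obtain V \<rho> e where V: "open V" "\<rho> holomorphic_on V" "e > 0"
      "\<And>s. s \<in> {0..1} \<Longrightarrow> dist s t < e \<Longrightarrow> \<gamma> s \<in> V \<and> G s = germ (\<gamma> s) \<rho>"
      using G(1) t unfolding analytic_continuation_def by metis
    have "\<gamma> t \<in> V" using V(3) V(4)[OF t] by simp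
    from over_component_locally_constant[OF C reg[OF t] V(1) this V(2)]
    obtain \<delta> where d: "\<delta> > 0"
      "\<And>x. x \<in> ball (\<gamma> t) \<delta> \<Longrightarrow> over_component C x (germ x \<rho>) \<longleftrightarrow> over_component C (\<gamma> t) (germ (\<gamma> t) \<rho>)"
      by blast
    let ?T = "{0..1} \<inter> \<gamma> -` ball (\<gamma> t) \<delta> \<inter> ball t e"
    have "openin (top_of_set {0..1}) ({0..1} \<inter> \<gamma> -` ball (\<gamma> t) \<delta>)"
      by (rule continuous_openin_preimage_gen[OF cont\<gamma> open_ball])
    then have "openin (top_of_set {0..1}) ?T" by (simp add: openin_Int_open)
    moreover have "t \<in> ?T" using t d(1) V(3) by simp
    moreover have "?Q s = ?Q t" if "s \<in> ?T" for s
      using that V(4)[of s] V(4)[OF t] V(3) d(2)[of "\<gamma> s"] by (simp add: dist_commute)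
    ultimately show "\<exists>T. openin (top_of_set {0..1}) T \<and> t \<in> T \<and> (\<forall>s\<in>T. ?Q s = ?Q t)" by blast
  qed
  then obtain b where "\<And>t. t \<in> {0..1} \<Longrightarrow> ?Q t = b" unfolding constant_on_def by blast
  from this[of 0] this[of 1] show ?thesis using G g by simp
qed

text \<open>For a path in \<open>C\<close> joining the two points, the second entry is the path of
  continuation and the first entry prescribes the value of the germ at each time.\<close>

lemma over_component_continues_to:
  assumes C: "C \<in> cover_components" and z: "z \<in> regular_set \<phi>" and z': "z' \<in> regular_set \<phi>"
    and g: "over_component C z g" and h: "over_component C z' h"
  shows "continues_to (regular_set \<phi>) z z' g h"
proof -
  let ?w = "germ_rep g z" and ?w' = "germ_rep h z'"
  have gh: "(?w, z) \<in> C" "(?w', z') \<in> C" "g \<in> local_inverse_germs \<phi> z" "h \<in> local_inverse_germs \<phi> z'"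
    using g h by (auto simp: over_component_def)
  obtain p where p: "path p" "path_image p \<subseteq> C" "pathstart p = (?w, z)" "pathfinish p = (?w', z')"
    using component_path_connected[OF C] gh(1,2) unfolding path_connected_def by blast
  define \<gamma> where "\<gamma> = snd \<circ> p"
  define \<omega> where "\<omega> = fst \<circ> p"
  define G where "G = (\<lambda>t. germ (\<gamma> t) (branch (\<omega> t) (\<gamma> t)))"
  have X: "(\<omega> t, \<gamma> t) \<in> unbranched_cover \<phi>" if "t \<in> {0..1}" for t
  proof -
    have "p t \<in> C" using p(2) that by (auto simp: path_image_def)
    then show ?thesis using in_components_subset[OF C] by (auto simp: \<gamma>_def \<omega>_def)
  qed
  have c: "continuous_on {0..1} \<gamma>" "continuous_on {0..1} \<omega>"
    using p(1) by (auto simp: \<gamma>_def \<omega>_def path_def comp_def intro!: continuous_intros)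
  have "analytic_continuation \<gamma> G"
    unfolding analytic_continuation_def
  proof (intro conjI ballI)
    show "path \<gamma>" using c by (simp add: path_def)
    fix t :: real assume t: "t \<in> {0..1}"
    let ?\<rho> = "branch (\<omega> t) (\<gamma> t)"
    obtain V where V: "\<gamma> t \<in> V" "local_inverse \<phi> V ?\<rho>" using branch(1)[OF X[OF t]] by blast
    have V': "open V" "?\<rho> holomorphic_on V" using V(2) by (auto simp: local_inverse_def)
    obtain B where B: "open B" "\<omega> t \<in> B" "inj_on \<phi> B"
      using locally_injective[OF cover_regular(1)[OF X[OF t]]] by blast
    have "open (V \<inter> ?\<rho> -` B)"
      using continuous_open_preimage[OF holomorphic_on_imp_continuous_on[OF V'(2)] V'(1) B(1)] .
    then have "openin (top_of_set {0..1}) (({0..1} \<inter> \<gamma> -` (V \<inter> ?\<rho> -` B)) \<inter> ({0..1} \<inter> \<omega> -` B))"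
      by (intro openin_Int continuous_openin_preimage_gen c B)
    moreover have "t \<in> ({0..1} \<inter> \<gamma> -` (V \<inter> ?\<rho> -` B)) \<inter> ({0..1} \<inter> \<omega> -` B)"
      using t V(1) B(2) branch(2)[OF X[OF t]] by simp
    ultimately obtain e where e: "e > 0" "\<And>s. s \<in> {0..1} \<Longrightarrow> dist s t < e \<Longrightarrow>
        s \<in> ({0..1} \<inter> \<gamma> -` (V \<inter> ?\<rho> -` B)) \<inter> ({0..1} \<inter> \<omega> -` B)"
      unfolding openin_euclidean_subtopology_iff by blast
    \<comment> \<open>The branch chosen at time \<open>t\<close> also serves nearby times
      \<open>s\<close>: its value at \<open>\<gamma> s\<close> and the point
      \<open>\<omega> s\<close> have the same image, and both lie in \<open>B\<close>, where
      \<open>\<phi>\<close> is injective.\<close>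
    have "G s = germ (\<gamma> s) ?\<rho>" if s: "s \<in> {0..1}" "dist s t < e" for s
    proof -
      have m: "\<gamma> s \<in> V" "?\<rho> (\<gamma> s) \<in> B" "\<omega> s \<in> B" using e(2)[OF s] by auto
      have "\<phi> (?\<rho> (\<gamma> s)) = \<phi> (\<gamma> s)" using V(2) m(1) by (simp add: local_inverse_def)
      also have "\<dots> = \<phi> (\<omega> s)" using cover_regular(3)[OF X[OF s(1)]] ..
      finally have "?\<rho> (\<gamma> s) = \<omega> s" using B(3) m by (simp add: inj_on_eq_iff)
      moreover obtain V' where "\<gamma> s \<in> V'" "local_inverse \<phi> V' (branch (\<omega> s) (\<gamma> s))"
        using branch(1)[OF X[OF s(1)]] by blast
      ultimately show ?thesis
        unfolding G_def using germ_eqI V(2) m(1) cover_regular(2)[OF X[OF s(1)]] branch(2)[OF X[OF s(1)]] by metis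
    qed
    then show "\<exists>V \<rho> e. open V \<and> \<rho> holomorphic_on V \<and> e > 0 \<and>
        (\<forall>s\<in>{0..1}. dist s t < e \<longrightarrow> \<gamma> s \<in> V \<and> G s = germ (\<gamma> s) \<rho>)"
      using V' e by (intro exI[of _ V] exI[of _ ?\<rho>] exI[of _ e]) auto
  qed
  moreover have "path_image \<gamma> \<subseteq> regular_set \<phi>" using cover_regular(2)[OF X] unfolding path_image_def by blast
  moreover have ends: "\<gamma> 0 = z" "\<gamma> 1 = z'" "\<omega> 0 = ?w" "\<omega> 1 = ?w'"
    using p(3,4) by (simp_all add: \<gamma>_def \<omega>_def pathstart_def pathfinish_def)
  moreover have "G 0 = g" "G 1 = h"
    unfolding G_def ends using local_inverse_germ_cases(2) gh(3,4) z z' by metis+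
  ultimately show ?thesis
    unfolding continues_to_def pathstart_def pathfinish_def by blast
qed

section \<open>Classes of germs and their sums\<close>

definition component_class :: "complex \<Rightarrow> (complex \<times> complex) set \<Rightarrow> cgerm set" where
  "component_class z C = {g. over_component C z g}"

lemma component_class_value_bij:
  assumes C: "C \<in> cover_components" and z: "z \<in> regular_set \<phi>"
  shows "bij_betw (\<lambda>g. germ_rep g z) (component_class z C) (component_fibre C z)"
  unfolding bij_betw_def
proof
  show "inj_on (\<lambda>g. germ_rep g z) (component_class z C)"
  proof (rule inj_onI)
    show "g = h" if "g \<in> component_class z C" "h \<in> component_class z C" "germ_rep g z = germ_rep h z" for g h
      using that germ_rep_inj[OF _ _ z] by (auto simp: component_class_def over_component_def)
  qed
  show "(\<lambda>g. germ_rep g z) ` component_class z C = component_fibre C z"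
  proof (intro equalityI subsetI)
    show "w \<in> component_fibre C z" if "w \<in> (\<lambda>g. germ_rep g z) ` component_class z C" for w
      using that by (auto simp: component_class_def over_component_def component_fibre_def)
    fix w assume "w \<in> component_fibre C z"
    then have w: "(w, z) \<in> C" by (simp add: component_fibre_def)
    then have X: "(w, z) \<in> unbranched_cover \<phi>" using in_components_subset[OF C] by blast
    have "germ z (branch w z) \<in> component_class z C"
      using branch_germ[OF X] germ_rep_branch[OF X] w by (simp add: component_class_def over_component_def)
    then show "w \<in> (\<lambda>g. germ_rep g z) ` component_class z C" using germ_rep_branch[OF X] by (metis imageI)
  qed
qed

lemma component_class_nonempty:
  assumes C: "C \<in> cover_components" and z: "z \<in> regular_set \<phi>"
  shows "component_class z C \<noteq> {}"
proof -
  have "component_fibre C z \<noteq> {}" using component_snd[OF C z] by (auto simp: component_fibre_def)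
  then show ?thesis using component_class_value_bij[OF C z] by (auto simp: bij_betw_def)
qed

lemma over_component_exists:
  assumes "g \<in> local_inverse_germs \<phi> z" "z \<in> regular_set \<phi>"
  shows "\<exists>C\<in>cover_components. over_component C z g"
proof -
  have "(germ_rep g z, z) \<in> \<Union>cover_components"
    using local_inverse_germ_cases(1)[OF assms] by (simp only: Union_components)
  then show ?thesis using assms by (elim UnionE) (auto simp: over_component_def)
qed

text \<open>Continuation along loops keeps the component and joins any two germs over the same
  component, so the class of a germ is everything over its component.\<close>

lemma inverse_classes_eq:
  assumes z: "z \<in> regular_set \<phi>"
  shows "inverse_classes \<phi> z = component_class z ` cover_components"
proof -
  let ?L = "local_inverse_germs \<phi> z"
  define R where "R = {(g, h). g \<in> ?L \<and> h \<in> ?L \<and> continues_to (regular_set \<phi>) z z g h}"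
  have im: "R `` {g} = component_class z C" if C: "C \<in> cover_components" and g: "over_component C z g" for C g
  proof -
    have "(g, h) \<in> R \<longleftrightarrow> over_component C z h" for h
      using continues_to_over_component[OF C _ g] over_component_continues_to[OF C z z g] g
      unfolding R_def over_component_def by blast
    then show ?thesis by (auto simp: component_class_def)
  qed
  have "inverse_classes \<phi> z = (\<lambda>g. R `` {g}) ` ?L"
    by (auto simp: inverse_classes_def quotient_def R_def)
  also have "\<dots> = component_class z ` cover_components"
  proof (intro equalityI subsetI)
    fix K assume "K \<in> (\<lambda>g. R `` {g}) ` ?L"
    then obtain g where g: "g \<in> ?L" "K = R `` {g}" by blast
    then obtain C where "C \<in> cover_components" "over_component C z g" using over_component_exists z by blast
    then show "K \<in> component_class z ` cover_components" using im g(2) by blast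
  next
    fix K assume "K \<in> component_class z ` cover_components"
    then obtain C where C: "C \<in> cover_components" "K = component_class z C" by blast
    then obtain g where g: "over_component C z g" using component_class_nonempty[OF C(1) z] by (auto simp: component_class_def)
    then have "g \<in> ?L" by (simp add: over_component_def)
    then show "K \<in> (\<lambda>g. R `` {g}) ` ?L" using im[OF C(1) g] C(2) by blast
  qed
  finally show ?thesis .
qed

lemma component_class_inj:
  assumes z: "z \<in> regular_set \<phi>"
  shows "inj_on (component_class z) cover_components"
proof (rule inj_onI)
  fix C D assume C: "C \<in> cover_components" and D: "D \<in> cover_components" and eq: "component_class z C = component_class z D"
  obtain g where "g \<in> component_class z C" using component_class_nonempty[OF C z] by blast
  then have "(germ_rep g z, z) \<in> C \<inter> D" using eq by (auto simp: component_class_def over_component_def)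
  then show "C = D" using components_nonoverlap[OF C D] by blast
qed

text \<open>The same two facts as for loops, now for paths from \<open>z0\<close> to
  \<open>z\<close>; this contains the independence of the path.\<close>

lemma continued_class_eq:
  assumes C: "C \<in> cover_components" and z0: "z0 \<in> regular_set \<phi>" and z: "z \<in> regular_set \<phi>"
  shows "continued_class \<phi> z0 (component_class z0 C) z = component_class z C"
proof (intro equalityI subsetI)
  fix h assume "h \<in> continued_class \<phi> z0 (component_class z0 C) z"
  then show "h \<in> component_class z C"
    using continues_to_over_component[OF C] by (auto simp: continued_class_def component_class_def)
next
  fix h assume h: "h \<in> component_class z C"
  obtain g where "g \<in> component_class z0 C" using component_class_nonempty[OF C z0] by blast
  then show "h \<in> continued_class \<phi> z0 (component_class z0 C) z"
    using over_component_continues_to[OF C z0 z] h by (auto simp: continued_class_def component_class_def)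
qed

lemma class_sum_eq:
  assumes C: "C \<in> cover_components" and z0: "z0 \<in> regular_set \<phi>" and z: "z \<in> regular_set \<phi>"
  shows "class_sum \<phi> z0 (component_class z0 C) f z = component_sum C (bergman_fun f) z"
proof -
  have "class_sum \<phi> z0 (component_class z0 C) f z
    = (\<Sum>g\<in>component_class z C. deriv \<phi> z / deriv \<phi> (germ_rep g z) * bergman_fun f (germ_rep g z))"
    unfolding class_sum_def continued_class_eq[OF C z0 z]
    by (intro sum.cong refl)
       (simp add: component_class_def over_component_def germ_rep_deriv_local_inverse[OF _ z])
  also have "\<dots> = component_sum C (bergman_fun f) z"
    unfolding component_sum_def
    by (rule sum.reindex_bij_betw[OF component_class_value_bij[OF C z]])
  finally show ?thesis .
qed

lemma class_op_eq:
  assumes C: "C \<in> cover_components" and z0: "z0 \<in> regular_set \<phi>"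
  shows "class_op \<phi> z0 (component_class z0 C) = component_op C"
proof
  fix f
  show "class_op \<phi> z0 (component_class z0 C) f = component_op C f"
    unfolding class_op_def component_op_def using class_sum_eq[OF C z0] by simp
qed

end

section \<open>Connected components of the Riemann surface\<close>

context proper_disk_map
begin

text \<open>The completion of \<open>C\<close>: an end belongs to it as soon as one of its pieces
  does, since the pieces for smaller radii are contained in that one.\<close>

definition surface_component :: "(complex \<times> complex) set \<Rightarrow> surface_point set" where
  "surface_component C = Sheet ` C \<union>
     {Branch b U | b U. b \<in> singular_set \<phi> \<and> U \<in> cover_ends \<phi> b \<and> (\<exists>r>0. U r \<subseteq> C)}"

lemma Union_cover_components: "\<Union>cover_components = unbranched_cover \<phi>"
  by (rule Union_components)

lemma cover_end_nonempty: "U \<in> cover_ends \<phi> b \<Longrightarrow> r > 0 \<Longrightarrow> U r \<noteq> {}"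
  unfolding cover_ends_def using in_components_nonempty by blast

lemma cover_end_mono: "U \<in> cover_ends \<phi> b \<Longrightarrow> 0 < r \<Longrightarrow> r \<le> s \<Longrightarrow> U r \<subseteq> U s"
  unfolding cover_ends_def by blast

lemma cover_end_subset:
  assumes "U \<in> cover_ends \<phi> b"
  shows "\<exists>C\<in>cover_components. U 1 \<subseteq> C"
proof -
  have c: "U 1 \<in> components (punctured_cover \<phi> b 1)" using assms by (simp add: cover_ends_def)
  have sub: "U 1 \<subseteq> unbranched_cover \<phi>"
    using in_components_subset[OF c] by (auto simp: punctured_cover_def)
  obtain x where x: "x \<in> U 1" using in_components_nonempty[OF c] by blast
  then have "x \<in> \<Union>cover_components" using sub Union_cover_components by blast
  then obtain C where C: "C \<in> cover_components" "x \<in> C" by blast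
  then have "U 1 \<subseteq> C" using components_maximal[OF C(1) in_components_connected[OF c] sub] x by blast
  then show ?thesis using C(1) by blast
qed

lemma surface_component_openin:
  assumes C: "C \<in> cover_components"
  shows "openin (riemann_surface \<phi>) (surface_component C)"
  unfolding openin_riemann_surface
proof (intro conjI allI impI)
  show "surface_component C \<subseteq> surface_points \<phi>"
    using in_components_subset[OF C] by (auto simp: surface_component_def surface_points_def)
  have "Sheet -` surface_component C = C" by (auto simp: surface_component_def)
  then show "openin (top_of_set (unbranched_cover \<phi>)) (Sheet -` surface_component C)"
    using component_openin[OF C] by simp
  fix b U assume "Branch b U \<in> surface_component C"
  then obtain r where "r > 0" "U r \<subseteq> C" by (auto simp: surface_component_def)
  then show "\<exists>r>0. Sheet ` U r \<subseteq> surface_component C"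
    unfolding surface_component_def by (intro exI[of _ r]) blast
qed

text \<open>Each added point is a limit of \<open>Sheet\<close> points of \<open>C\<close>, as its
  neighbourhoods contain nonempty pieces of its end; so the set lies between a connected set and its
  closure.\<close>

lemma surface_component_connectedin:
  assumes C: "C \<in> cover_components"
  shows "connectedin (riemann_surface \<phi>) (surface_component C)"
proof (rule connectedin_intermediate_closure_of)
  have "continuous_map (top_of_set (unbranched_cover \<phi>)) (riemann_surface \<phi>) Sheet"
    unfolding continuous_map
  proof (intro conjI allI impI)
    show "Sheet ` topspace (top_of_set (unbranched_cover \<phi>)) \<subseteq> topspace (riemann_surface \<phi>)"
      by (auto simp: topspace_riemann_surface surface_points_def)
    fix W assume W: "openin (riemann_surface \<phi>) W"
    have "{x \<in> topspace (top_of_set (unbranched_cover \<phi>)). Sheet x \<in> W} = Sheet -` W"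
      using W by (auto simp: openin_riemann_surface surface_points_def)
    then show "openin (top_of_set (unbranched_cover \<phi>)) {x \<in> topspace (top_of_set (unbranched_cover \<phi>)). Sheet x \<in> W}"
      using W by (simp add: openin_riemann_surface)
  qed
  moreover have "connectedin (top_of_set (unbranched_cover \<phi>)) C"
    using in_components_connected[OF C] in_components_subset[OF C] by (simp add: connectedin_subtopology)
  ultimately show "connectedin (riemann_surface \<phi>) (Sheet ` C)" by (rule connectedin_continuous_map_image)
  show "Sheet ` C \<subseteq> surface_component C" by (auto simp: surface_component_def)
  have sp: "surface_component C \<subseteq> surface_points \<phi>"
    using openin_subset[OF surface_component_openin[OF C]] by (simp add: topspace_riemann_surface)
  show "surface_component C \<subseteq> riemann_surface \<phi> closure_of Sheet ` C"
  proof
    fix x assume x: "x \<in> surface_component C"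
    show "x \<in> riemann_surface \<phi> closure_of Sheet ` C"
      unfolding in_closure_of topspace_riemann_surface
    proof (intro conjI allI impI)
      show "x \<in> surface_points \<phi>" using x sp by blast
      fix T assume T: "x \<in> T \<and> openin (riemann_surface \<phi>) T"
      show "\<exists>y. y \<in> Sheet ` C \<and> y \<in> T"
      proof (cases x)
        case (Sheet p)
        then show ?thesis using x T by (auto simp: surface_component_def)
      next
        case (Branch b U)
        then obtain r where r: "U \<in> cover_ends \<phi> b" "r > 0" "U r \<subseteq> C"
          using x by (auto simp: surface_component_def)
        obtain s where s: "s > 0" "Sheet ` U s \<subseteq> T"
        proof -
          have "\<forall>b U. Branch b U \<in> T \<longrightarrow> (\<exists>r>0. Sheet ` U r \<subseteq> T)"
            using T by (simp add: openin_riemann_surface)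
          moreover have "Branch b U \<in> T" using T Branch by simp
          ultimately show ?thesis using that by blast
        qed
        have m: "min r s > 0" using r(2) s(1) by simp
        obtain p where "p \<in> U (min r s)" using cover_end_nonempty[OF r(1) m] by blast
        then have "p \<in> U r" "p \<in> U s"
          using cover_end_mono[OF r(1) m, of r] cover_end_mono[OF r(1) m, of s] by auto
        then show ?thesis using r(3) s(2) by blast
      qed
    qed
  qed
qed

text \<open>At a branch point: pieces of one end at different radii are nested and nonempty, so both
  components contain a common point.\<close>

lemma surface_component_disjoint:
  assumes C: "C \<in> cover_components" and D: "D \<in> cover_components"
    and x: "x \<in> surface_component C" "x \<in> surface_component D"
  shows "C = D"
proof (cases x)
  case (Sheet p)
  then have "p \<in> C \<inter> D" using x by (auto simp: surface_component_def)
  then show ?thesis using components_nonoverlap[OF C D] by blast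
next
  case (Branch b U)
  then obtain r s where r: "U \<in> cover_ends \<phi> b" "r > 0" "U r \<subseteq> C" and s: "s > 0" "U s \<subseteq> D"
    using x by (auto simp: surface_component_def)
  have m: "min r s > 0" using r(2) s(1) by simp
  obtain p where "p \<in> U (min r s)" using cover_end_nonempty[OF r(1) m] by blast
  then have "p \<in> C \<inter> D"
    using cover_end_mono[OF r(1) m, of r] cover_end_mono[OF r(1) m, of s] r(3) s(2) by auto
  then show ?thesis using components_nonoverlap[OF C D] by blast
qed

lemma surface_component_Union: "\<Union>(surface_component ` cover_components) = surface_points \<phi>"
proof
  show "\<Union>(surface_component ` cover_components) \<subseteq> surface_points \<phi>"
    using openin_subset[OF surface_component_openin] by (auto simp: topspace_riemann_surface)
  show "surface_points \<phi> \<subseteq> \<Union>(surface_component ` cover_components)"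
  proof
    fix x assume x: "x \<in> surface_points \<phi>"
    show "x \<in> \<Union>(surface_component ` cover_components)"
    proof (cases x)
      case (Sheet p)
      then have "p \<in> \<Union>cover_components" using x unfolding Union_cover_components by (auto simp: surface_points_def)
      then obtain C where "C \<in> cover_components" "p \<in> C" by blast
      then show ?thesis using Sheet by (intro UN_I[of C]) (auto simp: surface_component_def)
    next
      case (Branch b U)
      then have U: "b \<in> singular_set \<phi>" "U \<in> cover_ends \<phi> b" using x by (auto simp: surface_points_def)
      obtain C where "C \<in> cover_components" "U 1 \<subseteq> C" using cover_end_subset[OF U(2)] by blast
      then have "C \<in> cover_components" "x \<in> surface_component C"
        using U Branch by (auto simp: surface_component_def intro!: exI[of _ 1])
      then show ?thesis by blast
    qed
  qed
qed

text \<open>The sets are open, connected, pairwise disjoint and exhaust the surface; each is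
  therefore also closed, and a connected component cannot leave it.\<close>

theorem connected_components_riemann_surface:
  "connected_components_of (riemann_surface \<phi>) = surface_component ` cover_components"
proof -
  let ?S = "riemann_surface \<phi>"
  have eq: "connected_component_of_set ?S x = surface_component C"
    if C: "C \<in> cover_components" and x: "x \<in> surface_component C" for C x
  proof
    show "surface_component C \<subseteq> connected_component_of_set ?S x"
      by (rule connected_component_of_maximal[OF surface_component_connectedin[OF C] x])
    have "openin ?S (\<Union>(surface_component ` (cover_components - {C})))"
      using surface_component_openin by blast
    also have "\<Union>(surface_component ` (cover_components - {C})) = topspace ?S - surface_component C"
      unfolding topspace_riemann_surface surface_component_Union[symmetric]
      using surface_component_disjoint C by blast
    finally have "closedin ?S (surface_component C)"
      using openin_subset[OF surface_component_openin[OF C]] by (simp add: closedin_def)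
    then have "connected_component_of_set ?S x \<subseteq> surface_component C \<or> disjnt (connected_component_of_set ?S x) (surface_component C)"
      using connectedin_clopen_cases[OF connectedin_connected_component_of _ surface_component_openin[OF C]] by blast
    moreover have "x \<in> connected_component_of_set ?S x"
      using x openin_subset[OF surface_component_openin[OF C]] by (simp add: connected_component_of_refl subset_iff)
    ultimately show "connected_component_of_set ?S x \<subseteq> surface_component C"
      using x by (auto simp: disjnt_def)
  qed
  have "connected_components_of ?S = connected_component_of_set ?S ` \<Union>(surface_component ` cover_components)"
    by (simp add: connected_components_of_def topspace_riemann_surface surface_component_Union)
  also have "\<dots> = surface_component ` cover_components"
  proof (intro equalityI subsetI)
    fix K assume "K \<in> connected_component_of_set ?S ` \<Union>(surface_component ` cover_components)"
    then obtain x C where "C \<in> cover_components" "x \<in> surface_component C" "K = connected_component_of_set ?S x" by blast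
    then show "K \<in> surface_component ` cover_components" using eq by blast
  next
    fix K assume "K \<in> surface_component ` cover_components"
    then obtain C where C: "C \<in> cover_components" "K = surface_component C" by blast
    obtain p where "p \<in> C" using in_components_nonempty[OF C(1)] by blast
    then have x: "Sheet p \<in> surface_component C" by (simp add: surface_component_def)
    then show "K \<in> connected_component_of_set ?S ` \<Union>(surface_component ` cover_components)"
      using eq[OF C(1) x] C by blast
  qed
  finally show ?thesis .
qed

lemma card_connected_components_riemann_surface:
  "card (connected_components_of (riemann_surface \<phi>)) = card cover_components"
proof -
  have "inj_on surface_component cover_components"
  proof (rule inj_onI)
    fix C D assume C: "C \<in> cover_components" "D \<in> cover_components" "surface_component C = surface_component D"
    obtain p where "p \<in> C" using in_components_nonempty[OF C(1)] by blast
    then have "Sheet p \<in> surface_component C" by (simp add: surface_component_def)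
    then show "C = D" using surface_component_disjoint C by metis
  qed
  then show ?thesis unfolding connected_components_riemann_surface by (rule card_image)
qed

end

section \<open>Finite Blaschke products are proper self-maps of the disk\<close>

lemma blaschke_factor_identity:
  "(cmod (1 - cnj a * z))\<^sup>2 - (cmod (z - a))\<^sup>2 = (1 - (cmod a)\<^sup>2) * (1 - (cmod z)\<^sup>2)"
  unfolding cmod_power2 by (simp add: power2_eq_square algebra_simps)

lemma blaschke_factor_denominator:
  assumes "cmod a < 1" "cmod z \<le> 1"
  shows "1 - cnj a * z \<noteq> 0"
proof
  assume "1 - cnj a * z = 0"
  then have "cmod (cnj a * z) = 1" by simp
  moreover have "cmod a * cmod z \<le> cmod a * 1" using assms by (intro mult_left_mono) auto
  ultimately show False using assms by (simp add: norm_mult)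
qed

text \<open>\<open>blaschke_factor_identity\<close> gives the sign of the difference between the
  squared moduli of denominator and numerator.\<close>

lemma blaschke_factor_norm:
  assumes "cmod a < 1"
  shows "cmod z < 1 \<Longrightarrow> cmod ((z - a) / (1 - cnj a * z)) < 1"
    and "cmod z = 1 \<Longrightarrow> cmod ((z - a) / (1 - cnj a * z)) = 1"
proof -
  have a: "1 - (cmod a)\<^sup>2 > 0" using assms by (simp add: abs_square_less_1)
  assume z: "cmod z < 1"
  then have "1 - (cmod z)\<^sup>2 > 0" by (simp add: abs_square_less_1)
  then have "(cmod (z - a))\<^sup>2 < (cmod (1 - cnj a * z))\<^sup>2"
    using blaschke_factor_identity[of a z] mult_pos_pos[OF a, of "1 - (cmod z)\<^sup>2"] by linarith
  then have "cmod (z - a) < cmod (1 - cnj a * z)" by (rule power2_less_imp_less) simp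
  then show "cmod ((z - a) / (1 - cnj a * z)) < 1"
    by (simp add: norm_divide divide_less_eq)
next
  assume z: "cmod z = 1"
  then have "(cmod (z - a))\<^sup>2 = (cmod (1 - cnj a * z))\<^sup>2"
    using blaschke_factor_identity[of a z] by simp
  then have "cmod (z - a) = cmod (1 - cnj a * z)" by (simp add: power2_eq_iff_nonneg)
  then show "cmod ((z - a) / (1 - cnj a * z)) = 1"
    using blaschke_factor_denominator[OF assms, of z] z by (simp add: norm_divide)
qed

text \<open>With the product written as P/Q, where Q has no zero on the closed disk, fibres are
  zeros of \<open>P - smult v Q\<close> and critical points are zeros of the numerator of the
  derivative. The degrees provide \<open>N\<close>.\<close>

theorem blaschke_proper:
  fixes n :: nat and a :: "nat \<Rightarrow> complex"
  assumes n: "n \<ge> 1" and a: "\<forall>j\<in>{1..n}. a j \<in> ball 0 1"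
  shows "\<exists>N. proper_disk_map (blaschke n a) N"
proof -
  define P where "P = (\<Prod>j=1..n. [:- a j, 1:])"
  define Q where "Q = (\<Prod>j=1..n. [:1, - cnj (a j):])"
  let ?\<phi> = "blaschke n a"
  have a1: "cmod (a j) < 1" if "j \<in> {1..n}" for j using a that by simp
  have phi: "?\<phi> z = poly P z / poly Q z" for z
    by (simp add: blaschke_def P_def Q_def poly_prod prod_dividef mult.commute)
  have Q0: "poly Q z \<noteq> 0" if "z \<in> cball 0 1" for z
  proof -
    have "1 - z * cnj (a j) \<noteq> 0" if "j \<in> {1..n}" for j
      using blaschke_factor_denominator[OF a1[OF that], of z] \<open>z \<in> cball 0 1\<close> by (simp add: mult.commute)
    then show ?thesis by (auto simp: Q_def poly_prod)
  qed
  have Q0': "poly Q z \<noteq> 0" if "z \<in> ball 0 1" for z using Q0[of z] that by simp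
  have P0: "P \<noteq> 0" unfolding P_def by (simp add: prod_zero_iff)
  have Pa: "poly P (a 1) = 0" unfolding P_def poly_prod using n by (intro prod_zero) auto
  have a1D: "a 1 \<in> ball 0 1" using a n by simp
  have phi': "?\<phi> = (\<lambda>z. poly P z / poly Q z)" using phi by blast
  have holo: "?\<phi> holomorphic_on ball 0 1"
    unfolding phi' using Q0' by (intro holomorphic_intros) auto
  \<comment> \<open>At \<open>a 1\<close> the polynomial \<open>P\<close> vanishes and
    \<open>Q\<close> does not, so only \<open>v = 0\<close> could fail, and \<open>P\<close> itself
    is nonzero.\<close>
  have nz: "P - smult v Q \<noteq> 0" for v
  proof
    assume eq: "P - smult v Q = 0"
    then have "poly (P - smult v Q) (a 1) = 0" by simp
    then have "v = 0" using Pa Q0'[OF a1D] by simp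
    then show False using eq P0 by simp
  qed
  have fib: "{w \<in> ball 0 1. ?\<phi> w = v} \<subseteq> {w. poly (P - smult v Q) w = 0}" for v
    using Q0' by (auto simp: phi field_simps)
  have fin: "finite {w \<in> ball 0 1. ?\<phi> w = v}" for v
    using fib poly_roots_finite[OF nz] finite_subset by blast
  have "proper_disk_map ?\<phi> (max (degree P) (degree Q))"
  proof
    show "?\<phi> holomorphic_on ball 0 1" by (rule holo)
    show "continuous_on (cball 0 1) ?\<phi>"
      unfolding phi' using Q0 by (intro continuous_intros) auto
    show "cmod (?\<phi> z) < 1" if z: "z \<in> ball 0 1" for z
    proof -
      let ?b = "\<lambda>j. cmod ((z - a j) / (1 - cnj (a j) * z))"
      have b: "?b j < 1" if "j \<in> {1..n}" for j using blaschke_factor_norm(1)[OF a1[OF that]] z by simp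
      have "cmod (?\<phi> z) = (\<Prod>j=1..n. ?b j)" by (simp add: blaschke_def prod_norm)
      also have "\<dots> = ?b 1 * (\<Prod>j\<in>{1..n} - {1}. ?b j)" using n by (intro prod.remove) auto
      also have "\<dots> \<le> ?b 1 * 1"
        using b by (intro mult_left_mono prod_le_1) (auto simp: less_imp_le)
      also have "\<dots> < 1" using b[of 1] n by simp
      finally show ?thesis .
    qed
    show "cmod (?\<phi> z) = 1" if z: "cmod z = 1" for z
    proof -
      have "cmod (?\<phi> z) = (\<Prod>j=1..n. cmod ((z - a j) / (1 - cnj (a j) * z)))"
        by (simp add: blaschke_def prod_norm)
      also have "\<dots> = (\<Prod>j=1..n. 1)"
        using blaschke_factor_norm(2)[OF a1 z] by (intro prod.cong) auto
      finally show ?thesis by simp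
    qed
    show "finite {w \<in> ball 0 1. ?\<phi> w = v}" for v by (rule fin)
    show "card {w \<in> ball 0 1. ?\<phi> w = v} \<le> max (degree P) (degree Q)" for v
    proof -
      have "card {w \<in> ball 0 1. ?\<phi> w = v} \<le> card {w. poly (P - smult v Q) w = 0}"
        by (rule card_mono[OF poly_roots_finite[OF nz] fib])
      also have "\<dots> \<le> degree (P - smult v Q)" by (rule card_poly_roots_bound[OF nz])
      also have "\<dots> \<le> max (degree P) (degree Q)"
        using degree_diff_le_max[of P "smult v Q"] degree_smult_le[of v Q] by arith
      finally show ?thesis .
    qed
    define R where "R = pderiv P * Q - P * pderiv Q"
    have der: "(?\<phi> has_field_derivative poly R z / (poly Q z * poly Q z)) (at z)" if z: "z \<in> ball 0 1" for z
      unfolding phi' R_def using Q0'[OF z]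
      by (auto intro!: derivative_eq_intros poly_DERIV)
    \<comment> \<open>If the numerator vanished identically, the product would be constant on the
      disk and one fibre infinite.\<close>
    have "R \<noteq> 0"
    proof
      assume "R = 0"
      have d0: "(?\<phi> has_field_derivative 0) (at z within ball 0 1)" if "z \<in> ball 0 1" for z
        using has_field_derivative_at_within[OF der[OF that], of "ball 0 1"] \<open>R = 0\<close> by simp
      obtain c where c: "\<forall>z\<in>ball 0 1. ?\<phi> z = c"
        using has_field_derivative_zero_constant[OF convex_ball d0] by metis
      then have "ball 0 1 \<subseteq> {w \<in> ball 0 1. ?\<phi> w = c}" by blast
      then have "finite (ball (0::complex) 1)" using fin by (rule finite_subset)
      then show False using uncountable_ball[of 1 "0::complex"] countable_finite by auto
    qed
    moreover have "critical_points ?\<phi> \<subseteq> {z. poly R z = 0}"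
      using DERIV_imp_deriv[OF der] Q0' by (auto simp: critical_points_def)
    ultimately show "finite (critical_points ?\<phi>)" using poly_roots_finite finite_subset by blast
  qed
  then show ?thesis by blast
qed

text \<open>\<open>inj_on\<close> stands next to independence because the latter concerns a set and
  cannot see two classes with the same operator; together they express independence of the family
  indexed by the classes.\<close>

theorem theorem7p6:
  fixes n q :: nat and a :: "nat \<Rightarrow> complex" and \<phi> :: "complex \<Rightarrow> complex" and z0 :: complex
  assumes "n \<ge> 1"
    and "\<forall>j\<in>{1..n}. a j \<in> ball 0 1"
    and "\<phi> = blaschke n a"
    and "q = card (connected_components_of (riemann_surface \<phi>))"
    and "z0 \<in> regular_set \<phi>"
  shows "finite (connected_components_of (riemann_surface \<phi>)) \<and>
    finite (inverse_classes \<phi> z0) \<and> card (inverse_classes \<phi> z0) = q \<and>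
    (\<forall>K\<in>inverse_classes \<phi> z0. class_op \<phi> z0 K \<in> bounded_ops \<and>
       (\<forall>f. \<forall>z\<in>regular_set \<phi>. bergman_fun (class_op \<phi> z0 K f) z = class_sum \<phi> z0 K f z)) \<and>
    inj_on (class_op \<phi> z0) (inverse_classes \<phi> z0) \<and>
    ops.independent (class_op \<phi> z0 ` inverse_classes \<phi> z0) \<and>
    von_neumann_algebra (blaschke_algebra \<phi>) \<and>
    von_neumann_generated (class_op \<phi> z0 ` inverse_classes \<phi> z0) = blaschke_algebra \<phi> \<and>
    ops.span (class_op \<phi> z0 ` inverse_classes \<phi> z0) = blaschke_algebra \<phi> \<and>
    ops.dim (blaschke_algebra \<phi>) = q"
proof -
  obtain N where "proper_disk_map \<phi> N" using blaschke_proper assms(1-3) by blast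
  then interpret proper_disk_map \<phi> N .
  note z0 = assms(5)
  have q: "q = card cover_components" using assms(4) card_connected_components_riemann_surface by simp
  have fin: "finite cover_components" by (rule finite_cover_components[OF z0])
  \<comment> \<open>Reduces the claims on classes of germs to the results on component
    operators.\<close>
  have image: "class_op \<phi> z0 ` inverse_classes \<phi> z0 = component_op ` cover_components"
    unfolding inverse_classes_eq[OF z0] image_image using class_op_eq[OF _ z0] by simp
  have inj: "inj_on (class_op \<phi> z0) (inverse_classes \<phi> z0)"
  proof (rule inj_onI)
    fix K L assume KL: "K \<in> inverse_classes \<phi> z0" "L \<in> inverse_classes \<phi> z0" "class_op \<phi> z0 K = class_op \<phi> z0 L"
    then obtain C D where CD: "C \<in> cover_components" "K = component_class z0 C"
      "D \<in> cover_components" "L = component_class z0 D"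
      unfolding inverse_classes_eq[OF z0] by blast
    then have "component_op C = component_op D" using KL(3) class_op_eq[OF _ z0] by simp
    then show "K = L" using CD inj_onD[OF component_op_inj] by blast
  qed
  have op: "class_op \<phi> z0 K \<in> bounded_ops \<and>
      (\<forall>f. \<forall>z\<in>regular_set \<phi>. bergman_fun (class_op \<phi> z0 K f) z = class_sum \<phi> z0 K f z)"
    if K: "K \<in> inverse_classes \<phi> z0" for K
  proof -
    obtain C where C: "C \<in> cover_components" "K = component_class z0 C"
      using K unfolding inverse_classes_eq[OF z0] by blast
    then show ?thesis
      using component_op_bounded[OF C(1)] component_op_fun[OF C(1)] class_sum_eq[OF C(1) z0] class_op_eq[OF C(1) z0]
      by simp
  qed
  show ?thesis
    unfolding image span_component_op von_neumann_generated_component_op dim_blaschke_algebra q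
    using fin op inj component_op_independent von_neumann_blaschke_algebra
    by (simp add: connected_components_riemann_surface inverse_classes_eq[OF z0] card_image[OF component_class_inj[OF z0]])
qed

end
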